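(* Let $G$ be a countable discrete sofic group with sofic approximation $\Sigma$. Let $(\mathcal{X}^G,\mu,S,d_{\mathcal{X}})$ and $(\mathcal{Y}^G,\nu,S,d_{\mathcal{Y}})$ be metric $G$-processes and let $\Phi:(\mathcal{X}^G,\mu,S)\to(\mathcal{Y}^G,\nu,S)$ be a factor map. If $(\mathcal{X}^G,\mu,S,d_{\mathcal{X}})$ has connected model spaces rel $\Sigma$ and $\Phi$ is model-surjective rel $\Sigma$ (with respect to the metrics $d_{\mathcal{X}},d_{\mathcal{Y}}$), then $(\mathcal{Y}^G,\nu,S,d_{\mathcal{Y}})$ also has connected model spaces rel $\Sigma$. In particular, whether $(\mathcal{X}^G,\mu,S,d_{\mathcal{X}})$ has connected model spaces rel $\Sigma$ depends only on the shift-system $(\mathcal{X}^G,\mu,S)$ and not on the choice of $d_{\mathcal{X}}$, and this property is an isomorphism-invariant: if $(\mathcal{X}^G,\mu,S,d_{\mathcal{X}})$ and $(\mathcal{Y}^G,\nu,S,d_{\mathcal{Y}})$ are metric $G$-processes for which the $G$-systems $(\mathcal{X}^G,\mu,S)$ and $(\mathcal{Y}^G,\nu,S)$ are isomorphic, then one has connected model spaces rel $\Sigma$ if and only if the other does.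
   Context: Sofic approximations and systems. A sofic approximation to $G$ is a sequence $\Sigma=(\sigma_n)_{n\ge 1}$ of maps $\sigma_n:G\to\mathrm{Sym}(V_n)$, $g\mapsto\sigma_n^g$, where $V_n$ are finite sets with $|V_n|\to\infty$, such that for all $g,h\in G$ the proportion of $v\in V_n$ with $\sigma_n^g(\sigma_n^h(v))=\sigma_n^{gh}(v)$ tends to $1$, and for all $g\neq h$ the proportion of $v\in V_n$ with $\sigma_n^g(v)\ne\sigma_n^h(v)$ tends to $1$. A $G$-system $(X,\mu,T)$ is a standard probability space $(X,\mu)$ with a measurable $\mu$-preserving action $T$ of $G$. A factor map between $G$-systems is a measurable map, equivariant a.e., pushing the first measure to the second; it is an isomorphism if it is invertible modulo null sets. Metric $G$-processes. A metric $G$-process $(\mathcal{X}^G,\mu,S,d)$ consists of a standard measurable space $\mathcal{X}$, a compact metric $d$ on $\mathcal{X}$ whose Borel $\sigma$-algebra is that of $\mathcal{X}$, the right-shift action $(S^h x)_g=x_{gh}$ of $G$ on $\mathcal{X}^G$, and an $S$-invariant probability measure $\mu$ on $\mathcal{X}^G$. The weak$^\ast$ topology on $\mathrm{Prob}(\mathcal{X}^G)$ (Borel probability measures) refers to the product topology on $\mathcal{X}^G$ arising from $d$. For finite $V$, $d^{(V)}(\mathbf{x},\mathbf{x}')=\frac1{|V|}\sum_{v\in V}d(x_v,x'_v)$ on $\mathcal{X}^V$. Models. For $\sigma:G\to\mathrm{Sym}(V)$, $v\in V$, $\mathbf{x}\in\mathcal{X}^V$, put $\Pi^\sigma_v(\mathbf{x})=(x_{\sigma^g(v)})_{g\in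 G}\in\mathcal{X}^G$ and $P^\sigma_{\mathbf{x}}=\frac1{|V|}\sum_{v\in V}\delta_{\Pi^\sigma_v(\mathbf{x})}$ (empirical distribution). For a weak$^\ast$-neighbourhood $\mathcal{O}$ of $\mu$, $\Omega(\mathcal{O},\sigma_n)=\{\mathbf{x}\in\mathcal{X}^{V_n}:P^{\sigma_n}_{\mathbf{x}}\in\mathcal{O}\}$. Connected model spaces. A $\delta$-path from $x$ to $y$ in a metric space $(Y,d_Y)$ is a finite sequence $x=x_0,\dots,x_\ell=y$ with $d_Y(x_i,x_{i+1})<\delta$ for all $0\le i<\ell$. A metric $G$-process $(\mathcal{X}^G,\mu,S,d)$ has connected model spaces rel $\Sigma$ if: whenever $n_1<n_2<\cdots$ and $\mathbf{x}_i,\mathbf{y}_i\in\mathcal{X}^{V_{n_i}}$ satisfy $P^{\sigma_{n_i}}_{\mathbf{x}_i}\to\mu$ and $P^{\sigma_{n_i}}_{\mathbf{y}_i}\to\mu$ weak$^\ast$, there are $\delta_i\downarrow0$ and $\delta_i$-paths $\mathbf{x}_i=\mathbf{x}_{i,0},\dots,\mathbf{x}_{i,\ell_i}=\mathbf{y}_i$ in $(\mathcal{X}^{V_{n_i}},d^{(V_{n_i})})$ such that for every weak$^\ast$-neighbourhood $\mathcal{O}$ of $\mu$ we have $\{\mathbf{x}_{i,j}:0\le j\le\ell_i\}\subseteq\Omega(\mathcal{O},\sigma_{n_i})$ for all sufficiently large $i$. Model-surjectivity. For a factor map $\Phi:(\mathcal{X}^G,\mu,S)\to(\mathcal{Y}^G,\nu,S)$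 between metric $G$-processes, let $\lambda=\int\delta_{(x,\Phi(x))}\,\mu(dx)$ be its graphical joining, a measure on $\mathcal{X}^G\times\mathcal{Y}^G=(\mathcal{X}\times\mathcal{Y})^G$. $\Phi$ is model-surjective rel $\Sigma$ if, whenever $n_1<n_2<\cdots$ and $\mathbf{y}_i\in\mathcal{Y}^{V_{n_i}}$ satisfy $P^{\sigma_{n_i}}_{\mathbf{y}_i}\to\nu$ weak$^\ast$, there are $\mathbf{x}_i\in\mathcal{X}^{V_{n_i}}$ with $P^{\sigma_{n_i}}_{(\mathbf{x}_i,\mathbf{y}_i)}\to\lambda$ weak$^\ast$, for the product topology on $\mathcal{X}^G\times\mathcal{Y}^G$. *)

theory Defs
  imports
    "HOL-Analysis.Analysis"
    "HOL-Probability.Probability_Measure"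
    "HOL-Algebra.Group"
begin

text \<open>
  All the finite sets \<open>V n\<close> live in one type; this loses nothing, as any sequence of finite sets
  embeds into a single countable type.  The value \<open>\<sigma> n g v\<close> is irrelevant for \<open>v \<notin> V n\<close>, so
  membership in the symmetric group of \<open>V n\<close> is expressed by \<^term>\<open>bij_betw\<close>.
\<close>

definition sofic_approximation ::
    "('g, 'm) monoid_scheme \<Rightarrow> (nat \<Rightarrow> 'v set) \<Rightarrow> (nat \<Rightarrow> 'g \<Rightarrow> 'v \<Rightarrow> 'v) \<Rightarrow> bool" where
  "sofic_approximation G V \<sigma> \<longleftrightarrow>
     (\<forall>n. finite (V n)) \<and>
     filterlim (\<lambda>n. card (V n)) at_top sequentially \<and>
     (\<forall>n. \<forall>g\<in>carrier G. bij_betw (\<sigma> n g) (V n) (V n)) \<and>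
     (\<forall>g\<in>carrier G. \<forall>h\<in>carrier G.
        (\<lambda>n. real (card {v \<in> V n. \<sigma> n g (\<sigma> n h v) = \<sigma> n (g \<otimes>\<^bsub>G\<^esub> h) v}) / real (card (V n)))
          \<longlonglongrightarrow> 1) \<and>
     (\<forall>g\<in>carrier G. \<forall>h\<in>carrier G. g \<noteq> h \<longrightarrow>
        (\<lambda>n. real (card {v \<in> V n. \<sigma> n g v \<noteq> \<sigma> n h v}) / real (card (V n))) \<longlonglongrightarrow> 1)"

definition factor_map ::
    "('g, 'm) monoid_scheme \<Rightarrow> 'a measure \<Rightarrow> ('g \<Rightarrow> 'a \<Rightarrow> 'a) \<Rightarrow> 'b measure \<Rightarrow> ('g \<Rightarrow> 'b \<Rightarrow> 'b)
      \<Rightarrow> ('a \<Rightarrow> 'b) \<Rightarrow> bool" where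
  "factor_map G M T N U \<Phi> \<longleftrightarrow>
     \<Phi> \<in> measurable M N \<and>
     (\<forall>g\<in>carrier G. AE x in M. \<Phi> (T g x) = U g (\<Phi> x)) \<and>
     distr M N \<Phi> = N"

definition isomorphic_systems ::
    "('g, 'm) monoid_scheme \<Rightarrow> 'a measure \<Rightarrow> ('g \<Rightarrow> 'a \<Rightarrow> 'a) \<Rightarrow> 'b measure \<Rightarrow> ('g \<Rightarrow> 'b \<Rightarrow> 'b)
      \<Rightarrow> bool" where
  "isomorphic_systems G M T N U \<longleftrightarrow>
     (\<exists>\<Phi> \<Psi>. factor_map G M T N U \<Phi> \<and> \<Psi> \<in> measurable N M \<and>
        (AE x in M. \<Psi> (\<Phi> x) = x) \<and> (AE y in N. \<Phi> (\<Psi> y) = y))"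

definition borel_of :: "'a topology \<Rightarrow> 'a measure" where
  "borel_of T = sigma (topspace T) {U. openin T U}"

definition borel_probs :: "'a topology \<Rightarrow> 'a measure set" where
  "borel_probs T = {M. prob_space M \<and> sets M = sets (borel_of T)}"

text \<open>
  The coarsest topology on the Borel probability measures for which integration against every
  continuous real function is continuous.  It is only used for compact \<open>T\<close>, so boundedness of the
  test functions is automatic.
\<close>

definition weak_star_topology :: "'a topology \<Rightarrow> 'a measure topology" where
  "weak_star_topology T =
     topology_generated_by
       {{M \<in> borel_probs T. (\<integral>x. f x \<partial>M) \<in> U} | f U.
          continuous_map T euclideanreal f \<and> open (U :: real set)}"

definition weak_star_nhd :: "'a topology \<Rightarrow> 'a measure \<Rightarrow> 'a measure set \<Rightarrow> bool" where
  "weak_star_nhd T \<mu> \<O> \<longleftrightarrow> \<O> \<subseteq> borel_probs T \<and>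
     (\<exists>\<U>. openin (weak_star_topology T) \<U> \<and> \<mu> \<in> \<U> \<and> \<U> \<subseteq> \<O>)"

definition standard_measurable_space :: "'a measure \<Rightarrow> bool" where
  "standard_measurable_space M \<longleftrightarrow>
     (\<exists>T. completely_metrizable_space T \<and> second_countable T \<and>
          topspace T = space M \<and> sets M = sets (borel_of T))"

abbreviation metric_topology :: "'a measure \<Rightarrow> ('a \<Rightarrow> 'a \<Rightarrow> real) \<Rightarrow> 'a topology" where
  "metric_topology X d \<equiv> Metric_space.mtopology (space X) d"

text \<open>
  In what follows a measurable space is given by a value of type \<^typ>\<open>'x measure\<close> of which only
  the underlying set and \<open>\<sigma>\<close>-algebra matter, and the points of its \<open>G\<close>-th power are the
  functions on \<^term>\<open>carrier G\<close> extended by \<^term>\<open>undefined\<close>, as in \<^const>\<open>PiM\<close> and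
  \<^const>\<open>product_topology\<close>.
\<close>

definition shift :: "('g, 'm) monoid_scheme \<Rightarrow> 'g \<Rightarrow> ('g \<Rightarrow> 'x) \<Rightarrow> ('g \<Rightarrow> 'x)" where
  "shift G h x = (\<lambda>g\<in>carrier G. x (g \<otimes>\<^bsub>G\<^esub> h))"

definition metric_process ::
    "('g, 'm) monoid_scheme \<Rightarrow> 'x measure \<Rightarrow> ('g \<Rightarrow> 'x) measure \<Rightarrow> ('x \<Rightarrow> 'x \<Rightarrow> real) \<Rightarrow> bool" where
  "metric_process G X \<mu> d \<longleftrightarrow>
     standard_measurable_space X \<and>
     Metric_space (space X) d \<and>
     compact_space (metric_topology X d) \<and>
     sets X = sets (borel_of (metric_topology X d)) \<and>
     prob_space \<mu> \<and>
     sets \<mu> = sets (PiM (carrier G) (\<lambda>_. X)) \<and>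
     (\<forall>h\<in>carrier G. distr \<mu> \<mu> (shift G h) = \<mu>)"

abbreviation process_topology ::
    "('g, 'm) monoid_scheme \<Rightarrow> 'x measure \<Rightarrow> ('x \<Rightarrow> 'x \<Rightarrow> real) \<Rightarrow> ('g \<Rightarrow> 'x) topology" where
  "process_topology G X d \<equiv> product_topology (\<lambda>_. metric_topology X d) (carrier G)"

definition average_dist :: "'v set \<Rightarrow> ('x \<Rightarrow> 'x \<Rightarrow> real) \<Rightarrow> ('v \<Rightarrow> 'x) \<Rightarrow> ('v \<Rightarrow> 'x) \<Rightarrow> real" where
  "average_dist V d x x' = (\<Sum>v\<in>V. d (x v) (x' v)) / real (card V)"

definition pullback_name ::
    "('g, 'm) monoid_scheme \<Rightarrow> ('g \<Rightarrow> 'v \<Rightarrow> 'v) \<Rightarrow> 'v \<Rightarrow> ('v \<Rightarrow> 'x) \<Rightarrow> ('g \<Rightarrow> 'x)" where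
  "pullback_name G \<sigma> v x = (\<lambda>g\<in>carrier G. x (\<sigma> g v))"

text \<open>
  The average of the point masses at \<^term>\<open>pullback_name G \<sigma> v x\<close> over \<open>v \<in> V\<close>, written as the
  image of the uniform distribution on \<open>V\<close>.
\<close>

definition empirical ::
    "('g, 'm) monoid_scheme \<Rightarrow> 'x measure \<Rightarrow> 'v set \<Rightarrow> ('g \<Rightarrow> 'v \<Rightarrow> 'v) \<Rightarrow> ('v \<Rightarrow> 'x)
      \<Rightarrow> ('g \<Rightarrow> 'x) measure" where
  "empirical G X V \<sigma> x =
     distr (uniform_count_measure V) (PiM (carrier G) (\<lambda>_. X)) (\<lambda>v. pullback_name G \<sigma> v x)"

definition good_models ::
    "('g, 'm) monoid_scheme \<Rightarrow> 'x measure \<Rightarrow> 'v set \<Rightarrow> ('g \<Rightarrow> 'v \<Rightarrow> 'v) \<Rightarrow> ('g \<Rightarrow> 'x) measure set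
      \<Rightarrow> ('v \<Rightarrow> 'x) set" where
  "good_models G X V \<sigma> \<O> = {x \<in> V \<rightarrow>\<^sub>E space X. empirical G X V \<sigma> x \<in> \<O>}"

definition delta_path ::
    "'a set \<Rightarrow> ('a \<Rightarrow> 'a \<Rightarrow> real) \<Rightarrow> real \<Rightarrow> nat \<Rightarrow> (nat \<Rightarrow> 'a) \<Rightarrow> 'a \<Rightarrow> 'a \<Rightarrow> bool" where
  "delta_path Y d \<delta> l p x y \<longleftrightarrow>
     p 0 = x \<and> p l = y \<and> (\<forall>j\<le>l. p j \<in> Y) \<and> (\<forall>j<l. d (p j) (p (Suc j)) < \<delta>)"

definition connected_model_spaces ::
    "('g, 'm) monoid_scheme \<Rightarrow> (nat \<Rightarrow> 'v set) \<Rightarrow> (nat \<Rightarrow> 'g \<Rightarrow> 'v \<Rightarrow> 'v)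
      \<Rightarrow> 'x measure \<Rightarrow> ('g \<Rightarrow> 'x) measure \<Rightarrow> ('x \<Rightarrow> 'x \<Rightarrow> real) \<Rightarrow> bool" where
  "connected_model_spaces G V \<sigma> X \<mu> d \<longleftrightarrow>
     (\<forall>(n :: nat \<Rightarrow> nat) x y.
        strict_mono n \<and>
        (\<forall>i. x i \<in> V (n i) \<rightarrow>\<^sub>E space X) \<and>
        (\<forall>i. y i \<in> V (n i) \<rightarrow>\<^sub>E space X) \<and>
        limitin (weak_star_topology (process_topology G X d))
          (\<lambda>i. empirical G X (V (n i)) (\<sigma> (n i)) (x i)) \<mu> sequentially \<and>
        limitin (weak_star_topology (process_topology G X d))
          (\<lambda>i. empirical G X (V (n i)) (\<sigma> (n i)) (y i)) \<mu> sequentially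
        \<longrightarrow>
        (\<exists>(\<delta> :: nat \<Rightarrow> real) l p.
           (\<forall>i. 0 < \<delta> i) \<and> decseq \<delta> \<and> \<delta> \<longlonglongrightarrow> 0 \<and>
           (\<forall>i. delta_path (V (n i) \<rightarrow>\<^sub>E space X) (average_dist (V (n i)) d) (\<delta> i)
                  (l i) (p i) (x i) (y i)) \<and>
           (\<forall>\<O>. weak_star_nhd (process_topology G X d) \<mu> \<O> \<longrightarrow>
              (\<forall>\<^sub>F i in sequentially.
                 {p i j | j. j \<le> l i} \<subseteq> good_models G X (V (n i)) (\<sigma> (n i)) \<O>))))"

text \<open>
  The spaces \<open>X\<^sup>G \<times> Y\<^sup>G\<close> and \<open>(X \<times> Y)\<^sup>G\<close> are identified; all joint objects are placed on the latter.
\<close>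

definition graphical_joining ::
    "('g, 'm) monoid_scheme \<Rightarrow> 'x measure \<Rightarrow> ('g \<Rightarrow> 'x) measure \<Rightarrow> 'y measure
      \<Rightarrow> (('g \<Rightarrow> 'x) \<Rightarrow> ('g \<Rightarrow> 'y)) \<Rightarrow> ('g \<Rightarrow> 'x \<times> 'y) measure" where
  "graphical_joining G X \<mu> Y \<Phi> =
     distr \<mu> (PiM (carrier G) (\<lambda>_. X \<Otimes>\<^sub>M Y)) (\<lambda>x. \<lambda>g\<in>carrier G. (x g, \<Phi> x g))"

abbreviation joint_topology ::
    "('g, 'm) monoid_scheme \<Rightarrow> 'x measure \<Rightarrow> ('x \<Rightarrow> 'x \<Rightarrow> real) \<Rightarrow> 'y measure \<Rightarrow> ('y \<Rightarrow> 'y \<Rightarrow> real)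
      \<Rightarrow> ('g \<Rightarrow> 'x \<times> 'y) topology" where
  "joint_topology G X dX Y dY \<equiv>
     product_topology (\<lambda>_. prod_topology (metric_topology X dX) (metric_topology Y dY)) (carrier G)"

definition model_surjective ::
    "('g, 'm) monoid_scheme \<Rightarrow> (nat \<Rightarrow> 'v set) \<Rightarrow> (nat \<Rightarrow> 'g \<Rightarrow> 'v \<Rightarrow> 'v)
      \<Rightarrow> 'x measure \<Rightarrow> ('g \<Rightarrow> 'x) measure \<Rightarrow> ('x \<Rightarrow> 'x \<Rightarrow> real)
      \<Rightarrow> 'y measure \<Rightarrow> ('g \<Rightarrow> 'y) measure \<Rightarrow> ('y \<Rightarrow> 'y \<Rightarrow> real)
      \<Rightarrow> (('g \<Rightarrow> 'x) \<Rightarrow> ('g \<Rightarrow> 'y)) \<Rightarrow> bool" where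
  "model_surjective G V \<sigma> X \<mu> dX Y \<nu> dY \<Phi> \<longleftrightarrow>
     (\<forall>(n :: nat \<Rightarrow> nat) y.
        strict_mono n \<and>
        (\<forall>i. y i \<in> V (n i) \<rightarrow>\<^sub>E space Y) \<and>
        limitin (weak_star_topology (process_topology G Y dY))
          (\<lambda>i. empirical G Y (V (n i)) (\<sigma> (n i)) (y i)) \<nu> sequentially
        \<longrightarrow>
        (\<exists>x. (\<forall>i. x i \<in> V (n i) \<rightarrow>\<^sub>E space X) \<and>
           limitin (weak_star_topology (joint_topology G X dX Y dY))
             (\<lambda>i. empirical G (X \<Otimes>\<^sub>M Y) (V (n i)) (\<sigma> (n i)) (\<lambda>v\<in>V (n i). (x i v, y i v)))
             (graphical_joining G X \<mu> Y \<Phi>) sequentially))"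

end

theory Submission
  imports Defs
begin

text \<open>
  Two models \<open>y\<close>, \<open>y'\<close> of \<open>\<nu>\<close> lift, by model-surjectivity, to models \<open>x\<close>, \<open>x'\<close> of \<open>\<mu>\<close> such that the
  pairs converge to the graphical joining \<open>\<lambda>\<close> of \<open>\<Phi>\<close>.  Connectedness upstairs joins \<open>x\<close> to \<open>x'\<close> by a
  path of good models with small steps, and that path has to be pushed down to \<open>Y\<close>.  Asymptotically
  \<open>\<lambda>\<close> acts like the graph of a continuous map between model spaces:

  \<^item> (\<open>models_lift\<close>) every sequence of models of \<open>\<mu>\<close> can be completed by \<open>Y\<close>-valued configurations to
    pairs that converge to \<open>\<lambda>\<close>;

  \<^item> (\<open>average_dist_vanishes\<close>) if the \<open>X\<close>-halves of two such pairs are close in the average distance,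
    then so are the \<open>Y\<close>-halves.

  So one completes every point of the path upstairs.  Consecutive completions are close by the second
  fact, and so are the ends of the new path and the given \<open>y\<close>, \<open>y'\<close>, because those complete the same
  \<open>x\<close>, \<open>x'\<close>.  This is \<open>connected_transfer\<close>.

  The map \<open>\<Phi>\<close> is only measurable, and it may have no good approximation by continuous \<open>Y\<close>-valued
  functions at all, for instance if \<open>X\<close> is connected and \<open>Y\<close> is finite.  Its graph can nevertheless be
  approximated by a real function: for the points \<open>r\<close> of a finite net of \<open>Y\<close> one takes continuous real
  functions \<open>h r\<close> that are close in the mean to \<open>p \<mapsto> d (r, \<Phi>(p)\<^sub>1)\<close>, and sets
  \<open>D p u = (\<Sum>r. \<bar>d (r, u) - h r p\<bar>)\<close> for \<open>p \<in> X\<^sup>G\<close> and \<open>u \<in> Y\<close>.  Then \<open>D\<close> is continuous, has small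
  mean along \<open>\<lambda>\<close>, and two letters at which \<open>D p\<close> is small are close to each other.  A completion of a
  model is obtained by letting \<open>y(v)\<close> almost minimise \<open>D p\<close> at the name \<open>p\<close> of \<open>v\<close>.

  If \<open>\<Phi>\<close> has an inverse modulo null sets then the roles of the two processes in \<open>\<lambda>\<close> can be exchanged,
  and \<open>models_lift\<close> for the inverse is precisely model-surjectivity of \<open>\<Phi>\<close>.  Hence isomorphisms preserve
  connected model spaces in both directions.  A change of the metric is the case of the identity map,
  which is a measurable isomorphism although it need not be continuous.

  Good models on a whole path are required uniformly in the position on the path.  This uniformity is
  convergence along a single filter on pairs of a stage and a position (\<open>path_filter\<close>); for that reason
  the two facts above are proved for models indexed along an arbitrary filter.
\<close>

section \<open>Borel sets of second countable spaces\<close>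

lemma (in Metric_space) second_countable_compact:
  assumes "compact_space mtopology"
  shows "second_countable mtopology"
proof -
  have tb: "\<exists>K. finite K \<and> K \<subseteq> M \<and> M \<subseteq> (\<Union>x\<in>K. mball x (1 / real (Suc n)))" for n
    using compactin_imp_mtotally_bounded[of M] assms
    by (simp add: compact_space_def mtotally_bounded_def)
  then obtain K where K: "\<And>n. finite (K n)" "\<And>n. K n \<subseteq> M"
      "\<And>n. M \<subseteq> (\<Union>x\<in>K n. mball x (1 / real (Suc n)))"
    by metis
  define \<B> where "\<B> = (\<Union>n. (\<lambda>x. mball x (1 / real (Suc n))) ` K n)"
  have "countable \<B>"
    unfolding \<B>_def by (intro countable_UN countable_image countable_finite[OF K(1)]) auto
  moreover have "\<exists>B\<in>\<B>. x \<in> B \<and> B \<subseteq> U" if U: "openin mtopology U" "x \<in> U" for U x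
  proof -
    obtain r where r: "r > 0" "mball x r \<subseteq> U" "x \<in> M"
      using U unfolding openin_mtopology by (meson subsetD)
    obtain n where n: "1 / real (Suc n) < r / 2"
      using reals_Archimedean[of "r / 2"] r by (auto simp: inverse_eq_divide)
    obtain c where c: "c \<in> K n" "x \<in> mball c (1 / real (Suc n))"
      using K(3)[of n] r(3) by auto
    have "mball c (1 / real (Suc n)) \<subseteq> mball x r"
    proof
      fix z assume z: "z \<in> mball c (1 / real (Suc n))"
      have "d x z \<le> d x c + d c z" using z c r(3) by (intro triangle) auto
      also have "\<dots> < r" using z c n by (auto simp: commute)
      finally show "z \<in> mball x r" using z r(3) by auto
    qed
    then show ?thesis
      using c r(2) unfolding \<B>_def by blast
  qed
  ultimately show ?thesis
    unfolding second_countable_def \<B>_def by (intro exI[of _ \<B>]) (auto simp: \<B>_def)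
qed

lemma sets_borel_of: "sets (borel_of T) = sigma_sets (topspace T) {U. openin T U}"
  unfolding borel_of_def by (rule sets_measure_of) (auto dest: openin_subset)

lemma space_borel_of [simp]: "space (borel_of T) = topspace T"
  unfolding borel_of_def by (rule space_measure_of) (auto dest: openin_subset)

lemma openin_sets_borel_of: "openin T U \<Longrightarrow> U \<in> sets (borel_of T)"
  by (auto simp: sets_borel_of)

lemma measurable_continuous_map:
  assumes "continuous_map T T' f"
  shows "f \<in> borel_of T \<rightarrow>\<^sub>M borel_of T'"
  unfolding borel_of_def[of T']
proof (rule measurable_measure_of)
  fix U assume "U \<in> {U. openin T' U}"
  then show "f -` U \<inter> space (borel_of T) \<in> sets (borel_of T)"
    using openin_continuous_map_preimage[OF assms, of U]
    by (auto intro!: openin_sets_borel_of simp: vimage_def Collect_conj_eq Int_commute)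
qed (use assms in \<open>auto dest: openin_subset simp: continuous_map_def\<close>)

lemma borel_of_euclidean: "sets (borel_of euclidean) = sets borel"
  by (simp add: sets_borel_of borel_def)

lemma borel_measurable_continuous_map:
  assumes "continuous_map T euclidean f" "sets M = sets (borel_of T)"
  shows "f \<in> borel_measurable M"
  using measurable_continuous_map[OF assms(1)]
  by (subst measurable_cong_sets[OF assms(2) borel_of_euclidean[symmetric]])

lemma second_countableE:
  assumes "second_countable T"
  obtains \<B> where "countable \<B>" "\<And>V. V \<in> \<B> \<Longrightarrow> openin T V"
    "\<And>U x. openin T U \<Longrightarrow> x \<in> U \<Longrightarrow> \<exists>V\<in>\<B>. x \<in> V \<and> V \<subseteq> U"
proof -
  obtain \<B> where "countable \<B> \<and> (\<forall>V\<in>\<B>. openin T V) \<and>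
      (\<forall>U x. openin T U \<and> x \<in> U \<longrightarrow> (\<exists>V\<in>\<B>. x \<in> V \<and> V \<subseteq> U))"
    using assms unfolding second_countable_def by (elim exE)
  then show ?thesis by (intro that[of \<B>]) simp_all
qed

lemma sets_le_if_measurable_id:
  assumes "(\<lambda>x. x) \<in> M \<rightarrow>\<^sub>M N" "space N = space M"
  shows "sets N \<subseteq> sets M"
proof
  fix A assume A: "A \<in> sets N"
  then have "A \<inter> space M = A" using sets.sets_into_space[OF A] assms(2) by blast
  then show "A \<in> sets M" using measurable_sets[OF assms(1) A] by simp
qed

lemma second_countable_open_decomposition:
  assumes "countable \<B>" "\<And>x. x \<in> U \<Longrightarrow> \<exists>B\<in>\<B>. x \<in> B \<and> B \<subseteq> U" "\<B> \<subseteq> sets M"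
  shows "U \<in> sets M"
proof -
  have "U = \<Union>{B\<in>\<B>. B \<subseteq> U}" using assms(2) by blast
  moreover have "\<Union>{B\<in>\<B>. B \<subseteq> U} \<in> sets M"
    using assms(1,3) by (intro sets.countable_Union) (auto intro: countable_subset)
  ultimately show ?thesis by metis
qed

text \<open>
  An open subset of a countable product is a union of boxes whose sides come from countable bases, and
  there are only countably many such boxes; so it belongs to the product \<open>\<sigma>\<close>-algebra.
\<close>

lemma sets_PiM_borel_of:
  assumes I: "countable I"
    and sc: "\<And>i. i \<in> I \<Longrightarrow> second_countable (T i)"
    and M: "\<And>i. i \<in> I \<Longrightarrow> sets (M i) = sets (borel_of (T i))"
  shows "sets (PiM I M) = sets (borel_of (product_topology T I))"
proof
  have spM: "space (M i) = topspace (T i)" if "i \<in> I" for i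
    using sets_eq_imp_space_eq[OF M[OF that]] by simp
  have sp: "space (PiM I M) = topspace (product_topology T I)"
    using spM by (simp add: space_PiM cong: PiE_cong)
  have "(\<lambda>x. x) \<in> measurable (borel_of (product_topology T I)) (PiM I M)"
  proof (rule measurable_PiM_single)
    fix A i assume i: "i \<in> I" "A \<in> sets (M i)"
    have "(\<lambda>x. x i) \<in> borel_of (product_topology T I) \<rightarrow>\<^sub>M M i"
      using measurable_continuous_map[OF continuous_map_product_projection[OF i(1), of T]]
        measurable_cong_sets[OF refl M[OF i(1)]] by blast
    from measurable_sets[OF this i(2)]
    show "{\<omega> \<in> space (borel_of (product_topology T I)). \<omega> i \<in> A}
        \<in> sets (borel_of (product_topology T I))"
      by (simp add: vimage_def Int_def conj_commute)
  qed (use sp in \<open>auto simp: space_PiM\<close>)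
  then show "sets (PiM I M) \<subseteq> sets (borel_of (product_topology T I))"
    by (rule sets_le_if_measurable_id) (simp add: sp)
  have "\<forall>i\<in>I. \<exists>\<B>. countable \<B> \<and> (\<forall>V\<in>\<B>. openin (T i) V) \<and>
      (\<forall>U x. openin (T i) U \<and> x \<in> U \<longrightarrow> (\<exists>V\<in>\<B>. x \<in> V \<and> V \<subseteq> U))"
    using sc by (simp add: second_countable_def)
  then obtain \<B> where B: "\<And>i. i \<in> I \<Longrightarrow> countable (\<B> i)"
      "\<And>i V. i \<in> I \<Longrightarrow> V \<in> \<B> i \<Longrightarrow> openin (T i) V"
      "\<And>i U x. i \<in> I \<Longrightarrow> openin (T i) U \<Longrightarrow> x \<in> U \<Longrightarrow> \<exists>V\<in>\<B> i. x \<in> V \<and> V \<subseteq> U"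
    by metis
  define box where "box S = {x \<in> topspace (product_topology T I). \<forall>(i, V)\<in>S. x i \<in> V}" for S
  define \<C> where "\<C> = box ` {S. S \<subseteq> (SIGMA i:I. \<B> i) \<and> finite S}"
  have cC: "countable \<C>"
    unfolding \<C>_def
  proof (intro countable_image)
    have "countable (SIGMA i:I. \<B> i)" using I B(1) by (rule countable_SIGMA)
    from countable_Collect_finite_subset[OF this]
    show "countable {S. S \<subseteq> (SIGMA i:I. \<B> i) \<and> finite S}" by (simp add: conj_commute)
  qed
  have CM: "\<C> \<subseteq> sets (PiM I M)"
  proof
    fix C assume "C \<in> \<C>"
    then obtain S where S: "S \<subseteq> (SIGMA i:I. \<B> i)" "finite S" and C: "C = box S"
      unfolding \<C>_def by blast
    have "{x \<in> space (PiM I M). \<forall>s\<in>S. x (fst s) \<in> snd s} \<in> sets (PiM I M)"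
    proof (rule sets.sets_Collect_finite_All[OF _ S(2)])
      fix s assume "s \<in> S"
      then have s: "fst s \<in> I" "snd s \<in> \<B> (fst s)"
        using S(1) by auto
      then have s: "fst s \<in> I" "snd s \<in> sets (M (fst s))"
        using openin_sets_borel_of[OF B(2)] M by auto
      from measurable_sets[OF measurable_component_singleton[OF s(1), of M] s(2)]
      show "{x \<in> space (PiM I M). x (fst s) \<in> snd s} \<in> sets (PiM I M)"
        by (simp add: vimage_def Int_def conj_commute)
    qed
    then show "C \<in> sets (PiM I M)"
      unfolding C box_def sp by (simp add: case_prod_unfold)
  qed
  have "U \<in> sets (PiM I M)" if U: "openin (product_topology T I) U" for U
  proof (rule second_countable_open_decomposition[OF cC _ CM])
    fix x assume x: "x \<in> U"
    then have "\<exists>W. finite {i \<in> I. W i \<noteq> topspace (T i)} \<and> (\<forall>i\<in>I. openin (T i) (W i)) \<and>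
        x \<in> PiE I W \<and> PiE I W \<subseteq> U"
      using U by (simp add: openin_product_topology_alt)
    then obtain W where W: "finite {i \<in> I. W i \<noteq> topspace (T i)}" "\<And>i. i \<in> I \<Longrightarrow> openin (T i) (W i)"
        "x \<in> PiE I W" "PiE I W \<subseteq> U"
      by (elim exE conjE) simp
    define F where "F = {i \<in> I. W i \<noteq> topspace (T i)}"
    have "\<forall>i\<in>F. \<exists>V\<in>\<B> i. x i \<in> V \<and> V \<subseteq> W i"
      using B(3) W unfolding F_def by (simp add: PiE_mem)
    then obtain \<phi> where \<phi>: "\<And>i. i \<in> F \<Longrightarrow> \<phi> i \<in> \<B> i \<and> x i \<in> \<phi> i \<and> \<phi> i \<subseteq> W i"
      by metis
    define S where "S = (\<lambda>i. (i, \<phi> i)) ` F"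
    have S: "S \<subseteq> (SIGMA i:I. \<B> i) \<and> finite S"
      using W(1) \<phi> unfolding S_def F_def by auto
    have xt: "x \<in> topspace (product_topology T I)"
      using x openin_subset[OF U] by blast
    have "box S \<subseteq> PiE I W"
    proof
      fix z assume z: "z \<in> box S"
      show "z \<in> PiE I W"
      proof (rule PiE_I)
        fix i assume i: "i \<in> I"
        show "z i \<in> W i"
        proof (cases "i \<in> F")
          case True
          then show ?thesis using z \<phi>[of i] unfolding box_def S_def by auto
        next
          case False
          then have "W i = topspace (T i)" using i unfolding F_def by simp
          then show ?thesis using z i unfolding box_def by auto
        qed
      qed (use z in \<open>auto simp: box_def\<close>)
    qed
    moreover have "x \<in> box S"
      using xt \<phi> unfolding box_def S_def by auto
    ultimately show "\<exists>C\<in>\<C>. x \<in> C \<and> C \<subseteq> U"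
      using S W(4) unfolding \<C>_def by blast
  qed
  then show "sets (borel_of (product_topology T I)) \<subseteq> sets (PiM I M)"
    unfolding sets_borel_of sp[symmetric] by (intro sets.sigma_sets_subset) auto
qed

text \<open>
  The same countability argument for a product of two factors.
\<close>

lemma sets_pair_borel_of:
  assumes sc: "second_countable T1" "second_countable T2"
    and M: "sets M1 = sets (borel_of T1)" "sets M2 = sets (borel_of T2)"
  shows "sets (M1 \<Otimes>\<^sub>M M2) = sets (borel_of (prod_topology T1 T2))"
proof
  let ?B = "borel_of (prod_topology T1 T2)"
  have sp1: "space M1 = topspace T1" and sp2: "space M2 = topspace T2"
    using sets_eq_imp_space_eq[OF M(1)] sets_eq_imp_space_eq[OF M(2)] by simp_all
  have "fst \<in> ?B \<rightarrow>\<^sub>M M1" "snd \<in> ?B \<rightarrow>\<^sub>M M2"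
    using measurable_continuous_map[OF continuous_map_fst[of T1 T2]] measurable_cong_sets[OF refl M(1)]
      measurable_continuous_map[OF continuous_map_snd[of T1 T2]] measurable_cong_sets[OF refl M(2)]
    by blast+
  then have "(\<lambda>x. x) \<in> ?B \<rightarrow>\<^sub>M M1 \<Otimes>\<^sub>M M2"
    by (simp add: measurable_pair_iff comp_def)
  then show "sets (M1 \<Otimes>\<^sub>M M2) \<subseteq> sets ?B"
    by (rule sets_le_if_measurable_id) (simp add: sp1 sp2 space_pair_measure)
  obtain \<B>1 where B1: "countable \<B>1" "\<And>V. V \<in> \<B>1 \<Longrightarrow> openin T1 V"
      "\<And>U x. openin T1 U \<Longrightarrow> x \<in> U \<Longrightarrow> \<exists>V\<in>\<B>1. x \<in> V \<and> V \<subseteq> U"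
    using second_countableE[OF sc(1)] by metis
  obtain \<B>2 where B2: "countable \<B>2" "\<And>V. V \<in> \<B>2 \<Longrightarrow> openin T2 V"
      "\<And>U x. openin T2 U \<Longrightarrow> x \<in> U \<Longrightarrow> \<exists>V\<in>\<B>2. x \<in> V \<and> V \<subseteq> U"
    using second_countableE[OF sc(2)] by metis
  define \<C> where "\<C> = (\<lambda>(V, W). V \<times> W) ` (\<B>1 \<times> \<B>2)"
  have cC: "countable \<C>" unfolding \<C>_def using B1(1) B2(1) by (intro countable_image) auto
  have CM: "\<C> \<subseteq> sets (M1 \<Otimes>\<^sub>M M2)"
    unfolding \<C>_def using B1(2) B2(2) M by (auto intro!: pair_measureI openin_sets_borel_of)
  have "U \<in> sets (M1 \<Otimes>\<^sub>M M2)" if U: "openin (prod_topology T1 T2) U" for U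
  proof (rule second_countable_open_decomposition[OF cC _ CM])
    fix z assume z: "z \<in> U"
    obtain x y where xy: "z = (x, y)" by fastforce
    then obtain V W where "openin T1 V" "openin T2 W" "x \<in> V" "y \<in> W" "V \<times> W \<subseteq> U"
      using U z openin_prod_topology_alt[of T1 T2 U] by metis
    moreover from this obtain V' W' where "V' \<in> \<B>1" "x \<in> V'" "V' \<subseteq> V" "W' \<in> \<B>2" "y \<in> W'" "W' \<subseteq> W"
      using B1(3) B2(3) by metis
    ultimately show "\<exists>C\<in>\<C>. z \<in> C \<and> C \<subseteq> U"
      unfolding \<C>_def xy by (intro bexI[of _ "V' \<times> W'"]) auto
  qed
  then show "sets ?B \<subseteq> sets (M1 \<Otimes>\<^sub>M M2)"
    unfolding sets_borel_of using sets.sigma_sets_subset[of "{U. openin (prod_topology T1 T2) U}" "M1 \<Otimes>\<^sub>M M2"]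
    by (simp add: sp1 sp2 space_pair_measure subset_iff)
qed

section \<open>Continuous functions on compact spaces\<close>

lemma continuous_map_compact_bounded:
  assumes "compact_space T" "continuous_map T euclideanreal f"
  obtains B where "0 \<le> B" "\<And>x. x \<in> topspace T \<Longrightarrow> \<bar>f x\<bar> \<le> B"
proof -
  have "compact (f ` topspace T)"
    using image_compactin[OF _ assms(2), of "topspace T"] assms(1) by (simp add: compact_space_def)
  then obtain B where "\<forall>y\<in>f ` topspace T. \<bar>y\<bar> \<le> B"
    using compact_imp_bounded bounded_real by blast
  then show ?thesis
    by (intro that[of "max B 0"]) fastforce+
qed

text \<open>
  By the tube lemma, \<open>f p'\<close> is uniformly close to \<open>f p\<close> on the compact factor once \<open>p'\<close> is close to \<open>p\<close>,
  and infima of uniformly close functions are close.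
\<close>

lemma continuous_map_INF_compact:
  fixes f :: "'a \<Rightarrow> 'b \<Rightarrow> real"
  assumes cont: "continuous_map (prod_topology T S) euclideanreal (\<lambda>(p, q). f p q)"
    and S: "compact_space S" "topspace S \<noteq> {}"
  shows "continuous_map T euclideanreal (\<lambda>p. INF q\<in>topspace S. f p q)"
proof -
  have bdd: "bdd_below (f p ` topspace S)" if p: "p \<in> topspace T" for p
  proof -
    have "continuous_map S euclideanreal (f p)"
      using continuous_map_compose[OF _ cont, of S "\<lambda>q. (p, q)"] p
      by (simp add: continuous_map_paired comp_def)
    from continuous_map_compact_bounded[OF S(1) this] obtain B
      where "\<And>q. q \<in> topspace S \<Longrightarrow> \<bar>f p q\<bar> \<le> B" by blast
    then show ?thesis
      by (intro bdd_belowI2[of _ "-B"]) (simp add: abs_le_iff minus_le_iff)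
  qed
  have "\<exists>U. openin T U \<and> p \<in> U \<and> (\<forall>p'\<in>U. \<bar>(INF q\<in>topspace S. f p' q) - (INF q\<in>topspace S. f p q)\<bar> < \<epsilon>)"
    if p: "p \<in> topspace T" and e: "\<epsilon> > 0" for p and \<epsilon> :: real
  proof -
    define g where "g = (\<lambda>(p', q). f p' q - f p q)"
    have "continuous_map (prod_topology T S) euclideanreal g"
    proof -
      have "continuous_map (prod_topology T S) euclideanreal (\<lambda>z. f p (snd z))"
        using continuous_map_compose[OF _ cont, of "prod_topology T S" "\<lambda>z. (p, snd z)"] p
        by (simp add: continuous_map_paired comp_def continuous_map_snd)
      then show ?thesis
        using cont continuous_map_diff unfolding g_def case_prod_unfold by blast
    qed
    then have W: "openin (prod_topology T S) {z \<in> topspace (prod_topology T S). g z \<in> {-\<epsilon>/2<..<\<epsilon>/2}}"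
      by (rule openin_continuous_map_preimage) simp
    obtain U V where U: "openin T U" "p \<in> U" "topspace S \<subseteq> V"
        "U \<times> V \<subseteq> {z \<in> topspace (prod_topology T S). g z \<in> {-\<epsilon>/2<..<\<epsilon>/2}}"
    proof -
      have "{p} \<times> topspace S \<subseteq> {z \<in> topspace (prod_topology T S). g z \<in> {-\<epsilon>/2<..<\<epsilon>/2}}"
        using p e by (auto simp: g_def)
      then show ?thesis
        using tube_lemma_right[OF W, of "topspace S" p] S(1) p that unfolding compact_space_def by blast
    qed
    have close: "\<bar>f p' q - f p q\<bar> < \<epsilon> / 2" if "p' \<in> U" "q \<in> topspace S" for p' q
    proof -
      have "(p', q) \<in> U \<times> V" using U(3) that by auto
      then have "g (p', q) \<in> {-\<epsilon>/2<..<\<epsilon>/2}" using subsetD[OF U(4)] by simp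
      then have "- (\<epsilon>/2) < f p' q - f p q" "f p' q - f p q < \<epsilon>/2" by (simp_all add: g_def)
      then show ?thesis by linarith
    qed
    have "\<bar>(INF q\<in>topspace S. f p' q) - (INF q\<in>topspace S. f p q)\<bar> < \<epsilon>" if p': "p' \<in> U" for p'
    proof -
      have p't: "p' \<in> topspace T" using p' openin_subset[OF U(1)] by blast
      have "(INF q\<in>topspace S. f p' q) - \<epsilon>/2 \<le> (INF q\<in>topspace S. f p q)"
      proof (rule cINF_greatest[OF S(2)])
        fix q assume q: "q \<in> topspace S"
        have "(INF q\<in>topspace S. f p' q) \<le> f p' q" by (rule cINF_lower[OF bdd[OF p't] q])
        then show "(INF q\<in>topspace S. f p' q) - \<epsilon>/2 \<le> f p q" using close[OF p' q] by linarith
      qed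
      moreover have "(INF q\<in>topspace S. f p q) - \<epsilon>/2 \<le> (INF q\<in>topspace S. f p' q)"
      proof (rule cINF_greatest[OF S(2)])
        fix q assume q: "q \<in> topspace S"
        have "(INF q\<in>topspace S. f p q) \<le> f p q" by (rule cINF_lower[OF bdd[OF p] q])
        then show "(INF q\<in>topspace S. f p q) - \<epsilon>/2 \<le> f p' q" using close[OF p' q] by linarith
      qed
      ultimately show ?thesis using e by linarith
    qed
    then show ?thesis using U(1,2) by blast
  qed
  then show ?thesis
    by (simp add: Met_TC.continuous_map_to_metric[unfolded mtopology_is_euclidean]
        dist_real_def abs_minus_commute)
qed

text \<open>
  Uniform continuity on a product, in a form that survives averaging.  Near every point, \<open>K\<close> is
  controlled by finitely many coordinates; by compactness one finite set of coordinates and one radius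
  serve everywhere.  If some coordinate moves by at least that radius, then the oscillation of \<open>K\<close> is
  absorbed by the linear term.
\<close>

lemma (in Metric_space) product_modulus:
  assumes comp: "compact_space mtopology"
    and K: "continuous_map (product_topology (\<lambda>_. mtopology) I) euclideanreal K"
    and e: "\<epsilon> > 0"
  obtains F C where "finite F" "F \<subseteq> I" "0 \<le> C"
    "\<And>z z'. z \<in> I \<rightarrow>\<^sub>E M \<Longrightarrow> z' \<in> I \<rightarrow>\<^sub>E M \<Longrightarrow> \<bar>K z - K z'\<bar> \<le> \<epsilon> + C * (\<Sum>i\<in>F. d (z i) (z' i))"
proof -
  let ?P = "product_topology (\<lambda>_. mtopology) I"
  have compP: "compact_space ?P" using comp by (simp add: compact_space_product_topology)
  have top: "topspace ?P = I \<rightarrow>\<^sub>E M" by simp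
  obtain B where B: "0 \<le> B" "\<And>z. z \<in> I \<rightarrow>\<^sub>E M \<Longrightarrow> \<bar>K z\<bar> \<le> B"
    using continuous_map_compact_bounded[OF compP K] top by metis
  have loc: "\<exists>F r. finite F \<and> F \<subseteq> I \<and> r > 0 \<and>
      (\<forall>z'\<in>I \<rightarrow>\<^sub>E M. (\<forall>i\<in>F. d (z i) (z' i) < 2 * r) \<longrightarrow> \<bar>K z' - K z\<bar> < \<epsilon> / 2)"
    if z: "z \<in> I \<rightarrow>\<^sub>E M" for z
  proof -
    let ?U = "{z' \<in> topspace ?P. K z' \<in> {K z - \<epsilon>/2<..<K z + \<epsilon>/2}}"
    have "openin ?P ?U" by (rule openin_continuous_map_preimage[OF K]) simp
    moreover have "z \<in> ?U" using z e by simp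
    ultimately have "\<exists>W. finite {i \<in> I. W i \<noteq> topspace mtopology} \<and> (\<forall>i\<in>I. openin mtopology (W i)) \<and>
        z \<in> PiE I W \<and> PiE I W \<subseteq> ?U"
      unfolding openin_product_topology_alt by (rule bspec)
    then obtain W where W: "finite {i \<in> I. W i \<noteq> M}" "\<And>i. i \<in> I \<Longrightarrow> openin mtopology (W i)"
        "z \<in> PiE I W" "PiE I W \<subseteq> ?U"
      by (elim exE conjE) simp
    define F where "F = {i \<in> I. W i \<noteq> M}"
    have "\<forall>i\<in>F. \<exists>r>0. mball (z i) r \<subseteq> W i"
    proof
      fix i assume "i \<in> F"
      then have "openin mtopology (W i)" "z i \<in> W i" using W(2,3) unfolding F_def by auto
      then show "\<exists>r>0. mball (z i) r \<subseteq> W i" unfolding openin_mtopology by blast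
    qed
    then obtain \<rho> where \<rho>: "\<And>i. i \<in> F \<Longrightarrow> \<rho> i > 0" "\<And>i. i \<in> F \<Longrightarrow> mball (z i) (\<rho> i) \<subseteq> W i"
      by metis
    have F: "finite F" "F \<subseteq> I" using W(1) unfolding F_def by auto
    define r where "r = Min (insert 1 (\<rho> ` F)) / 2"
    have r: "r > 0" unfolding r_def using F(1) \<rho>(1) by (simp add: Min_gr_iff)
    have r': "2 * r \<le> \<rho> i" if "i \<in> F" for i unfolding r_def using F(1) that by (simp add: Min_le)
    have "\<bar>K z' - K z\<bar> < \<epsilon> / 2" if z': "z' \<in> I \<rightarrow>\<^sub>E M" "\<forall>i\<in>F. d (z i) (z' i) < 2 * r" for z'
    proof -
      have "z' \<in> PiE I W"
      proof (rule PiE_I)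
        fix i assume i: "i \<in> I"
        show "z' i \<in> W i"
        proof (cases "i \<in> F")
          case True
          have "d (z i) (z' i) < \<rho> i" using z'(2) r'[OF True] True by fastforce
          moreover have "z i \<in> M" "z' i \<in> M" using z z'(1) i by auto
          ultimately have "z' i \<in> mball (z i) (\<rho> i)" by simp
          then show ?thesis using \<rho>(2)[OF True] by blast
        next
          case False
          then have "W i = M" using i unfolding F_def by simp
          then show ?thesis using z'(1) i by auto
        qed
      qed (use z'(1) in auto)
      then have "K z' \<in> {K z - \<epsilon>/2<..<K z + \<epsilon>/2}" using subsetD[OF W(4)] by simp
      then have "K z - \<epsilon>/2 < K z'" "K z' < K z + \<epsilon>/2" by simp_all
      then show ?thesis by linarith
    qed
    then show ?thesis using F r by blast
  qed
  have "\<forall>z\<in>I \<rightarrow>\<^sub>E M. \<exists>F r. finite F \<and> F \<subseteq> I \<and> r > 0 \<and>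
      (\<forall>z'\<in>I \<rightarrow>\<^sub>E M. (\<forall>i\<in>F. d (z i) (z' i) < 2 * r) \<longrightarrow> \<bar>K z' - K z\<bar> < \<epsilon> / 2)"
    using loc by (rule ballI)
  from bchoice[OF this] obtain F where "\<forall>z\<in>I \<rightarrow>\<^sub>E M. \<exists>r. finite (F z) \<and> F z \<subseteq> I \<and> r > 0 \<and>
      (\<forall>z'\<in>I \<rightarrow>\<^sub>E M. (\<forall>i\<in>F z. d (z i) (z' i) < 2 * r) \<longrightarrow> \<bar>K z' - K z\<bar> < \<epsilon> / 2)"
    by (elim exE)
  from bchoice[OF this] obtain r where Fr: "\<forall>z\<in>I \<rightarrow>\<^sub>E M. finite (F z) \<and> F z \<subseteq> I \<and> r z > 0 \<and>
      (\<forall>z'\<in>I \<rightarrow>\<^sub>E M. (\<forall>i\<in>F z. d (z i) (z' i) < 2 * r z) \<longrightarrow> \<bar>K z' - K z\<bar> < \<epsilon> / 2)"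
    by (elim exE)
  define N where "N z = (\<Pi>\<^sub>E i\<in>I. if i \<in> F z then mball (z i) (r z) else M)" for z
  have N_open: "openin ?P (N z)" if "z \<in> I \<rightarrow>\<^sub>E M" for z
    unfolding N_def
  proof (rule product_topology_basis)
    have "{i. (if i \<in> F z then mball (z i) (r z) else M) \<noteq> topspace mtopology} \<subseteq> F z" by auto
    then show "finite {i. (if i \<in> F z then mball (z i) (r z) else M) \<noteq> topspace mtopology}"
      using Fr that finite_subset by blast
    show "openin mtopology (if i \<in> F z then mball (z i) (r z) else M)" for i
      using openin_topspace[of mtopology] by simp
  qed
  have N_self: "z \<in> N z" if z: "z \<in> I \<rightarrow>\<^sub>E M" for z
  proof -
    have "r z > 0" using Fr z by blast
    then show ?thesis unfolding N_def using z by (auto simp: PiE_iff)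
  qed
  have "compactin ?P (I \<rightarrow>\<^sub>E M)" using compP top by (metis compact_space_def)
  then have "\<exists>\<F>. finite \<F> \<and> \<F> \<subseteq> N ` (I \<rightarrow>\<^sub>E M) \<and> (I \<rightarrow>\<^sub>E M) \<subseteq> \<Union>\<F>"
    unfolding compactin_def
    by (elim conjE allE[of _ "N ` (I \<rightarrow>\<^sub>E M)"]) (use N_open N_self in fastforce)
  then obtain \<F> where \<F>: "finite \<F>" "\<F> \<subseteq> N ` (I \<rightarrow>\<^sub>E M)" "(I \<rightarrow>\<^sub>E M) \<subseteq> \<Union>\<F>" by (elim exE conjE)
  obtain Z where Z: "Z \<subseteq> I \<rightarrow>\<^sub>E M" "finite Z" "\<F> = N ` Z"
    using finite_subset_image[OF \<F>(1,2)] by metis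
  define F0 where "F0 = (\<Union>z\<in>Z. F z)"
  define r0 where "r0 = Min (insert 1 (r ` Z))"
  have F0: "finite F0" "F0 \<subseteq> I" unfolding F0_def using Z Fr by blast+
  have r0: "r0 > 0" unfolding r0_def using Z Fr by (subst Min_gr_iff) auto
  have r0': "r0 \<le> r z" if "z \<in> Z" for z unfolding r0_def using Z(2) that by (simp add: Min_le)
  define C where "C = 2 * B / r0"
  have C: "0 \<le> C" unfolding C_def using B(1) r0 by simp
  have "\<bar>K z - K z'\<bar> \<le> \<epsilon> + C * (\<Sum>i\<in>F0. d (z i) (z' i))"
    if z: "z \<in> I \<rightarrow>\<^sub>E M" and z': "z' \<in> I \<rightarrow>\<^sub>E M" for z z'
  proof (cases "\<exists>i\<in>F0. d (z i) (z' i) \<ge> r0")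
    case True
    then obtain i where i: "i \<in> F0" "d (z i) (z' i) \<ge> r0" by blast
    have "d (z i) (z' i) \<le> (\<Sum>i\<in>F0. d (z i) (z' i))"
      using i(1) F0(1) by (intro member_le_sum) auto
    then have "C * r0 \<le> C * (\<Sum>i\<in>F0. d (z i) (z' i))" using i(2) C by (intro mult_left_mono) auto
    moreover have "C * r0 = 2 * B" unfolding C_def using r0 by simp
    moreover have "\<bar>K z - K z'\<bar> \<le> 2 * B" using B(2)[OF z] B(2)[OF z'] by linarith
    ultimately show ?thesis using e by linarith
  next
    case False
    obtain w where w: "w \<in> Z" "z \<in> N w" using \<F>(3) Z(3) z by blast
    have wM: "w \<in> I \<rightarrow>\<^sub>E M" using w(1) Z(1) by blast
    have 1: "d (w i) (z i) < r w" if "i \<in> F w" for i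
    proof -
      have "i \<in> I" using that Fr wM by blast
      then have "z i \<in> mball (w i) (r w)" using w(2) that unfolding N_def PiE_iff by auto
      then show ?thesis by simp
    qed
    have 2: "d (w i) (z' i) < 2 * r w" if i: "i \<in> F w" for i
    proof -
      have iI: "i \<in> I" using i Fr wM by blast
      then have mem: "w i \<in> M" "z i \<in> M" "z' i \<in> M" using wM z z' by auto
      have "i \<in> F0" using i w(1) unfolding F0_def by blast
      then have "d (z i) (z' i) < r w" using False r0'[OF w(1)] by force
      then show ?thesis using triangle[OF mem] 1[OF i] by linarith
    qed
    have rw: "r w > 0" using Fr wM by blast
    have "\<bar>K z - K w\<bar> < \<epsilon> / 2" using Fr wM z 1 rw by (smt (verit))
    moreover have "\<bar>K z' - K w\<bar> < \<epsilon> / 2" using Fr wM z' 2 by blast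
    moreover have "0 \<le> C * (\<Sum>i\<in>F0. d (z i) (z' i))" using C by (intro mult_nonneg_nonneg sum_nonneg) auto
    ultimately show ?thesis by linarith
  qed
  then show ?thesis using that F0 C by blast
qed

section \<open>Density of continuous functions in the mean\<close>

definition L1_approximable :: "'a topology \<Rightarrow> 'a measure \<Rightarrow> ('a \<Rightarrow> real) \<Rightarrow> bool" where
  "L1_approximable T M u \<longleftrightarrow>
     (\<forall>\<epsilon>>0. \<exists>h. continuous_map T euclideanreal h \<and> (\<integral>x. \<bar>u x - h x\<bar> \<partial>M) < \<epsilon>)"

lemma L1_triangle:
  fixes u v w :: "'a \<Rightarrow> real"
  assumes "integrable M u" "integrable M v" "integrable M w"
  shows "(\<integral>x. \<bar>u x - w x\<bar> \<partial>M) \<le> (\<integral>x. \<bar>u x - v x\<bar> \<partial>M) + (\<integral>x. \<bar>v x - w x\<bar> \<partial>M)"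
proof -
  have "(\<integral>x. \<bar>u x - w x\<bar> \<partial>M) \<le> (\<integral>x. \<bar>u x - v x\<bar> + \<bar>v x - w x\<bar> \<partial>M)"
    using assms by (intro integral_mono) auto
  also have "\<dots> = (\<integral>x. \<bar>u x - v x\<bar> \<partial>M) + (\<integral>x. \<bar>v x - w x\<bar> \<partial>M)"
    using assms by (intro Bochner_Integration.integral_add) auto
  finally show ?thesis .
qed

context
  fixes T :: "'a topology" and M :: "'a measure"
  assumes T: "compact_space T" "metrizable_space T"
    and M: "finite_measure M" "sets M = sets (borel_of T)"
begin

interpretation finite_measure M by (fact M(1))

lemma space_eq: "space M = topspace T"
  using sets_eq_imp_space_eq[OF M(2)] by simp

lemma integrable_continuous:
  assumes h: "continuous_map T euclideanreal h"
  shows "integrable M h"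
proof -
  obtain B where "\<And>x. x \<in> topspace T \<Longrightarrow> \<bar>h x\<bar> \<le> B"
    using continuous_map_compact_bounded[OF T(1) h] by blast
  then show ?thesis
    using borel_measurable_continuous_map[OF h M(2)]
    by (intro integrable_const_bound[of _ B]) (auto simp: space_eq)
qed

text \<open>
  The lemmas up to \<open>L1_approximable_integrable\<close> show that the approximable functions contain the
  indicators of open sets and are closed under Lipschitz operations and limits in the mean.  It follows
  that the sets with approximable indicator form a \<open>\<sigma>\<close>-algebra.
\<close>

lemma L1_approximable_closed:
  assumes u: "integrable M u"
    and v: "\<And>\<epsilon>. \<epsilon> > 0 \<Longrightarrow> \<exists>v. integrable M v \<and> L1_approximable T M v \<and> (\<integral>x. \<bar>u x - v x\<bar> \<partial>M) < \<epsilon>"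
  shows "L1_approximable T M u"
  unfolding L1_approximable_def
proof (intro allI impI)
  fix \<epsilon> :: real assume e: "\<epsilon> > 0"
  obtain v where v: "integrable M v" "L1_approximable T M v" "(\<integral>x. \<bar>u x - v x\<bar> \<partial>M) < \<epsilon> / 2"
    using v[of "\<epsilon> / 2"] e by auto
  obtain h where h: "continuous_map T euclideanreal h" "(\<integral>x. \<bar>v x - h x\<bar> \<partial>M) < \<epsilon> / 2"
    using v(2) e unfolding L1_approximable_def by (meson half_gt_zero)
  show "\<exists>h. continuous_map T euclideanreal h \<and> (\<integral>x. \<bar>u x - h x\<bar> \<partial>M) < \<epsilon>"
    using L1_triangle[OF u v(1) integrable_continuous[OF h(1)]] v(3) h by (intro exI[of _ h]) auto
qed

lemma L1_approximable_combine:
  assumes u: "integrable M u" "L1_approximable T M u" and v: "integrable M v" "L1_approximable T M v"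
    and F_cont: "\<And>h k. continuous_map T euclideanreal h \<Longrightarrow> continuous_map T euclideanreal k
      \<Longrightarrow> continuous_map T euclideanreal (\<lambda>x. F (h x) (k x))"
    and F_lipschitz: "\<And>a b a' b'. \<bar>F a b - F a' b'\<bar> \<le> C * (\<bar>a - a'\<bar> + \<bar>b - b'\<bar>)"
    and C: "C > 0"
  shows "L1_approximable T M (\<lambda>x. F (u x) (v x))"
  unfolding L1_approximable_def
proof (intro allI impI)
  fix \<epsilon> :: real assume e: "\<epsilon> > 0"
  then have e': "\<epsilon> / (2 * C) > 0" using C by simp
  obtain h where h: "continuous_map T euclideanreal h" "(\<integral>x. \<bar>u x - h x\<bar> \<partial>M) < \<epsilon> / (2 * C)"
    using u(2) e' unfolding L1_approximable_def by blast
  obtain k where k: "continuous_map T euclideanreal k" "(\<integral>x. \<bar>v x - k x\<bar> \<partial>M) < \<epsilon> / (2 * C)"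
    using v(2) e' unfolding L1_approximable_def by blast
  note int = u(1) v(1) integrable_continuous[OF h(1)] integrable_continuous[OF k(1)]
  have "(\<integral>x. \<bar>F (u x) (v x) - F (h x) (k x)\<bar> \<partial>M)
      \<le> (\<integral>x. C * (\<bar>u x - h x\<bar> + \<bar>v x - k x\<bar>) \<partial>M)"
    using int F_lipschitz C by (intro integral_mono') auto
  also have "\<dots> = C * ((\<integral>x. \<bar>u x - h x\<bar> \<partial>M) + (\<integral>x. \<bar>v x - k x\<bar> \<partial>M))"
    using int by (subst integral_mult_right_zero, subst Bochner_Integration.integral_add) auto
  also have "\<dots> < C * (\<epsilon> / (2 * C) + \<epsilon> / (2 * C))"
    using h(2) k(2) C by (intro mult_strict_left_mono add_strict_mono) auto
  also have "\<dots> = \<epsilon>" using C by simp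
  finally show "\<exists>h. continuous_map T euclideanreal h \<and> (\<integral>x. \<bar>F (u x) (v x) - h x\<bar> \<partial>M) < \<epsilon>"
    using F_cont[OF h(1) k(1)] by blast
qed

lemma integrable_indicator: "A \<in> sets M \<Longrightarrow> integrable M (indicator A :: 'a \<Rightarrow> real)"
  by (simp add: emeasure_eq_measure less_top[symmetric])

lemma integral_indicator_eq_measure:
  assumes "A \<in> sets M"
  shows "(\<integral>x. indicator A x \<partial>M) = measure M A"
  using sets.sets_into_space[OF assms] by (simp add: Int_absorb2)

lemma L1_approximable_const: "L1_approximable T M (\<lambda>x. c)"
  unfolding L1_approximable_def by (intro allI impI exI[of _ "\<lambda>x. c"]) auto

lemma L1_approximable_cong:
  assumes "\<And>x. x \<in> space M \<Longrightarrow> u x = v x" "L1_approximable T M u"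
  shows "L1_approximable T M v"
proof -
  have "(\<integral>x. \<bar>u x - h x\<bar> \<partial>M) = (\<integral>x. \<bar>v x - h x\<bar> \<partial>M)" for h
    using assms(1) by (intro Bochner_Integration.integral_cong) auto
  then show ?thesis using assms(2) unfolding L1_approximable_def by simp
qed

text \<open>
  An open subset of a metrizable space is an increasing union of closed sets \<open>C n\<close>; an Urysohn function
  between \<open>C n\<close> and the complement of \<open>U\<close> differs from the indicator of \<open>U\<close> only on \<open>U - C n\<close>.
\<close>

lemma L1_approximable_open:
  assumes U: "openin T U"
  shows "L1_approximable T M (indicator U)"
  unfolding L1_approximable_def
proof (intro allI impI)
  fix \<epsilon> :: real assume e: "\<epsilon> > 0"
  obtain C where C: "\<And>n. closedin T (C n)" "\<And>n::nat. C n \<subseteq> C (Suc n)" "(\<Union>n. C n) = U"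
    using open_imp_fsigma_in[OF T(2) U] unfolding fsigma_in_ascending by metis
  have CM: "C n \<in> sets M" for n
  proof -
    have "topspace T - (topspace T - C n) = C n" using closedin_subset[OF C(1)] by blast
    moreover have "topspace T - C n \<in> sets M" 
      using C(1)[of n] M(2) by (auto simp: closedin_def intro!: openin_sets_borel_of)
    ultimately show ?thesis using sets.compl_sets[of "topspace T - C n" M] by (simp add: space_eq)
  qed
  have UM: "U \<in> sets M" using U M(2) openin_sets_borel_of by blast
  have "(\<lambda>n. measure M (C n)) \<longlonglongrightarrow> measure M (\<Union>n. C n)"
    using CM C(2) by (intro finite_Lim_measure_incseq) (auto simp: incseq_SucI)
  then have "(\<lambda>n. measure M (C n)) \<longlonglongrightarrow> measure M U" using C(3) by simp
  from LIMSEQ_D[OF this e] obtain n where n: "\<bar>measure M (C n) - measure M U\<bar> < \<epsilon>" by auto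
  have CU: "C n \<subseteq> U" using C(3) by blast
  have "closedin T (topspace T - U)" "disjnt (topspace T - U) (C n)"
    using U CU by (auto simp: disjnt_def)
  then obtain h where h: "continuous_map T (top_of_set {0..1::real}) h" "h ` (topspace T - U) \<subseteq> {0}"
      "h ` C n \<subseteq> {1}"
    using Urysohn_lemma[OF metrizable_imp_normal_space[OF T(2)] _ C(1), of "topspace T - U" n 0 1] by auto
  have h': "continuous_map T euclideanreal h" "h ` topspace T \<subseteq> {0..1}"
    using h(1) by (auto simp: continuous_map_in_subtopology)
  have "(\<integral>x. \<bar>indicator U x - h x\<bar> \<partial>M) \<le> (\<integral>x. indicator (U - C n) x \<partial>M)"
  proof (rule integral_mono')
    show "integrable M (indicator (U - C n) :: 'a \<Rightarrow> real)" using CM UM by (intro integrable_indicator) auto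
    fix x assume "x \<in> space M"
    then have x: "x \<in> topspace T" by (simp add: space_eq)
    then have "0 \<le> h x" "h x \<le> 1" using h'(2) by auto
    then show "\<bar>indicator U x - h x\<bar> \<le> indicator (U - C n) x"
      using x h(2,3) CU by (auto simp: indicator_def)
  qed auto
  also have "\<dots> = measure M (U - C n)" using UM CM by (intro integral_indicator_eq_measure) auto
  also have "\<dots> = measure M U - measure M (C n)" using UM CM CU by (intro finite_measure_Diff) auto
  also have "\<dots> < \<epsilon>" using n by linarith
  finally show "\<exists>h. continuous_map T euclideanreal h \<and> (\<integral>x. \<bar>indicator U x - h x\<bar> \<partial>M) < \<epsilon>"
    using h'(1) by blast
qed

lemma L1_approximable_Un:
  assumes A: "A \<in> sets M" "L1_approximable T M (indicator A)"
    and B: "B \<in> sets M" "L1_approximable T M (indicator B)"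
  shows "L1_approximable T M (indicator (A \<union> B))"
proof (rule L1_approximable_cong)
  show "L1_approximable T M (\<lambda>x. max (indicator A x) (indicator B x))"
  proof (rule L1_approximable_combine[where F=max and C=1])
    show "\<bar>max a b - max a' b'\<bar> \<le> 1 * (\<bar>a - a'\<bar> + \<bar>b - b'\<bar>)" for a b a' b' :: real
      by (auto simp: max_def abs_if)
  qed (use A B integrable_indicator continuous_map_real_max in auto)
qed (auto simp: indicator_def)

lemma L1_approximable_indicator:
  assumes "A \<in> sets M"
  shows "L1_approximable T M (indicator A)"
proof -
  have "A \<in> sigma_sets (topspace T) {U. openin T U}" using assms M(2) by (simp add: sets_borel_of)
  then show ?thesis
  proof (induction rule: sigma_sets.induct)
    case (Basic U)
    then show ?case using L1_approximable_open by simp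
  next
    case Empty
    show ?case using L1_approximable_open[OF openin_empty] .
  next
    case (Compl A)
    then have A: "A \<in> sets M" using M(2) by (simp add: sets_borel_of)
    show ?case
    proof (rule L1_approximable_cong)
      show "L1_approximable T M (\<lambda>x. 1 - indicator A x)"
        using Compl.IH A integrable_indicator L1_approximable_const
        by (intro L1_approximable_combine[where F="(-)" and C=1]) (auto intro!: continuous_map_diff)
    qed (auto simp: indicator_def space_eq)
  next
    case (Union A)
    then have A: "A i \<in> sets M" for i using M(2) by (simp add: sets_borel_of)
    have fin: "L1_approximable T M (indicator (\<Union>i<n. A i))" for n
    proof (induction n)
      case 0
      show ?case by (simp only: lessThan_0 UN_empty) (rule L1_approximable_open[OF openin_empty])
    next
      case (Suc n)
      then show ?case using L1_approximable_Un[OF _ Suc A Union.IH] A by (simp add: lessThan_Suc Un_commute)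
    qed
    show ?case
    proof (rule L1_approximable_closed)
      show "integrable M (indicator (\<Union>i. A i) :: 'a \<Rightarrow> real)" using A by (intro integrable_indicator) auto
      fix \<epsilon> :: real assume e: "\<epsilon> > 0"
      let ?A = "\<lambda>n. \<Union>i<n. A i"
      have "(\<lambda>n. measure M (?A n)) \<longlonglongrightarrow> measure M (\<Union>n. ?A n)"
        using A by (intro finite_Lim_measure_incseq) (fastforce simp: incseq_def)+
      moreover have "(\<Union>n. ?A n) = (\<Union>i. A i)" by blast
      ultimately have "(\<lambda>n. measure M (?A n)) \<longlonglongrightarrow> measure M (\<Union>i. A i)" by simp
      from LIMSEQ_D[OF this e] obtain n where
        n: "\<bar>measure M (?A n) - measure M (\<Union>i. A i)\<bar> < \<epsilon>" by auto
      have "(\<integral>x. \<bar>indicator (\<Union>i. A i) x - indicator (?A n) x :: real\<bar> \<partial>M)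
          = (\<integral>x. indicator ((\<Union>i. A i) - ?A n) x \<partial>M)"
        by (intro Bochner_Integration.integral_cong) (auto simp: indicator_def)
      also have "\<dots> = measure M ((\<Union>i. A i) - ?A n)"
        using A by (intro integral_indicator_eq_measure) auto
      also have "\<dots> = measure M (\<Union>i. A i) - measure M (?A n)"
        using A by (intro finite_measure_Diff) auto
      also have "\<dots> < \<epsilon>" using n by linarith
      finally show "\<exists>v. integrable M v \<and> L1_approximable T M v \<and>
          (\<integral>x. \<bar>indicator (\<Union>i. A i) x - v x\<bar> \<partial>M) < \<epsilon>"
        using fin A by (intro exI[of _ "indicator (?A n)"] conjI integrable_indicator) auto
    qed
  qed
qed

lemma L1_approximable_integrable:
  assumes "integrable M u"
  shows "L1_approximable T M u"
  using assms
proof (induction rule: integrable_induct)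
  case (base A c)
  have "L1_approximable T M (\<lambda>x. indicator A x * c)"
  proof (rule L1_approximable_combine[where F="\<lambda>a b. a * c" and C="\<bar>c\<bar> + 1" and v="\<lambda>x. 0"])
    show "\<bar>a * c - a' * c\<bar> \<le> (\<bar>c\<bar> + 1) * (\<bar>a - a'\<bar> + \<bar>b - b'\<bar>)" for a b a' b' :: real
    proof -
      have "\<bar>a * c - a' * c\<bar> = \<bar>c\<bar> * \<bar>a - a'\<bar>" by (simp add: abs_mult[symmetric] algebra_simps)
      also have "\<dots> \<le> (\<bar>c\<bar> + 1) * (\<bar>a - a'\<bar> + \<bar>b - b'\<bar>)" by (intro mult_mono) auto
      finally show ?thesis .
    qed
  qed (use base in \<open>auto intro!: integrable_indicator L1_approximable_indicator L1_approximable_const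
      continuous_map_real_mult_right\<close>)
  then show ?case by simp
next
  case (add f g)
  then show ?case
    by (intro L1_approximable_combine[where F="(+)" and C=1]) (auto intro!: continuous_map_add)
next
  case (lim f s)
  have "(\<lambda>i. \<integral>x. \<bar>f x - s i x\<bar> \<partial>M) \<longlonglongrightarrow> (\<integral>x. \<bar>f x - f x\<bar> \<partial>M)"
  proof (rule integral_dominated_convergence)
    show "integrable M (\<lambda>x. 3 * \<bar>f x\<bar>)" using lim by simp
    show "AE x in M. (\<lambda>i. \<bar>f x - s i x\<bar>) \<longlonglongrightarrow> \<bar>f x - f x\<bar>"
      using lim by (intro AE_I2 tendsto_intros) auto
    show "AE x in M. norm \<bar>f x - s i x\<bar> \<le> 3 * \<bar>f x\<bar>" for i
    proof (rule AE_I2)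
      fix x assume "x \<in> space M"
      then have "\<bar>s i x\<bar> \<le> 2 * \<bar>f x\<bar>" using lim.hyps(3)[of x i] by simp
      then show "norm \<bar>f x - s i x\<bar> \<le> 3 * \<bar>f x\<bar>"
        using abs_triangle_ineq4[of "f x" "s i x"] by simp
    qed
  qed (use lim in auto)
  then have l: "(\<lambda>i. \<integral>x. \<bar>f x - s i x\<bar> \<partial>M) \<longlonglongrightarrow> 0" by simp
  show ?case
  proof (rule L1_approximable_closed)
    fix \<epsilon> :: real assume "\<epsilon> > 0"
    then obtain i where "(\<integral>x. \<bar>f x - s i x\<bar> \<partial>M) < \<epsilon>"
      using order_tendstoD(2)[OF l, of \<epsilon>] by (auto simp: eventually_sequentially)
    then show "\<exists>v. integrable M v \<and> L1_approximable T M v \<and> (\<integral>x. \<bar>f x - v x\<bar> \<partial>M) < \<epsilon>"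
      using lim by blast
  qed (use lim in auto)
qed

end

section \<open>Convergence in the weak* topology\<close>

lemma topspace_weak_star: "topspace (weak_star_topology T) = borel_probs T"
proof -
  have "borel_probs T \<in> {{M \<in> borel_probs T. (\<integral>x. f x \<partial>M) \<in> U} | f U.
      continuous_map T euclideanreal f \<and> open (U :: real set)}"
    by (intro CollectI exI[of _ "\<lambda>_. 0"] exI[of _ UNIV]) auto
  then show ?thesis
    unfolding weak_star_topology_def topology_generated_by_topspace by blast
qed

text \<open>
  Convergence has to be tested on a subbasis only, that is, on integrals of continuous functions.  The
  filter is arbitrary because paths of models are indexed by pairs.
\<close>

lemma limitin_weak_star:
  "limitin (weak_star_topology T) m l F \<longleftrightarrow>
     l \<in> borel_probs T \<and> (\<forall>\<^sub>F i in F. m i \<in> borel_probs T) \<and>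
     (\<forall>f. continuous_map T euclideanreal f \<longrightarrow> ((\<lambda>i. \<integral>x. f x \<partial>m i) \<longlongrightarrow> (\<integral>x. f x \<partial>l)) F)"
proof (intro iffI conjI allI impI)
  assume L: "limitin (weak_star_topology T) m l F"
  show l: "l \<in> borel_probs T" using limitin_topspace[OF L] by (simp add: topspace_weak_star)
  show "\<forall>\<^sub>F i in F. m i \<in> borel_probs T"
    using limitinD[OF L openin_topspace limitin_topspace[OF L]] by (simp add: topspace_weak_star)
  fix f assume f: "continuous_map T euclideanreal f"
  show "((\<lambda>i. \<integral>x. f x \<partial>m i) \<longlongrightarrow> (\<integral>x. f x \<partial>l)) F"
  proof (rule topological_tendstoI)
    fix U :: "real set" assume U: "open U" "(\<integral>x. f x \<partial>l) \<in> U"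
    have "openin (weak_star_topology T) {M \<in> borel_probs T. (\<integral>x. f x \<partial>M) \<in> U}"
      unfolding weak_star_topology_def using f U(1) by (intro topology_generated_by_Basis) blast
    from limitinD[OF L this] l U(2) show "\<forall>\<^sub>F i in F. (\<integral>x. f x \<partial>m i) \<in> U"
      by (auto elim: eventually_mono)
  qed
next
  assume R: "l \<in> borel_probs T \<and> (\<forall>\<^sub>F i in F. m i \<in> borel_probs T) \<and>
     (\<forall>f. continuous_map T euclideanreal f \<longrightarrow> ((\<lambda>i. \<integral>x. f x \<partial>m i) \<longlongrightarrow> (\<integral>x. f x \<partial>l)) F)"
  let ?S = "{{M \<in> borel_probs T. (\<integral>x. f x \<partial>M) \<in> U} | f U.
      continuous_map T euclideanreal f \<and> open (U :: real set)}"
  have "l \<in> W \<longrightarrow> (\<forall>\<^sub>F i in F. m i \<in> W)" if "generate_topology_on ?S W" for W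
    using that
  proof (induction rule: generate_topology_on.induct)
    case (Int a b)
    then show ?case by (auto elim: eventually_elim2)
  next
    case (UN K)
    show ?case
    proof
      assume "l \<in> \<Union>K"
      then obtain k where k: "k \<in> K" "l \<in> k" by blast
      with UN have "\<forall>\<^sub>F i in F. m i \<in> k" by blast
      then show "\<forall>\<^sub>F i in F. m i \<in> \<Union>K" using k(1) by (auto elim: eventually_mono)
    qed
  next
    case (Basis s)
    then obtain f U where f: "s = {M \<in> borel_probs T. (\<integral>x. f x \<partial>M) \<in> U}"
        "continuous_map T euclideanreal f" "open U" by blast
    show ?case
    proof
      assume "l \<in> s"
      then have "\<forall>\<^sub>F i in F. (\<integral>x. f x \<partial>m i) \<in> U"
        using R f by (intro topological_tendstoD[where l="\<integral>x. f x \<partial>l"]) auto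
      moreover have "\<forall>\<^sub>F i in F. m i \<in> borel_probs T" using R by blast
      ultimately show "\<forall>\<^sub>F i in F. m i \<in> s" unfolding f(1) by eventually_elim simp
    qed
  qed simp
  then show "limitin (weak_star_topology T) m l F"
    using R unfolding limitin_def topspace_weak_star
    by (auto simp: weak_star_topology_def openin_topology_generated_by_iff)
qed

section \<open>Averages over vertices\<close>

definition vertex_avg :: "'v set \<Rightarrow> ('v \<Rightarrow> real) \<Rightarrow> real" where
  "vertex_avg W f = (\<Sum>v\<in>W. f v) / real (card W)"

lemma vertex_avg_cong: "(\<And>v. v \<in> W \<Longrightarrow> f v = g v) \<Longrightarrow> vertex_avg W f = vertex_avg W g"
  unfolding vertex_avg_def by (simp cong: sum.cong)

lemma vertex_avg_mono: "(\<And>v. v \<in> W \<Longrightarrow> f v \<le> g v) \<Longrightarrow> vertex_avg W f \<le> vertex_avg W g"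
  unfolding vertex_avg_def by (intro divide_right_mono sum_mono) auto

lemma vertex_avg_add: "vertex_avg W (\<lambda>v. f v + g v) = vertex_avg W f + vertex_avg W g"
  unfolding vertex_avg_def by (simp add: sum.distrib add_divide_distrib)

lemma vertex_avg_diff: "vertex_avg W (\<lambda>v. f v - g v) = vertex_avg W f - vertex_avg W g"
  unfolding vertex_avg_def by (simp add: sum_subtractf diff_divide_distrib)

lemma vertex_avg_cmult: "vertex_avg W (\<lambda>v. c * f v) = c * vertex_avg W f"
  unfolding vertex_avg_def by (simp add: sum_distrib_left)

lemma vertex_avg_sum: "vertex_avg W (\<lambda>v. \<Sum>i\<in>I. f i v) = (\<Sum>i\<in>I. vertex_avg W (f i))"
  unfolding vertex_avg_def by (subst sum.swap) (simp add: sum_divide_distrib)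

lemma vertex_avg_const_le: "0 \<le> c \<Longrightarrow> vertex_avg W (\<lambda>_. c) \<le> c"
  unfolding vertex_avg_def by (cases "card W = 0") auto

lemma vertex_avg_nonneg: "(\<And>v. v \<in> W \<Longrightarrow> 0 \<le> f v) \<Longrightarrow> 0 \<le> vertex_avg W f"
  unfolding vertex_avg_def by (intro divide_nonneg_nonneg sum_nonneg) auto

lemma vertex_avg_abs_diff: "\<bar>vertex_avg W f - vertex_avg W g\<bar> \<le> vertex_avg W (\<lambda>v. \<bar>f v - g v\<bar>)"
proof -
  have "\<bar>sum (\<lambda>v. f v - g v) W\<bar> / real (card W) \<le> (\<Sum>v\<in>W. \<bar>f v - g v\<bar>) / real (card W)"
    by (intro divide_right_mono sum_abs) auto
  then show ?thesis
    unfolding vertex_avg_diff[symmetric] unfolding vertex_avg_def by simp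
qed

lemma vertex_avg_bij:
  assumes "bij_betw \<tau> W W"
  shows "vertex_avg W (\<lambda>v. f (\<tau> v)) = vertex_avg W f"
  unfolding vertex_avg_def using sum.reindex_bij_betw[OF assms, of f] by simp

lemma average_dist_eq: "average_dist W d x x' = vertex_avg W (\<lambda>v. d (x v) (x' v))"
  by (simp add: average_dist_def vertex_avg_def)

section \<open>Limits along families of paths\<close>

lemma tendsto_zero_if_eventually_le:
  fixes f :: "'i \<Rightarrow> real"
  assumes "\<And>i. 0 \<le> f i" "\<And>\<epsilon>. \<epsilon> > 0 \<Longrightarrow> \<forall>\<^sub>F i in F. f i \<le> \<epsilon>"
  shows "(f \<longlongrightarrow> 0) F"
proof (rule tendstoI)
  fix e :: real assume "e > 0"
  then have "\<forall>\<^sub>F i in F. f i \<le> e / 2" by (intro assms(2)) simp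
  then show "\<forall>\<^sub>F i in F. dist (f i) 0 < e"
  proof eventually_elim
    case (elim i)
    then show ?case using assms(1)[of i] \<open>e > 0\<close> by simp
  qed
qed

text \<open>
  If each level \<open>k\<close> is eventually achievable then one choice eventually achieves all levels: at index \<open>i\<close>,
  take the highest level \<open>k \<le> n i\<close> that is achievable there.  The bound \<open>n i\<close> makes this maximum exist.
\<close>

lemma eventually_diagonal_choice:
  fixes n :: "'i \<Rightarrow> nat" and Q :: "nat \<Rightarrow> 'i \<Rightarrow> 'b \<Rightarrow> bool"
  assumes n: "filterlim n at_top F"
    and ex: "\<And>k. \<forall>\<^sub>F i in F. \<exists>y. Q k i y"
    and anti: "\<And>k k' i y. k \<le> k' \<Longrightarrow> Q k' i y \<Longrightarrow> Q k i y"
    and R: "\<And>i. \<exists>y. R i y" "\<And>k i y. Q k i y \<Longrightarrow> R i y"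
  obtains y where "\<And>i. R i (y i)" "\<And>k. \<forall>\<^sub>F i in F. Q k i (y i)"
proof -
  define S where "S i = {k. k \<le> n i \<and> (\<exists>y. Q k i y)}" for i
  have fin: "finite (S i)" for i unfolding S_def by (rule finite_subset[of _ "{..n i}"]) auto
  define y where "y i = (if S i = {} then SOME y. R i y else SOME y. Q (Max (S i)) i y)" for i
  have y: "Q (Max (S i)) i (y i)" if "S i \<noteq> {}" for i
  proof -
    have "Max (S i) \<in> S i" using Max_in fin that by blast
    then show ?thesis using that unfolding y_def S_def by (auto intro: someI_ex)
  qed
  have "R i (y i)" for i
  proof (cases "S i = {}")
    case True
    then show ?thesis using someI_ex[OF R(1)[of i]] unfolding y_def by simp
  qed (use y R(2) in blast)
  moreover have "\<forall>\<^sub>F i in F. Q k i (y i)" for k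
  proof -
    have "\<forall>\<^sub>F i in F. k \<le> n i" using n unfolding filterlim_at_top by blast
    then show ?thesis using ex[of k]
    proof eventually_elim
      case (elim i)
      then have k: "k \<in> S i" unfolding S_def by simp
      then have "k \<le> Max (S i)" using fin by simp
      then show ?case using anti y k by blast
    qed
  qed
  ultimately show ?thesis using that by blast
qed

text \<open>
  Convergence along this filter is convergence as the stage \<open>i\<close> grows, uniformly in the position
  \<open>j \<in> S i\<close>.
\<close>

definition path_filter :: "(nat \<Rightarrow> nat set) \<Rightarrow> (nat \<times> nat) filter" where
  "path_filter S = inf (filtercomap fst sequentially) (principal {(i, j). j \<in> S i})"

lemma eventually_path_filter:
  "eventually Q (path_filter S) \<longleftrightarrow> (\<forall>\<^sub>F i in sequentially. \<forall>j\<in>S i. Q (i, j))"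
proof
  assume "eventually Q (path_filter S)"
  then show "\<forall>\<^sub>F i in sequentially. \<forall>j\<in>S i. Q (i, j)"
    unfolding path_filter_def eventually_inf_principal eventually_filtercomap
    by (auto elim!: eventually_mono)
next
  assume "\<forall>\<^sub>F i in sequentially. \<forall>j\<in>S i. Q (i, j)"
  then show "eventually Q (path_filter S)"
    unfolding path_filter_def eventually_inf_principal eventually_filtercomap
    by (intro exI[of _ "\<lambda>i. \<forall>j\<in>S i. Q (i, j)"]) auto
qed

lemma filterlim_path_filter_fst: "filterlim n at_top sequentially \<Longrightarrow> filterlim (\<lambda>k. n (fst k)) at_top (path_filter S)"
  unfolding filterlim_iff eventually_path_filter by (auto elim!: eventually_mono)

lemma filterlim_path_filter:
  assumes "\<And>i j. j \<in> S i \<Longrightarrow> f (i, j) = (i, g i j) \<and> g i j \<in> S' i"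
  shows "filterlim f (path_filter S') (path_filter S)"
  unfolding filterlim_iff eventually_path_filter using assms by (auto elim!: eventually_mono)

lemma filterlim_into_path_filter:
  assumes "\<And>i. g i \<in> S i"
  shows "filterlim (\<lambda>i. (i, g i)) (path_filter S) sequentially"
  unfolding filterlim_iff eventually_path_filter using assms by (auto elim!: eventually_mono)

text \<open>
  The suprema of the tails of \<open>s\<close> decrease to \<open>0\<close>; adding \<open>1 / (i + 1)\<close> makes the bound strict.
\<close>

lemma decreasing_majorant:
  fixes s :: "nat \<Rightarrow> real"
  assumes s: "s \<longlonglongrightarrow> 0"
  obtains \<delta> where "\<And>i. s i < \<delta> i" "decseq \<delta>" "\<delta> \<longlonglongrightarrow> 0"
proof -
  have "Bseq s" using s by (intro convergent_imp_Bseq convergentI)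
  then obtain B where B: "\<And>i. \<bar>s i\<bar> \<le> B" unfolding Bseq_def by auto
  have bdd: "bdd_above (s ` {i..})" for i
    by (intro bdd_aboveI2[of _ _ B]) (use B in \<open>simp add: abs_le_iff\<close>)
  define \<delta> where "\<delta> i = (SUP k\<in>{i..}. s k) + 1 / real (Suc i)" for i
  have "s i < \<delta> i" for i
  proof -
    have "s i \<le> (SUP k\<in>{i..}. s k)" using bdd by (intro cSUP_upper) auto
    moreover have "0 < 1 / real (Suc i)" by simp
    ultimately show ?thesis unfolding \<delta>_def by linarith
  qed
  moreover have "decseq \<delta>"
    unfolding decseq_Suc_iff \<delta>_def
  proof
    fix i
    have "(SUP k\<in>{Suc i..}. s k) \<le> (SUP k\<in>{i..}. s k)" by (intro cSUP_subset_mono bdd) auto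
    moreover have "1 / real (Suc (Suc i)) \<le> 1 / real (Suc i)" by (intro divide_left_mono) auto
    ultimately show "(SUP k\<in>{Suc i..}. s k) + 1 / real (Suc (Suc i))
        \<le> (SUP k\<in>{i..}. s k) + 1 / real (Suc i)" by linarith
  qed
  moreover have "\<delta> \<longlonglongrightarrow> 0"
  proof -
    have "(\<lambda>i. SUP k\<in>{i..}. s k) \<longlonglongrightarrow> 0"
    proof (rule LIMSEQ_I)
      fix e :: real assume e: "e > 0"
      then obtain N where N: "\<And>k. k \<ge> N \<Longrightarrow> \<bar>s k\<bar> < e / 2"
        using LIMSEQ_D[OF s, of "e / 2"] by auto
      have "\<bar>SUP k\<in>{i..}. s k\<bar> < e" if "i \<ge> N" for i
      proof -
        have "(SUP k\<in>{i..}. s k) \<le> e / 2" 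
        proof (rule cSUP_least)
          fix k assume "k \<in> {i..}"
          then have "\<bar>s k\<bar> < e / 2" using N[of k] that by simp
          then show "s k \<le> e / 2" by simp
        qed simp
        moreover have "s i \<le> (SUP k\<in>{i..}. s k)" using bdd by (intro cSUP_upper) auto
        ultimately show ?thesis using N[OF that] e by (simp add: abs_less_iff)
      qed
      then show "\<exists>N. \<forall>i\<ge>N. norm ((SUP k\<in>{i..}. s k) - 0) < e" by (intro exI[of _ N]) simp
    qed
    from tendsto_add[OF this LIMSEQ_Suc[OF lim_1_over_n]] show ?thesis
      unfolding \<delta>_def by simp
  qed
  ultimately show ?thesis using that by blast
qed

text \<open>
  Covers the points, and the steps, of a path that arises from another one by adding two end points.
\<close>

lemma tendsto_path_filter_assemble:
  assumes f0: "(f0 \<longlongrightarrow> L) sequentially" and f1: "(f1 \<longlongrightarrow> L) sequentially"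
    and g: "(g \<longlongrightarrow> L) (path_filter S)"
    and h: "\<And>i j. j \<in> S' i \<Longrightarrow> h (i, j) = f0 i \<or> h (i, j) = f1 i \<or> (\<exists>j'\<in>S i. h (i, j) = g (i, j'))"
  shows "(h \<longlongrightarrow> L) (path_filter S')"
proof (rule topological_tendstoI)
  fix U assume U: "open U" "L \<in> U"
  have "\<forall>\<^sub>F i in sequentially. f0 i \<in> U" "\<forall>\<^sub>F i in sequentially. f1 i \<in> U"
    "\<forall>\<^sub>F i in sequentially. \<forall>j\<in>S i. g (i, j) \<in> U"
    using topological_tendstoD[OF f0 U] topological_tendstoD[OF f1 U] topological_tendstoD[OF g U]
    by (simp_all add: eventually_path_filter)
  then show "\<forall>\<^sub>F k in path_filter S'. h k \<in> U"
    unfolding eventually_path_filter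
  proof eventually_elim
    case (elim i)
    show ?case
    proof
      fix j assume "j \<in> S' i"
      from h[OF this] show "h (i, j) \<in> U" using elim by auto
    qed
  qed
qed

section \<open>Compact metric alphabets\<close>

locale compact_alphabet = Metric_space "space X" d for X :: "'x measure" and d +
  assumes compact: "compact_space mtopology"
    and sets_alphabet: "sets X = sets (borel_of mtopology)"
begin

lemma dist_bound:
  obtains B where "0 \<le> B" "\<And>x y. x \<in> space X \<Longrightarrow> y \<in> space X \<Longrightarrow> d x y \<le> B"
proof -
  have "mtotally_bounded (space X)"
    using compactin_imp_mtotally_bounded[of "space X"] compact by (simp add: compact_space_def)
  then obtain B where B: "\<forall>x\<in>space X. \<forall>y\<in>space X. d x y \<le> B"
    using mtotally_bounded_imp_mbounded unfolding mbounded_alt by blast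
  show ?thesis
    by (rule that[of "max B 0"]) (use B in fastforce)+
qed

lemma sets_process:
  assumes "countable I"
  shows "sets (PiM I (\<lambda>_. X)) = sets (borel_of (product_topology (\<lambda>_. mtopology) I))"
  using assms second_countable_compact[OF compact] sets_alphabet by (intro sets_PiM_borel_of)

lemma metrizable_process:
  assumes "countable I"
  shows "metrizable_space (product_topology (\<lambda>_. mtopology) I)"
  using assms metrizable_space_mtopology
  by (simp add: metrizable_space_product_topology countable_Collect)

lemma compact_process: "compact_space (product_topology (\<lambda>_. mtopology) I)"
  using compact by (simp add: compact_space_product_topology)

lemma integrable_continuous_process:
  assumes "countable I" "finite_measure P" "c \<in> P \<rightarrow>\<^sub>M PiM I (\<lambda>_. X)"
    and K: "continuous_map (product_topology (\<lambda>_. mtopology) I) euclideanreal K"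
  shows "integrable P (\<lambda>\<omega>. K (c \<omega>))"
proof -
  interpret finite_measure P by (fact assms(2))
  obtain B where B: "\<And>x. x \<in> topspace (product_topology (\<lambda>_. mtopology) I) \<Longrightarrow> \<bar>K x\<bar> \<le> B"
    using continuous_map_compact_bounded[OF compact_process K] by blast
  have "K \<in> borel_measurable (PiM I (\<lambda>_. X))"
    by (rule borel_measurable_continuous_map[OF K sets_process[OF assms(1)]])
  then have "(\<lambda>\<omega>. K (c \<omega>)) \<in> borel_measurable P" using assms(3) by measurable
  moreover have "\<bar>K (c \<omega>)\<bar> \<le> B" if "\<omega> \<in> space P" for \<omega>
    using measurable_space[OF assms(3) that] by (intro B) (simp add: space_PiM)
  ultimately show ?thesis by (intro integrable_const_bound[of _ B]) auto
qed

lemma finite_net: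
  assumes "\<epsilon> > 0"
  obtains N where "finite N" "N \<subseteq> space X" "\<And>x. x \<in> space X \<Longrightarrow> \<exists>r\<in>N. d r x < \<epsilon>"
proof -
  obtain N where N: "finite N" "N \<subseteq> space X" "space X \<subseteq> (\<Union>x\<in>N. mball x \<epsilon>)"
    using compactin_imp_mtotally_bounded[of "space X"] compact assms
    by (auto simp: compact_space_def mtotally_bounded_def)
  show ?thesis
    by (rule that[OF N(1,2)]) (use N(3) in fastforce)
qed

lemma continuous_map_dist: "r \<in> space X \<Longrightarrow> continuous_map mtopology euclideanreal (d r)"
  unfolding continuous_map_from_metric open_openin[symmetric]
proof (intro conjI ballI allI impI)
  fix x U assume r: "r \<in> space X" and x: "x \<in> space X" and U: "open U \<and> d r x \<in> U"
  then obtain e where e: "e > 0" "\<And>t. \<bar>t - d r x\<bar> < e \<Longrightarrow> t \<in> U"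
    unfolding open_dist dist_real_def by blast
  have "d r y \<in> U" if "y \<in> space X" "d x y < e" for y
  proof -
    have "d r y \<le> d r x + d x y" "d r x \<le> d r y + d y x" using triangle r x that(1) by blast+
    then have "\<bar>d r y - d r x\<bar> < e" using that(2) commute[of x y] by linarith
    then show ?thesis by (rule e(2))
  qed
  then show "\<exists>t>0. \<forall>y. y \<in> space X \<and> d x y < t \<longrightarrow> d r y \<in> U" using e(1) by blast
qed simp

end

lemma compact_alphabet_metric_process:
  assumes "metric_process G X \<mu> d"
  shows "compact_alphabet X d"
  using assms by (simp add: metric_process_def compact_alphabet_def compact_alphabet_axioms_def)

lemma prod_alphabet_topology:
  assumes "compact_alphabet X dX" "compact_alphabet Y dY"
  shows "metric_topology (X \<Otimes>\<^sub>M Y) (prod_dist dX dY)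
    = prod_topology (metric_topology X dX) (metric_topology Y dY)"
proof -
  interpret X: compact_alphabet X dX by (fact assms(1))
  interpret Y: compact_alphabet Y dY by (fact assms(2))
  interpret Metric_space12 "space X" dX "space Y" dY ..
  show ?thesis using mtopology_prod_metric by (simp add: space_pair_measure)
qed

text \<open>
  Pairs of letters form an alphabet again; thus the results on a single process apply to joinings.
\<close>

lemma compact_alphabet_prod:
  assumes "compact_alphabet X dX" "compact_alphabet Y dY"
  shows "compact_alphabet (X \<Otimes>\<^sub>M Y) (prod_dist dX dY)"
proof -
  interpret X: compact_alphabet X dX by (fact assms(1))
  interpret Y: compact_alphabet Y dY by (fact assms(2))
  interpret Metric_space12 "space X" dX "space Y" dY ..
  have "Metric_space (space (X \<Otimes>\<^sub>M Y)) (prod_dist dX dY)"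
    using prod_metric by (simp add: space_pair_measure)
  moreover have "compact_space (prod_topology X.mtopology Y.mtopology)"
    using X.compact Y.compact by (simp add: compact_space_prod_topology)
  moreover have "sets (X \<Otimes>\<^sub>M Y) = sets (borel_of (prod_topology X.mtopology Y.mtopology))"
    using X.second_countable_compact[OF X.compact] Y.second_countable_compact[OF Y.compact]
      X.sets_alphabet Y.sets_alphabet by (rule sets_pair_borel_of)
  ultimately show ?thesis
    unfolding compact_alphabet_def compact_alphabet_axioms_def
    by (simp add: prod_alphabet_topology[OF assms])
qed

text \<open>
  Uniform continuity for the product topology, jointly for all parameters \<open>u\<close>; it is stated with
  linear bounds because these can be averaged over vertices.
\<close>

definition locally_uniform ::
    "'i set \<Rightarrow> 'x set \<Rightarrow> ('x \<Rightarrow> 'x \<Rightarrow> real) \<Rightarrow> 'u set \<Rightarrow> (('i \<Rightarrow> 'x) \<Rightarrow> 'u \<Rightarrow> real) \<Rightarrow> bool" where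
  "locally_uniform I S d U f \<longleftrightarrow>
     (\<forall>\<epsilon>>0. \<exists>F C. finite F \<and> F \<subseteq> I \<and> 0 \<le> C \<and>
        (\<forall>p\<in>I \<rightarrow>\<^sub>E S. \<forall>q\<in>I \<rightarrow>\<^sub>E S. \<forall>u\<in>U. \<bar>f p u - f q u\<bar> \<le> \<epsilon> + C * (\<Sum>i\<in>F. d (p i) (q i))))"

text \<open>
  The linear bound can be averaged over the vertices, so closeness on average of every single
  coordinate is enough.
\<close>

lemma locally_uniform_avg:
  fixes W :: "'k \<Rightarrow> 'v set"
  assumes f: "locally_uniform I S d U f"
    and p: "\<And>k v. v \<in> W k \<Longrightarrow> p k v \<in> I \<rightarrow>\<^sub>E S" "\<And>k v. v \<in> W k \<Longrightarrow> q k v \<in> I \<rightarrow>\<^sub>E S"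
    and u: "\<And>k v. v \<in> W k \<Longrightarrow> u k v \<in> U"
    and lim: "\<And>i. i \<in> I \<Longrightarrow> ((\<lambda>k. vertex_avg (W k) (\<lambda>v. d (p k v i) (q k v i))) \<longlongrightarrow> 0) F"
  shows "((\<lambda>k. vertex_avg (W k) (\<lambda>v. \<bar>f (p k v) (u k v) - f (q k v) (u k v)\<bar>)) \<longlongrightarrow> 0) F"
proof (rule tendsto_zero_if_eventually_le)
  fix \<epsilon> :: real assume e: "\<epsilon> > 0"
  then have "\<epsilon> / 2 > 0" by simp
  then obtain J C where J: "finite J" "J \<subseteq> I" "0 \<le> C"
    and fJ: "\<And>p q u. p \<in> I \<rightarrow>\<^sub>E S \<Longrightarrow> q \<in> I \<rightarrow>\<^sub>E S \<Longrightarrow> u \<in> U \<Longrightarrow>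
      \<bar>f p u - f q u\<bar> \<le> \<epsilon> / 2 + C * (\<Sum>i\<in>J. d (p i) (q i))"
    using f unfolding locally_uniform_def by meson
  have "((\<lambda>k. C * (\<Sum>i\<in>J. vertex_avg (W k) (\<lambda>v. d (p k v i) (q k v i)))) \<longlongrightarrow> C * (\<Sum>i\<in>J. 0)) F"
    using lim J(2) by (intro tendsto_intros) auto
  then have "\<forall>\<^sub>F k in F. C * (\<Sum>i\<in>J. vertex_avg (W k) (\<lambda>v. d (p k v i) (q k v i))) < \<epsilon> / 2"
    using e by (intro order_tendstoD(2)) auto
  then show "\<forall>\<^sub>F k in F. vertex_avg (W k) (\<lambda>v. \<bar>f (p k v) (u k v) - f (q k v) (u k v)\<bar>) \<le> \<epsilon>"
  proof eventually_elim
    case (elim k)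
    have "vertex_avg (W k) (\<lambda>v. \<bar>f (p k v) (u k v) - f (q k v) (u k v)\<bar>)
        \<le> vertex_avg (W k) (\<lambda>v. \<epsilon> / 2 + C * (\<Sum>i\<in>J. d (p k v i) (q k v i)))"
      using p u by (intro vertex_avg_mono fJ)
    also have "\<dots> = vertex_avg (W k) (\<lambda>v. \<epsilon> / 2) + C * (\<Sum>i\<in>J. vertex_avg (W k) (\<lambda>v. d (p k v i) (q k v i)))"
      by (simp add: vertex_avg_add vertex_avg_cmult vertex_avg_sum)
    also have "\<dots> \<le> \<epsilon>" using elim vertex_avg_const_le[of "\<epsilon> / 2" "W k"] e by linarith
    finally show ?case .
  qed
qed (rule vertex_avg_nonneg, simp)

section \<open>Models over a sofic approximation\<close>

locale sofic_group = group G for G :: "('g, 'm) monoid_scheme" (structure) +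
  fixes V :: "nat \<Rightarrow> 'v set" and \<sigma> :: "nat \<Rightarrow> 'g \<Rightarrow> 'v \<Rightarrow> 'v"
  assumes countable_carrier: "countable (carrier G)"
    and sofic: "sofic_approximation G V \<sigma>"
begin

lemma finite_V: "finite (V n)"
  using sofic by (simp add: sofic_approximation_def)

lemma bij_V: "g \<in> carrier G \<Longrightarrow> bij_betw (\<sigma> n g) (V n) (V n)"
  using sofic by (simp add: sofic_approximation_def)

lemma in_V: "g \<in> carrier G \<Longrightarrow> v \<in> V n \<Longrightarrow> \<sigma> n g v \<in> V n"
  using bij_betwE[OF bij_V] by blast

lemma eventually_V_nonempty: "filterlim n at_top F \<Longrightarrow> \<forall>\<^sub>F i in F. V (n i) \<noteq> {}"
proof -
  assume n: "filterlim n at_top F"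
  have "\<forall>\<^sub>F n in sequentially. 1 \<le> card (V n)"
    using sofic unfolding sofic_approximation_def filterlim_at_top by (elim conjE) (erule allE)
  from filterlim_iff[THEN iffD1, OF n, rule_format, OF this]
  show ?thesis by (auto elim!: eventually_mono)
qed

text \<open>
  The share of the vertices at which the product rule holds tends to \<open>1\<close>, and the share of the others is
  the complement as soon as there are vertices.
\<close>

lemma multiplicativity_defect:
  assumes "g \<in> carrier G" "h \<in> carrier G" "filterlim n at_top F"
  shows "((\<lambda>i. vertex_avg (V (n i)) (\<lambda>v. of_bool (\<sigma> (n i) g (\<sigma> (n i) h v) \<noteq> \<sigma> (n i) (g \<otimes> h) v))) \<longlongrightarrow> 0) F"
proof -
  let ?A = "\<lambda>m. {v \<in> V m. \<sigma> m g (\<sigma> m h v) = \<sigma> m (g \<otimes> h) v}"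
  have "(\<lambda>m. real (card (?A m)) / real (card (V m))) \<longlonglongrightarrow> 1"
    using sofic assms(1,2) by (simp add: sofic_approximation_def)
  from filterlim_compose[OF this assms(3)]
  have "((\<lambda>i. 1 - real (card (?A (n i))) / real (card (V (n i)))) \<longlongrightarrow> 1 - 1) F"
    by (intro tendsto_intros)
  moreover have "\<forall>\<^sub>F i in F. 1 - real (card (?A (n i))) / real (card (V (n i)))
      = vertex_avg (V (n i)) (\<lambda>v. of_bool (\<sigma> (n i) g (\<sigma> (n i) h v) \<noteq> \<sigma> (n i) (g \<otimes> h) v))"
    using eventually_V_nonempty[OF assms(3)]
  proof eventually_elim
    case (elim i)
    have c: "card (V (n i)) \<noteq> 0" using elim finite_V by simp
    have "(\<Sum>v\<in>V (n i). of_bool (\<sigma> (n i) g (\<sigma> (n i) h v) \<noteq> \<sigma> (n i) (g \<otimes> h) v))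
        = (\<Sum>v\<in>V (n i). 1 - of_bool (\<sigma> (n i) g (\<sigma> (n i) h v) = \<sigma> (n i) (g \<otimes> h) v) :: real)"
      by (intro sum.cong) auto
    also have "\<dots> = real (card (V (n i))) - real (card (?A (n i)))"
      using finite_V by (simp add: sum_subtractf sum_of_bool_eq Int_def)
    finally show ?case unfolding vertex_avg_def using c by (simp add: diff_divide_distrib)
  qed
  ultimately show ?thesis by (simp add: tendsto_cong)
qed

lemma pullback_in:
  assumes "x \<in> V n \<rightarrow>\<^sub>E S" "v \<in> V n"
  shows "pullback_name G (\<sigma> n) v x \<in> carrier G \<rightarrow>\<^sub>E S"
  using assms in_V unfolding pullback_name_def by (auto simp: PiE_iff)

lemma shift_in: "p \<in> carrier G \<rightarrow>\<^sub>E S \<Longrightarrow> g \<in> carrier G \<Longrightarrow> shift G g p \<in> carrier G \<rightarrow>\<^sub>E S"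
  unfolding shift_def by auto

text \<open>
  The name of the vertex \<open>\<sigma> g v\<close> agrees in the coordinate \<open>h\<close> with the name of \<open>v\<close> shifted by \<open>g\<close> unless
  \<open>\<sigma> h (\<sigma> g v) \<noteq> \<sigma> (h \<otimes> g) v\<close>, which is rare, and distances are bounded.
\<close>

lemma pullback_shift:
  assumes X: "compact_alphabet X d" and f: "locally_uniform (carrier G) (space X) d U f"
    and x: "\<And>i. x i \<in> V (n i) \<rightarrow>\<^sub>E space X" and u: "\<And>i v. v \<in> V (n i) \<Longrightarrow> u i v \<in> U"
    and n: "filterlim n at_top F" and g: "g \<in> carrier G"
  shows "((\<lambda>i. vertex_avg (V (n i)) (\<lambda>v.
      \<bar>f (shift G g (pullback_name G (\<sigma> (n i)) v (x i))) (u i v)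
        - f (pullback_name G (\<sigma> (n i)) (\<sigma> (n i) g v) (x i)) (u i v)\<bar>)) \<longlongrightarrow> 0) F"
proof (rule locally_uniform_avg[OF f])
  interpret compact_alphabet X d by (fact X)
  obtain B where B: "0 \<le> B" "\<And>x y. x \<in> space X \<Longrightarrow> y \<in> space X \<Longrightarrow> d x y \<le> B"
    by (rule dist_bound) blast
  fix h assume h: "h \<in> carrier G"
  let ?d = "\<lambda>i v. d (shift G g (pullback_name G (\<sigma> (n i)) v (x i)) h)
      (pullback_name G (\<sigma> (n i)) (\<sigma> (n i) g v) (x i) h)"
  let ?D = "\<lambda>i v. of_bool (\<sigma> (n i) h (\<sigma> (n i) g v) \<noteq> \<sigma> (n i) (h \<otimes> g) v) :: real"
  show "((\<lambda>i. vertex_avg (V (n i)) (?d i)) \<longlongrightarrow> 0) F"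
  proof (rule tendsto_sandwich[where f="\<lambda>_. 0" and h="\<lambda>i. B * vertex_avg (V (n i)) (?D i)"])
    show "((\<lambda>i. B * vertex_avg (V (n i)) (?D i)) \<longlongrightarrow> 0) F"
      by (rule tendsto_mult_right_zero[OF multiplicativity_defect[OF h g n]])
    show "((\<lambda>i. 0 :: real) \<longlongrightarrow> 0) F" by simp
    show "\<forall>\<^sub>F i in F. 0 \<le> vertex_avg (V (n i)) (?d i)"
      by (intro always_eventually allI vertex_avg_nonneg) simp
    show "\<forall>\<^sub>F i in F. vertex_avg (V (n i)) (?d i) \<le> B * vertex_avg (V (n i)) (?D i)"
      unfolding vertex_avg_cmult[symmetric]
    proof (intro always_eventually allI vertex_avg_mono)
      fix i v assume v: "v \<in> V (n i)"
      have hg: "h \<otimes> g \<in> carrier G" using h g by simp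
      have mem: "x i (\<sigma> (n i) (h \<otimes> g) v) \<in> space X" "x i (\<sigma> (n i) h (\<sigma> (n i) g v)) \<in> space X"
        using x[of i] in_V[OF hg v] in_V[OF h in_V[OF g v]] by auto
      have "?d i v = d (x i (\<sigma> (n i) (h \<otimes> g) v)) (x i (\<sigma> (n i) h (\<sigma> (n i) g v)))"
        using h hg unfolding shift_def pullback_name_def by simp
      also have "\<dots> \<le> B * ?D i v"
        using B(1) B(2)[OF mem] mdist_zero[OF mem(1)] by (auto simp: of_bool_def)
      finally show "?d i v \<le> B * ?D i v" .
    qed
  qed
qed (assumption | rule shift_in pullback_in x in_V g u)+

text \<open>
  The empirical distributions of \<open>z\<close> converge to the law of the random configuration \<open>c\<close>, expressed
  by test functions.
\<close>

definition models ::
    "'x topology \<Rightarrow> 'w measure \<Rightarrow> ('w \<Rightarrow> 'g \<Rightarrow> 'x) \<Rightarrow> 'i filter \<Rightarrow> ('i \<Rightarrow> nat) \<Rightarrow> ('i \<Rightarrow> 'v \<Rightarrow> 'x) \<Rightarrow> bool"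
where
  "models T P c F n z \<longleftrightarrow>
     (\<forall>K. continuous_map (product_topology (\<lambda>_. T) (carrier G)) euclideanreal K \<longrightarrow>
        ((\<lambda>i. vertex_avg (V (n i)) (\<lambda>v. K (pullback_name G (\<sigma> (n i)) v (z i))))
           \<longlongrightarrow> (\<integral>\<omega>. K (c \<omega>) \<partial>P)) F)"

text \<open>
  Convergence to the joint law of \<open>a\<close> and \<open>b\<close>, tested on pairs of configurations instead of
  configurations of pairs of letters; in this form marginals and exchange of roles are immediate.
\<close>

definition joint_models ::
    "'x topology \<Rightarrow> 'y topology \<Rightarrow> 'w measure \<Rightarrow> ('w \<Rightarrow> 'g \<Rightarrow> 'x) \<Rightarrow> ('w \<Rightarrow> 'g \<Rightarrow> 'y) \<Rightarrow>
      'i filter \<Rightarrow> ('i \<Rightarrow> nat) \<Rightarrow> ('i \<Rightarrow> 'v \<Rightarrow> 'x) \<Rightarrow> ('i \<Rightarrow> 'v \<Rightarrow> 'y) \<Rightarrow> bool"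
where
  "joint_models T T' P a b F n x y \<longleftrightarrow>
     (\<forall>f. continuous_map (prod_topology (product_topology (\<lambda>_. T) (carrier G))
          (product_topology (\<lambda>_. T') (carrier G))) euclideanreal (\<lambda>(p, q). f p q) \<longrightarrow>
        ((\<lambda>i. vertex_avg (V (n i)) (\<lambda>v. f (pullback_name G (\<sigma> (n i)) v (x i))
              (pullback_name G (\<sigma> (n i)) v (y i))))
           \<longlongrightarrow> (\<integral>\<omega>. f (a \<omega>) (b \<omega>) \<partial>P)) F)"

lemma joint_models_fst:
  assumes "joint_models T T' P a b F n x y"
  shows "models T P a F n x"
  unfolding models_def
proof (intro allI impI)
  fix K assume K: "continuous_map (product_topology (\<lambda>_. T) (carrier G)) euclideanreal K"
  have "continuous_map (prod_topology (product_topology (\<lambda>_. T) (carrier G))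
      (product_topology (\<lambda>_. T') (carrier G))) euclideanreal (\<lambda>(p, q). K p)"
    using continuous_map_compose[OF continuous_map_fst K] by (simp add: comp_def case_prod_unfold)
  then show "((\<lambda>i. vertex_avg (V (n i)) (\<lambda>v. K (pullback_name G (\<sigma> (n i)) v (x i))))
      \<longlongrightarrow> (\<integral>\<omega>. K (a \<omega>) \<partial>P)) F"
    using assms unfolding joint_models_def by (elim allE[of _ "\<lambda>p q. K p"] impE) simp_all
qed

lemma joint_models_swap:
  assumes "joint_models T T' P a b F n x y"
  shows "joint_models T' T P b a F n y x"
  unfolding joint_models_def
proof (intro allI impI)
  fix f assume f: "continuous_map (prod_topology (product_topology (\<lambda>_. T') (carrier G))
      (product_topology (\<lambda>_. T) (carrier G))) euclideanreal (\<lambda>(q, p). f q p)"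
  have "continuous_map (prod_topology (product_topology (\<lambda>_. T) (carrier G))
      (product_topology (\<lambda>_. T') (carrier G))) euclideanreal (\<lambda>(p, q). f q p)"
    using continuous_map_compose[OF continuous_map_pairedI[OF continuous_map_snd continuous_map_fst] f]
    by (simp add: comp_def case_prod_unfold)
  then show "((\<lambda>i. vertex_avg (V (n i)) (\<lambda>v. f (pullback_name G (\<sigma> (n i)) v (y i))
      (pullback_name G (\<sigma> (n i)) v (x i)))) \<longlongrightarrow> (\<integral>\<omega>. f (b \<omega>) (a \<omega>) \<partial>P)) F"
    using assms unfolding joint_models_def by (elim allE[of _ "\<lambda>p q. f q p"] impE) simp_all
qed

lemma joint_models_compose:
  assumes "joint_models T T' P a b F n x y" and f: "filterlim f F F'"
  shows "joint_models T T' P a b F' (\<lambda>i. n (f i)) (\<lambda>i. x (f i)) (\<lambda>i. y (f i))"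
  unfolding joint_models_def
  by (intro allI impI filterlim_compose[OF assms(1)[unfolded joint_models_def, rule_format] f])

lemma models_cong:
  assumes "\<forall>\<^sub>F i in F. z i = z' i" "models T P c F n z"
  shows "models T P c F n z'"
  unfolding models_def
proof (intro allI impI)
  fix K assume K: "continuous_map (product_topology (\<lambda>_. T) (carrier G)) euclideanreal K"
  from assms(2)[unfolded models_def, rule_format, OF K]
  show "((\<lambda>i. vertex_avg (V (n i)) (\<lambda>v. K (pullback_name G (\<sigma> (n i)) v (z' i))))
      \<longlongrightarrow> (\<integral>\<omega>. K (c \<omega>) \<partial>P)) F"
    by (rule Lim_transform_eventually) (use assms(1) in eventually_elim, simp)
qed

text \<open>
  The bridge between weak* convergence and averages of test functions.  Empirical distributions are
  probability measures only for nonempty vertex sets, which is why \<open>n\<close> has to tend to infinity.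
\<close>

lemma limitin_empirical:
  assumes Z: "compact_alphabet Z d" and P: "prob_space P"
    and c: "c \<in> P \<rightarrow>\<^sub>M PiM (carrier G) (\<lambda>_. Z)"
    and z: "\<forall>\<^sub>F i in F. z i \<in> V (n i) \<rightarrow>\<^sub>E space Z" and n: "filterlim n at_top F"
  shows "limitin (weak_star_topology (process_topology G Z d))
      (\<lambda>i. empirical G Z (V (n i)) (\<sigma> (n i)) (z i)) (distr P (PiM (carrier G) (\<lambda>_. Z)) c) F
    \<longleftrightarrow> models (metric_topology Z d) P c F n z"
proof -
  interpret compact_alphabet Z d by (fact Z)
  note sets = sets_process[OF countable_carrier]
  let ?T = "product_topology (\<lambda>_. mtopology) (carrier G)"
  let ?M = "PiM (carrier G) (\<lambda>_. Z)"
  have meas: "K \<in> borel_measurable ?M" if "continuous_map ?T euclideanreal K" for K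
    by (rule borel_measurable_continuous_map[OF that sets])
  have law: "distr P ?M c \<in> borel_probs ?T"
    unfolding borel_probs_def using prob_space.prob_space_distr[OF P c] sets by simp
  have pb: "(\<lambda>v. pullback_name G (\<sigma> m) v w) \<in> uniform_count_measure (V m) \<rightarrow>\<^sub>M ?M"
    if "w \<in> V m \<rightarrow>\<^sub>E space Z" for w m
    using pullback_in[OF that]
    by (simp add: measurable_cong_sets[OF sets_uniform_count_measure_count_space refl] space_PiM)
  have emp: "\<forall>\<^sub>F i in F. empirical G Z (V (n i)) (\<sigma> (n i)) (z i) \<in> borel_probs ?T"
    using z eventually_V_nonempty[OF n]
  proof eventually_elim
    case (elim i)
    then have "prob_space (empirical G Z (V (n i)) (\<sigma> (n i)) (z i))"
      unfolding empirical_def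
      by (intro prob_space.prob_space_distr prob_space_uniform_count_measure finite_V pb)
    then show ?case unfolding borel_probs_def using sets by (simp add: empirical_def)
  qed
  have "((\<lambda>i. \<integral>p. K p \<partial>empirical G Z (V (n i)) (\<sigma> (n i)) (z i)) \<longlongrightarrow> (\<integral>p. K p \<partial>distr P ?M c)) F
    \<longleftrightarrow> ((\<lambda>i. vertex_avg (V (n i)) (\<lambda>v. K (pullback_name G (\<sigma> (n i)) v (z i))))
           \<longlongrightarrow> (\<integral>\<omega>. K (c \<omega>) \<partial>P)) F"
    if K: "continuous_map ?T euclideanreal K" for K
  proof -
    have int_eq: "(\<integral>p. K p \<partial>distr P ?M c) = (\<integral>\<omega>. K (c \<omega>) \<partial>P)" by (rule integral_distr[OF c meas[OF K]])
    have "\<forall>\<^sub>F i in F. (\<integral>p. K p \<partial>empirical G Z (V (n i)) (\<sigma> (n i)) (z i))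
        = vertex_avg (V (n i)) (\<lambda>v. K (pullback_name G (\<sigma> (n i)) v (z i)))"
      using z
    proof eventually_elim
      case (elim i)
      show ?case
        unfolding empirical_def integral_distr[OF pb[OF elim] meas[OF K]]
        by (simp add: integral_uniform_count_measure finite_V vertex_avg_def)
    qed
    from tendsto_cong[OF this] show ?thesis unfolding int_eq .
  qed
  then have "(\<forall>K. continuous_map ?T euclideanreal K \<longrightarrow>
        ((\<lambda>i. \<integral>p. K p \<partial>empirical G Z (V (n i)) (\<sigma> (n i)) (z i)) \<longlongrightarrow> (\<integral>p. K p \<partial>distr P ?M c)) F)
      \<longleftrightarrow> models mtopology P c F n z"
    unfolding models_def by (rule all_cong)
  then show ?thesis
    unfolding limitin_weak_star using law emp by simp
qed

definition vanishing_paths ::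
    "'x measure \<Rightarrow> ('x \<Rightarrow> 'x \<Rightarrow> real) \<Rightarrow> 'w measure \<Rightarrow> ('w \<Rightarrow> 'g \<Rightarrow> 'x) \<Rightarrow> (nat \<Rightarrow> nat) \<Rightarrow>
      (nat \<Rightarrow> 'v \<Rightarrow> 'x) \<Rightarrow> (nat \<Rightarrow> 'v \<Rightarrow> 'x) \<Rightarrow> (nat \<Rightarrow> nat) \<Rightarrow> (nat \<times> nat \<Rightarrow> 'v \<Rightarrow> 'x) \<Rightarrow> bool"
where
  "vanishing_paths Z d P c n x y l p \<longleftrightarrow>
     (\<forall>i. p (i, 0) = x i \<and> p (i, l i) = y i \<and> (\<forall>j\<le>l i. p (i, j) \<in> V (n i) \<rightarrow>\<^sub>E space Z)) \<and>
     models (metric_topology Z d) P c (path_filter (\<lambda>i. {..l i})) (\<lambda>k. n (fst k)) p \<and>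
     ((\<lambda>k. average_dist (V (n (fst k))) d (p k) (p (fst k, Suc (snd k)))) \<longlongrightarrow> 0)
       (path_filter (\<lambda>i. {..<l i}))"

text \<open>
  The bounds \<open>\<delta>\<close> and the neighbourhoods of the measure disappear in favour of two limits along path
  filters: the vertices of the paths are models, and the lengths of the steps vanish.
\<close>

lemma connected_model_spaces_iff:
  assumes Z: "compact_alphabet Z d" and P: "prob_space P"
    and c: "c \<in> P \<rightarrow>\<^sub>M PiM (carrier G) (\<lambda>_. Z)"
  shows "connected_model_spaces G V \<sigma> Z (distr P (PiM (carrier G) (\<lambda>_. Z)) c) d \<longleftrightarrow>
    (\<forall>n x y. strict_mono n \<and>
       (\<forall>i. x i \<in> V (n i) \<rightarrow>\<^sub>E space Z) \<and> (\<forall>i. y i \<in> V (n i) \<rightarrow>\<^sub>E space Z) \<and>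
       models (metric_topology Z d) P c sequentially n x \<and>
       models (metric_topology Z d) P c sequentially n y \<longrightarrow>
       (\<exists>l p. vanishing_paths Z d P c n x y l p))"
proof -
  interpret compact_alphabet Z d by (fact Z)
  let ?law = "distr P (PiM (carrier G) (\<lambda>_. Z)) c"
  let ?W = "weak_star_topology (process_topology G Z d)"
  have paths: "(\<exists>\<delta> l p.
        (\<forall>i. 0 < \<delta> i) \<and> decseq \<delta> \<and> \<delta> \<longlonglongrightarrow> 0 \<and>
        (\<forall>i. delta_path (V (n i) \<rightarrow>\<^sub>E space Z) (average_dist (V (n i)) d) (\<delta> i) (l i) (p i) (x i) (y i)) \<and>
        (\<forall>\<O>. weak_star_nhd (process_topology G Z d) ?law \<O> \<longrightarrow>
           (\<forall>\<^sub>F i in sequentially. {p i j | j. j \<le> l i} \<subseteq> good_models G Z (V (n i)) (\<sigma> (n i)) \<O>)))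
    \<longleftrightarrow> (\<exists>l p. vanishing_paths Z d P c n x y l p)" (is "?L \<longleftrightarrow> ?R")
    if "strict_mono n" for n x y
  proof -
    have n: "filterlim n at_top sequentially" using that by (rule filterlim_subseq)
    show ?thesis
    proof
      assume ?L
      then obtain \<delta> l p where \<delta>: "\<delta> \<longlonglongrightarrow> 0"
        and dp: "\<forall>i. delta_path (V (n i) \<rightarrow>\<^sub>E space Z) (average_dist (V (n i)) d) (\<delta> i) (l i) (p i) (x i) (y i)"
        and good: "\<forall>\<O>. weak_star_nhd (process_topology G Z d) ?law \<O> \<longrightarrow>
          (\<forall>\<^sub>F i in sequentially. {p i j | j. j \<le> l i} \<subseteq> good_models G Z (V (n i)) (\<sigma> (n i)) \<O>)"
        by (elim exE conjE)
      have p: "\<And>i. p i 0 = x i" "\<And>i. p i (l i) = y i" "\<And>i j. j \<le> l i \<Longrightarrow> p i j \<in> V (n i) \<rightarrow>\<^sub>E space Z"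
          "\<And>i j. j < l i \<Longrightarrow> average_dist (V (n i)) d (p i j) (p i (Suc j)) < \<delta> i"
        using dp unfolding delta_path_def by simp_all
      define q where "q k = p (fst k) (snd k)" for k
      have mem: "\<forall>\<^sub>F k in path_filter (\<lambda>i. {..l i}). q k \<in> V (n (fst k)) \<rightarrow>\<^sub>E space Z"
        unfolding eventually_path_filter q_def using p(3) by simp
      have "limitin ?W (\<lambda>k. empirical G Z (V (n (fst k))) (\<sigma> (n (fst k))) (q k)) ?law
          (path_filter (\<lambda>i. {..l i}))"
        unfolding limitin_def
      proof (intro conjI allI impI)
        show "?law \<in> topspace ?W"
          unfolding topspace_weak_star borel_probs_def
          using prob_space.prob_space_distr[OF P c] sets_process[OF countable_carrier] by simp
        fix U assume U: "openin ?W U \<and> ?law \<in> U"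
        then have "weak_star_nhd (process_topology G Z d) ?law U"
          unfolding weak_star_nhd_def using openin_subset[of ?W U] topspace_weak_star by blast
        from good[rule_format, OF this] show "\<forall>\<^sub>F k in path_filter (\<lambda>i. {..l i}).
            empirical G Z (V (n (fst k))) (\<sigma> (n (fst k))) (q k) \<in> U"
          unfolding eventually_path_filter q_def
        proof eventually_elim
          case (elim i)
          then show ?case by (auto simp: good_models_def)
        qed
      qed
      then have "models (metric_topology Z d) P c (path_filter (\<lambda>i. {..l i})) (\<lambda>k. n (fst k)) q"
        using limitin_empirical[OF Z P c mem filterlim_path_filter_fst[OF n]] by blast
      moreover have "((\<lambda>k. average_dist (V (n (fst k))) d (q k) (q (fst k, Suc (snd k)))) \<longlongrightarrow> 0)
          (path_filter (\<lambda>i. {..<l i}))"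
      proof (rule tendsto_zero_if_eventually_le)
        show "0 \<le> average_dist (V (n (fst k))) d (q k) (q (fst k, Suc (snd k)))" for k
          unfolding average_dist_eq by (rule vertex_avg_nonneg) simp
        fix \<epsilon> :: real assume "\<epsilon> > 0"
        then have "\<forall>\<^sub>F i in sequentially. \<delta> i < \<epsilon>" using \<delta> by (intro order_tendstoD(2))
        then show "\<forall>\<^sub>F k in path_filter (\<lambda>i. {..<l i}).
            average_dist (V (n (fst k))) d (q k) (q (fst k, Suc (snd k))) \<le> \<epsilon>"
          unfolding eventually_path_filter q_def
        proof eventually_elim
          case (elim i)
          then show ?case using p(4)[of _ i] by fastforce
        qed
      qed
      ultimately have "vanishing_paths Z d P c n x y l q"
        unfolding vanishing_paths_def using p(1-3) by (simp add: q_def)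
      then show ?R by blast
    next
      assume ?R
      then obtain l q where q: "\<And>i. q (i, 0) = x i" "\<And>i. q (i, l i) = y i"
          "\<And>i j. j \<le> l i \<Longrightarrow> q (i, j) \<in> V (n i) \<rightarrow>\<^sub>E space Z"
        and models_q: "models (metric_topology Z d) P c (path_filter (\<lambda>i. {..l i})) (\<lambda>k. n (fst k)) q"
        and dist_q: "((\<lambda>k. average_dist (V (n (fst k))) d (q k) (q (fst k, Suc (snd k)))) \<longlongrightarrow> 0)
          (path_filter (\<lambda>i. {..<l i}))"
        unfolding vanishing_paths_def by blast
      define D where "D i j = average_dist (V (n i)) d (q (i, j)) (q (i, Suc j))" for i j
      (* The longest step; 0 is inserted for paths of length 0. *)
      define s where "s i = Max (insert 0 (D i ` {..<l i}))" for i
      have s_ge: "D i j \<le> s i" if "j < l i" for i j unfolding s_def using that by (intro Max_ge) auto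
      have s_nonneg: "0 \<le> s i" for i unfolding s_def by (intro Max_ge) auto
      have "s \<longlonglongrightarrow> 0"
      proof (rule tendsto_zero_if_eventually_le[OF s_nonneg])
        fix \<epsilon> :: real assume e: "\<epsilon> > 0"
        then have "\<forall>\<^sub>F i in sequentially. \<forall>j\<in>{..<l i}. D i j < \<epsilon>"
          using order_tendstoD(2)[OF dist_q e] unfolding eventually_path_filter D_def by simp
        then show "\<forall>\<^sub>F i in sequentially. s i \<le> \<epsilon>"
        proof eventually_elim
          case (elim i)
          then show ?case using e unfolding s_def by (subst Max_le_iff) (auto simp: less_imp_le)
        qed
      qed
      then obtain \<delta> where \<delta>: "\<And>i. s i < \<delta> i" "decseq \<delta>" "\<delta> \<longlonglongrightarrow> 0"
        by (rule decreasing_majorant) blast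
      have mem: "\<forall>\<^sub>F k in path_filter (\<lambda>i. {..l i}). q k \<in> V (n (fst k)) \<rightarrow>\<^sub>E space Z"
        unfolding eventually_path_filter using q(3) by simp
      have lim: "limitin ?W (\<lambda>k. empirical G Z (V (n (fst k))) (\<sigma> (n (fst k))) (q k)) ?law
          (path_filter (\<lambda>i. {..l i}))"
        using limitin_empirical[OF Z P c mem filterlim_path_filter_fst[OF n]] models_q by blast
      have "\<forall>\<^sub>F i in sequentially. {q (i, j) | j. j \<le> l i} \<subseteq> good_models G Z (V (n i)) (\<sigma> (n i)) \<O>"
        if nhd: "weak_star_nhd (process_topology G Z d) ?law \<O>" for \<O>
      proof -
        obtain U where U: "openin ?W U" "?law \<in> U" "U \<subseteq> \<O>"
          using nhd unfolding weak_star_nhd_def by blast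
        from limitinD[OF lim U(1,2)] show ?thesis
          unfolding eventually_path_filter
        proof eventually_elim
          case (elim i)
          show ?case
          proof
            fix w assume "w \<in> {q (i, j) | j. j \<le> l i}"
            then obtain j where j: "j \<le> l i" "w = q (i, j)" by blast
            then have "empirical G Z (V (n i)) (\<sigma> (n i)) w \<in> \<O>" using elim U(3) by auto
            then show "w \<in> good_models G Z (V (n i)) (\<sigma> (n i)) \<O>"
              unfolding good_models_def using q(3)[OF j(1)] j(2) by blast
          qed
        qed
      qed
      moreover have "delta_path (V (n i) \<rightarrow>\<^sub>E space Z) (average_dist (V (n i)) d) (\<delta> i) (l i)
          (\<lambda>j. q (i, j)) (x i) (y i)" for i
        unfolding delta_path_def using q s_ge \<delta>(1)[of i] by (fastforce simp: D_def)
      moreover have "0 < \<delta> i" for i using \<delta>(1)[of i] s_nonneg[of i] by linarith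
      ultimately show ?L
        using \<delta>(2,3) by (intro exI[of _ \<delta>] exI[of _ l] exI[of _ "\<lambda>i j. q (i, j)"]) blast
    qed
  qed
  have lims: "limitin ?W (\<lambda>i. empirical G Z (V (n i)) (\<sigma> (n i)) (x i)) ?law sequentially
      \<longleftrightarrow> models (metric_topology Z d) P c sequentially n x"
    if "strict_mono n" "\<forall>i. x i \<in> V (n i) \<rightarrow>\<^sub>E space Z" for n x
    using that(2) by (intro limitin_empirical[OF Z P c _ filterlim_subseq[OF that(1)]]) simp
  show ?thesis
    unfolding connected_model_spaces_def
    by (intro all_cong1 imp_cong conj_cong refl lims paths) simp_all
qed

end

section \<open>Joinings in which the first process determines the second\<close>

text \<open>
  A joining of two processes is given as the law of a pair of random configurations \<open>a\<close>, \<open>b\<close> on an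
  arbitrary probability space such that \<open>b\<close> is almost surely a function of \<open>a\<close>.  If \<open>a\<close> is also a
  function of \<open>b\<close>, exchanging the roles amounts to swapping \<open>a\<close> and \<open>b\<close>.  Stationarity is expressed
  by transformations \<open>R\<close> of the space that act on both configurations as the shift.
\<close>

locale joining = sofic_group G V \<sigma> + X: compact_alphabet X dX + Y: compact_alphabet Y dY + P: prob_space P
  for G :: "('g, 'm) monoid_scheme" (structure) and V :: "nat \<Rightarrow> 'v set" and \<sigma>
    and X :: "'x measure" and dX and Y :: "'y measure" and dY and P :: "'w measure" +
  fixes a :: "'w \<Rightarrow> 'g \<Rightarrow> 'x" and b :: "'w \<Rightarrow> 'g \<Rightarrow> 'y"
  assumes a_meas: "a \<in> P \<rightarrow>\<^sub>M PiM (carrier G) (\<lambda>_. X)"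
    and b_meas: "b \<in> P \<rightarrow>\<^sub>M PiM (carrier G) (\<lambda>_. Y)"
    and factor: "\<exists>\<psi>\<in>PiM (carrier G) (\<lambda>_. X) \<rightarrow>\<^sub>M PiM (carrier G) (\<lambda>_. Y). AE \<omega> in P. b \<omega> = \<psi> (a \<omega>)"
    and stationary: "\<And>g. g \<in> carrier G \<Longrightarrow> \<exists>R\<in>P \<rightarrow>\<^sub>M P. distr P P R = P \<and>
      (AE \<omega> in P. a (R \<omega>) = shift G g (a \<omega>)) \<and> (AE \<omega> in P. b (R \<omega>) = shift G g (b \<omega>))"
begin

abbreviation XG where "XG \<equiv> product_topology (\<lambda>_. X.mtopology) (carrier G)"
abbreviation YG where "YG \<equiv> product_topology (\<lambda>_. Y.mtopology) (carrier G)"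
abbreviation J where
  "J \<equiv> product_topology (\<lambda>_. prod_topology X.mtopology Y.mtopology) (carrier G)"
abbreviation X_models where "X_models \<equiv> models X.mtopology P a"
abbreviation XY_models where "XY_models \<equiv> joint_models X.mtopology Y.mtopology P a b"
abbreviation pb where "pb i v x \<equiv> pullback_name G (\<sigma> i) v x"

definition pair_up :: "('g \<Rightarrow> 'x) \<Rightarrow> ('g \<Rightarrow> 'y) \<Rightarrow> 'g \<Rightarrow> 'x \<times> 'y" where
  "pair_up p q = (\<lambda>g\<in>carrier G. (p g, q g))"

definition fst_part :: "('g \<Rightarrow> 'x \<times> 'y) \<Rightarrow> 'g \<Rightarrow> 'x" where
  "fst_part z = (\<lambda>g\<in>carrier G. fst (z g))"

definition snd_part :: "('g \<Rightarrow> 'x \<times> 'y) \<Rightarrow> 'g \<Rightarrow> 'y" where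
  "snd_part z = (\<lambda>g\<in>carrier G. snd (z g))"

lemma fst_pair_up: "p \<in> carrier G \<rightarrow>\<^sub>E S \<Longrightarrow> fst_part (pair_up p q) = p"
  unfolding fst_part_def pair_up_def by (auto simp: PiE_iff extensional_def)

lemma snd_pair_up: "q \<in> carrier G \<rightarrow>\<^sub>E S \<Longrightarrow> snd_part (pair_up p q) = q"
  unfolding snd_part_def pair_up_def by (auto simp: PiE_iff extensional_def)

lemma continuous_map_pair_up: "continuous_map (prod_topology XG YG) J (\<lambda>(p, q). pair_up p q)"
  unfolding continuous_map_componentwise
proof (intro conjI ballI)
  show "(\<lambda>(p, q). pair_up p q) ` topspace (prod_topology XG YG) \<subseteq> extensional (carrier G)"
    by (auto simp: pair_up_def)
  fix g assume g: "g \<in> carrier G"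
  have "continuous_map (prod_topology XG YG) (prod_topology X.mtopology Y.mtopology) (\<lambda>z. (fst z g, snd z g))"
    using continuous_map_compose[OF continuous_map_fst continuous_map_product_projection[OF g]]
      continuous_map_compose[OF continuous_map_snd continuous_map_product_projection[OF g]]
    by (intro continuous_map_pairedI) (simp_all add: comp_def)
  then show "continuous_map (prod_topology XG YG) (prod_topology X.mtopology Y.mtopology)
      (\<lambda>z. (case z of (p, q) \<Rightarrow> pair_up p q) g)"
    using g by (simp add: pair_up_def case_prod_unfold)
qed

lemma continuous_map_parts: "continuous_map J (prod_topology XG YG) (\<lambda>z. (fst_part z, snd_part z))"
proof (rule continuous_map_pairedI)
  show "continuous_map J XG fst_part"
    unfolding continuous_map_componentwise
  proof (intro conjI ballI)
    fix g assume g: "g \<in> carrier G"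
    show "continuous_map J X.mtopology (\<lambda>z. fst_part z g)"
      using continuous_map_compose[OF continuous_map_product_projection[OF g] continuous_map_fst] g
      by (simp add: fst_part_def comp_def)
  qed (auto simp: fst_part_def)
  show "continuous_map J YG snd_part"
    unfolding continuous_map_componentwise
  proof (intro conjI ballI)
    fix g assume g: "g \<in> carrier G"
    show "continuous_map J Y.mtopology (\<lambda>z. snd_part z g)"
      using continuous_map_compose[OF continuous_map_product_projection[OF g] continuous_map_snd] g
      by (simp add: snd_part_def comp_def)
  qed (auto simp: snd_part_def)
qed

lemma continuous_map_on_joint:
  "continuous_map (prod_topology XG YG) euclideanreal (\<lambda>(p, q). f p q) \<Longrightarrow>
    continuous_map J euclideanreal (\<lambda>z. f (fst_part z) (snd_part z))"
  using continuous_map_compose[OF continuous_map_parts] by (fastforce simp: comp_def)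

lemma a_space: "\<omega> \<in> space P \<Longrightarrow> a \<omega> \<in> carrier G \<rightarrow>\<^sub>E space X"
  using measurable_space[OF a_meas] by (simp add: space_PiM)

lemma b_space: "\<omega> \<in> space P \<Longrightarrow> b \<omega> \<in> carrier G \<rightarrow>\<^sub>E space Y"
  using measurable_space[OF b_meas] by (simp add: space_PiM)

lemma b_one: "\<omega> \<in> space P \<Longrightarrow> b \<omega> \<one> \<in> space Y"
  using b_space by auto

lemma space_Y_nonempty: "space Y \<noteq> {}"
  using P.not_empty b_one by blast

text \<open>
  Configurations of pairs of letters correspond homeomorphically to pairs of configurations.
\<close>

lemma joint_models_iff:
  assumes x: "\<And>i. x i \<in> V (n i) \<rightarrow>\<^sub>E space X" and y: "\<And>i. y i \<in> V (n i) \<rightarrow>\<^sub>E space Y"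
  shows "XY_models F n x y \<longleftrightarrow>
    models (prod_topology X.mtopology Y.mtopology) P (\<lambda>\<omega>. pair_up (a \<omega>) (b \<omega>)) F n
      (\<lambda>i. \<lambda>v\<in>V (n i). (x i v, y i v))"
proof -
  let ?z = "\<lambda>i. \<lambda>v\<in>V (n i). (x i v, y i v)"
  have pz: "pb (n i) v (?z i) = pair_up (pb (n i) v (x i)) (pb (n i) v (y i))"
    if "v \<in> V (n i)" for i v
    unfolding pullback_name_def pair_up_def using that in_V by (auto simp: restrict_def)
  show ?thesis
  proof
    assume L: "XY_models F n x y"
    show "models (prod_topology X.mtopology Y.mtopology) P (\<lambda>\<omega>. pair_up (a \<omega>) (b \<omega>)) F n ?z"
      unfolding models_def
    proof (intro allI impI)
      fix K assume K: "continuous_map J euclideanreal K"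
      have "continuous_map (prod_topology XG YG) euclideanreal (\<lambda>(p, q). K (pair_up p q))"
        using continuous_map_compose[OF continuous_map_pair_up K] by (simp add: comp_def case_prod_unfold)
      from L[unfolded joint_models_def, rule_format, OF this]
      show "((\<lambda>i. vertex_avg (V (n i)) (\<lambda>v. K (pb (n i) v (?z i))))
          \<longlongrightarrow> (\<integral>\<omega>. K (pair_up (a \<omega>) (b \<omega>)) \<partial>P)) F"
        by (simp add: pz cong: vertex_avg_cong)
    qed
  next
    assume R: "models (prod_topology X.mtopology Y.mtopology) P (\<lambda>\<omega>. pair_up (a \<omega>) (b \<omega>)) F n ?z"
    show "XY_models F n x y"
      unfolding joint_models_def
    proof (intro allI impI)
      fix f assume f: "continuous_map (prod_topology XG YG) euclideanreal (\<lambda>(p, q). f p q)"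
      let ?K = "\<lambda>z. f (fst_part z) (snd_part z)"
      have "?K (pb (n i) v (?z i)) = f (pb (n i) v (x i)) (pb (n i) v (y i))" if "v \<in> V (n i)" for i v
        unfolding pz[OF that] using fst_pair_up[OF pullback_in[OF x that]] snd_pair_up[OF pullback_in[OF y that]]
        by simp
      then have 1: "vertex_avg (V (n i)) (\<lambda>v. ?K (pb (n i) v (?z i)))
          = vertex_avg (V (n i)) (\<lambda>v. f (pb (n i) v (x i)) (pb (n i) v (y i)))" for i
        by (rule vertex_avg_cong)
      have 2: "(\<integral>\<omega>. ?K (pair_up (a \<omega>) (b \<omega>)) \<partial>P) = (\<integral>\<omega>. f (a \<omega>) (b \<omega>) \<partial>P)"
        using fst_pair_up[OF a_space] snd_pair_up[OF b_space]
        by (intro Bochner_Integration.integral_cong) auto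
      from R[unfolded models_def, rule_format, OF continuous_map_on_joint[OF f]]
      show "((\<lambda>i. vertex_avg (V (n i)) (\<lambda>v. f (pb (n i) v (x i)) (pb (n i) v (y i))))
          \<longlongrightarrow> (\<integral>\<omega>. f (a \<omega>) (b \<omega>) \<partial>P)) F"
        unfolding 1 2 .
    qed
  qed
qed

lemma pair_up_meas: "(\<lambda>\<omega>. pair_up (a \<omega>) (b \<omega>)) \<in> P \<rightarrow>\<^sub>M PiM (carrier G) (\<lambda>_. X \<Otimes>\<^sub>M Y)"
  unfolding pair_up_def
proof (rule measurable_restrict)
  fix g assume g: "g \<in> carrier G"
  show "(\<lambda>\<omega>. (a \<omega> g, b \<omega> g)) \<in> P \<rightarrow>\<^sub>M X \<Otimes>\<^sub>M Y"
    using measurable_compose[OF a_meas measurable_component_singleton[OF g]]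
      measurable_compose[OF b_meas measurable_component_singleton[OF g]]
    by (rule measurable_Pair)
qed

lemma prod_alphabet: "compact_alphabet (X \<Otimes>\<^sub>M Y) (prod_dist dX dY)"
  by (intro compact_alphabet_prod X.compact_alphabet_axioms Y.compact_alphabet_axioms)

lemma integrable_joint:
  assumes f: "continuous_map (prod_topology XG YG) euclideanreal (\<lambda>(p, q). f p q)"
  shows "integrable P (\<lambda>\<omega>. f (a \<omega>) (b \<omega>))"
proof -
  interpret Z: compact_alphabet "X \<Otimes>\<^sub>M Y" "prod_dist dX dY" by (rule prod_alphabet)
  have top: "Z.mtopology = prod_topology X.mtopology Y.mtopology"
    by (rule prod_alphabet_topology[OF X.compact_alphabet_axioms Y.compact_alphabet_axioms])
  have "integrable P (\<lambda>\<omega>. f (fst_part (pair_up (a \<omega>) (b \<omega>))) (snd_part (pair_up (a \<omega>) (b \<omega>))))"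
    by (rule Z.integrable_continuous_process[OF countable_carrier P.finite_measure_axioms pair_up_meas])
      (unfold top, rule continuous_map_on_joint[OF f])
  also have "?this \<longleftrightarrow> ?thesis"
    using fst_pair_up[OF a_space] snd_pair_up[OF b_space] by (intro Bochner_Integration.integrable_cong) auto
  finally show ?thesis .
qed

lemma continuous_map_shift: "g \<in> carrier G \<Longrightarrow> continuous_map XG XG (shift G g)"
  unfolding continuous_map_componentwise
  by (auto simp: shift_def intro!: continuous_map_product_projection)

section \<open>Continuous approximations of the graph of a factor map\<close>

text \<open>
  \<open>D p u\<close> measures how far the letter \<open>u\<close> is from the letter that \<open>p\<close> determines at \<open>\<one>\<close>.  The second
  condition says that \<open>D p\<close> is small on a set of small diameter only, and the third one that it is small
  at the true letter for most \<open>p\<close>.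
\<close>

definition approximate_graph :: "real \<Rightarrow> (('g \<Rightarrow> 'x) \<Rightarrow> 'y \<Rightarrow> real) \<Rightarrow> bool" where
  "approximate_graph \<epsilon> D \<longleftrightarrow>
     (\<forall>p u. 0 \<le> D p u) \<and>
     (\<forall>p\<in>carrier G \<rightarrow>\<^sub>E space X. \<forall>u\<in>space Y. \<forall>w\<in>space Y. dY u w \<le> \<epsilon> + D p u + D p w) \<and>
     (\<integral>\<omega>. D (a \<omega>) (b \<omega> \<one>) \<partial>P) < \<epsilon> \<and>
     continuous_map (prod_topology XG Y.mtopology) euclideanreal (\<lambda>(p, u). D p u) \<and>
     locally_uniform (carrier G) (space X) dX (space Y) D"

lemma approximate_graphD:
  assumes "approximate_graph \<epsilon> D"
  shows "0 \<le> D p u"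
    and "p \<in> carrier G \<rightarrow>\<^sub>E space X \<Longrightarrow> u \<in> space Y \<Longrightarrow> w \<in> space Y \<Longrightarrow> dY u w \<le> \<epsilon> + D p u + D p w"
    and "(\<integral>\<omega>. D (a \<omega>) (b \<omega> \<one>) \<partial>P) < \<epsilon>"
    and "continuous_map (prod_topology XG Y.mtopology) euclideanreal (\<lambda>(p, u). D p u)"
    and "locally_uniform (carrier G) (space X) dX (space Y) D"
  using assms unfolding approximate_graph_def by simp_all

lemma continuous_map_shift_eval:
  assumes D: "continuous_map (prod_topology XG Y.mtopology) euclideanreal (\<lambda>(p, u). D p u)"
    and g: "g \<in> carrier G" and h: "h \<in> carrier G"
  shows "continuous_map (prod_topology XG YG) euclideanreal (\<lambda>(p, q). D (shift G g p) (q h))"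
proof -
  have "continuous_map (prod_topology XG YG) (prod_topology XG Y.mtopology) (\<lambda>z. (shift G g (fst z), snd z h))"
    using continuous_map_compose[OF continuous_map_fst continuous_map_shift[OF g]]
      continuous_map_compose[OF continuous_map_snd continuous_map_product_projection[OF h]]
    by (intro continuous_map_pairedI) (simp_all add: comp_def)
  from continuous_map_compose[OF this D] show ?thesis by (simp add: comp_def case_prod_unfold)
qed

lemma continuous_map_eval:
  assumes D: "continuous_map (prod_topology XG Y.mtopology) euclideanreal (\<lambda>(p, u). D p u)"
    and h: "h \<in> carrier G"
  shows "continuous_map (prod_topology XG YG) euclideanreal (\<lambda>(p, q). D p (q h))"
proof -
  have "continuous_map (prod_topology XG YG) (prod_topology XG Y.mtopology) (\<lambda>z. (fst z, snd z h))"
    using continuous_map_fst continuous_map_compose[OF continuous_map_snd continuous_map_product_projection[OF h]]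
    by (intro continuous_map_pairedI) (simp_all add: comp_def)
  from continuous_map_compose[OF this D] show ?thesis by (simp add: comp_def case_prod_unfold)
qed

lemma integral_stationary:
  assumes D: "continuous_map (prod_topology XG Y.mtopology) euclideanreal (\<lambda>(p, u). D p u)"
    and g: "g \<in> carrier G"
  shows "(\<integral>\<omega>. D (shift G g (a \<omega>)) (b \<omega> g) \<partial>P) = (\<integral>\<omega>. D (a \<omega>) (b \<omega> \<one>) \<partial>P)"
proof -
  obtain R where R: "R \<in> P \<rightarrow>\<^sub>M P" "distr P P R = P" "AE \<omega> in P. a (R \<omega>) = shift G g (a \<omega>)"
      "AE \<omega> in P. b (R \<omega>) = shift G g (b \<omega>)"
    using stationary[OF g] by blast
  have m1: "(\<lambda>\<omega>. D (a \<omega>) (b \<omega> \<one>)) \<in> borel_measurable P"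
    by (rule borel_measurable_integrable[OF integrable_joint[OF continuous_map_eval[OF D one_closed]]])
  have m2: "(\<lambda>\<omega>. D (shift G g (a \<omega>)) (b \<omega> g)) \<in> borel_measurable P"
    by (rule borel_measurable_integrable[OF integrable_joint[OF continuous_map_shift_eval[OF D g g]]])
  have "(\<integral>\<omega>. D (a \<omega>) (b \<omega> \<one>) \<partial>P) = (\<integral>\<omega>. D (a (R \<omega>)) (b (R \<omega>) \<one>) \<partial>P)"
    using integral_distr[OF R(1) m1] R(2) by simp
  also have "\<dots> = (\<integral>\<omega>. D (shift G g (a \<omega>)) (b \<omega> g) \<partial>P)"
  proof (rule integral_cong_AE)
    show "AE \<omega> in P. D (a (R \<omega>)) (b (R \<omega>) \<one>) = D (shift G g (a \<omega>)) (b \<omega> g)"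
      using R(3,4) by eventually_elim (use g in \<open>simp add: shift_def\<close>)
  qed (use measurable_compose[OF R(1) m1] m2 in simp_all)
  finally show ?thesis by simp
qed

text \<open>
  For the points \<open>r\<close> of a finite net of \<open>Y\<close>, the distance of \<open>r\<close> to the letter determined by \<open>p\<close> is a
  bounded measurable function of \<open>p\<close>.  Take continuous approximations \<open>h r\<close> of these functions in the
  mean; then \<open>D p u\<close> sums the differences between the distances of \<open>u\<close> to the net and the predicted
  distances \<open>h r p\<close>.  Two letters with similar distances to a net are close to each other.
\<close>

lemma approximate_graph_exists:
  assumes e: "\<epsilon> > 0"
  obtains D where "approximate_graph \<epsilon> D"
proof -
  obtain N where N: "finite N" "N \<subseteq> space Y" "\<And>u. u \<in> space Y \<Longrightarrow> \<exists>r\<in>N. dY r u < \<epsilon> / 2"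
    using Y.finite_net[of "\<epsilon> / 2"] e by auto
  obtain \<psi> where \<psi>: "\<psi> \<in> PiM (carrier G) (\<lambda>_. X) \<rightarrow>\<^sub>M PiM (carrier G) (\<lambda>_. Y)" "AE \<omega> in P. b \<omega> = \<psi> (a \<omega>)"
    using factor by blast
  define \<epsilon>' where "\<epsilon>' = \<epsilon> / (real (card N) + 1)"
  have e': "\<epsilon>' > 0" unfolding \<epsilon>'_def using e by simp
  let ?M = "distr P (PiM (carrier G) (\<lambda>_. X)) a"
  interpret M: prob_space ?M by (rule P.prob_space_distr[OF a_meas])
  have one: "(\<lambda>q. q \<one>) \<in> PiM (carrier G) (\<lambda>_. Y) \<rightarrow>\<^sub>M Y"
    by (rule measurable_component_singleton) simp
  have dmeas: "dY r \<in> borel_measurable Y" if "r \<in> N" for r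
    using N(2) that by (intro borel_measurable_continuous_map[OF Y.continuous_map_dist Y.sets_alphabet]) auto
  obtain B where B: "0 \<le> B" "\<And>u w. u \<in> space Y \<Longrightarrow> w \<in> space Y \<Longrightarrow> dY u w \<le> B"
    by (rule Y.dist_bound) blast
  have "\<exists>h. continuous_map XG euclideanreal h \<and> (\<integral>\<omega>. \<bar>dY r (b \<omega> \<one>) - h (a \<omega>)\<bar> \<partial>P) < \<epsilon>'" if r: "r \<in> N" for r
  proof -
    have um: "(\<lambda>p. dY r (\<psi> p \<one>)) \<in> borel_measurable (PiM (carrier G) (\<lambda>_. X))"
      by (rule measurable_compose[OF measurable_compose[OF \<psi>(1) one] dmeas[OF r]])
    have "integrable ?M (\<lambda>p. dY r (\<psi> p \<one>))"
    proof (rule M.integrable_const_bound[of _ B])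
      show "AE p in ?M. norm (dY r (\<psi> p \<one>)) \<le> B"
      proof (rule AE_I2)
        fix p assume "p \<in> space ?M"
        then have "\<psi> p \<one> \<in> space Y"
          using measurable_space[OF \<psi>(1), of p] by (auto simp: space_PiM)
        then show "norm (dY r (\<psi> p \<one>)) \<le> B" using B(2) N(2) r by auto
      qed
    qed (use um in simp)
    then have "L1_approximable XG ?M (\<lambda>p. dY r (\<psi> p \<one>))"
      using X.sets_process[OF countable_carrier]
      by (intro L1_approximable_integrable[OF X.compact_process X.metrizable_process[OF countable_carrier]
            M.finite_measure_axioms]) simp_all
    then obtain h where h: "continuous_map XG euclideanreal h" "(\<integral>p. \<bar>dY r (\<psi> p \<one>) - h p\<bar> \<partial>?M) < \<epsilon>'"
      using e' unfolding L1_approximable_def by blast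
    have hm: "h \<in> borel_measurable (PiM (carrier G) (\<lambda>_. X))"
      by (rule borel_measurable_continuous_map[OF h(1) X.sets_process[OF countable_carrier]])
    have m: "(\<lambda>p. \<bar>dY r (\<psi> p \<one>) - h p\<bar>) \<in> borel_measurable (PiM (carrier G) (\<lambda>_. X))"
      using um hm by measurable
    have "(\<integral>p. \<bar>dY r (\<psi> p \<one>) - h p\<bar> \<partial>?M) = (\<integral>\<omega>. \<bar>dY r (\<psi> (a \<omega>) \<one>) - h (a \<omega>)\<bar> \<partial>P)"
      by (rule integral_distr[OF a_meas m])
    also have "\<dots> = (\<integral>\<omega>. \<bar>dY r (b \<omega> \<one>) - h (a \<omega>)\<bar> \<partial>P)"
    proof (rule integral_cong_AE)
      show "AE \<omega> in P. \<bar>dY r (\<psi> (a \<omega>) \<one>) - h (a \<omega>)\<bar> = \<bar>dY r (b \<omega> \<one>) - h (a \<omega>)\<bar>"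
        using \<psi>(2) by eventually_elim simp
      show "(\<lambda>\<omega>. \<bar>dY r (b \<omega> \<one>) - h (a \<omega>)\<bar>) \<in> borel_measurable P"
        using measurable_compose[OF measurable_compose[OF b_meas one] dmeas[OF r]] measurable_compose[OF a_meas hm]
        by measurable
    qed (rule measurable_compose[OF a_meas m])
    finally show ?thesis using h by auto
  qed
  then obtain h where h: "\<And>r. r \<in> N \<Longrightarrow> continuous_map XG euclideanreal (h r)"
      "\<And>r. r \<in> N \<Longrightarrow> (\<integral>\<omega>. \<bar>dY r (b \<omega> \<one>) - h r (a \<omega>)\<bar> \<partial>P) < \<epsilon>'"
    by metis
  define D where "D p u = (\<Sum>r\<in>N. \<bar>dY r u - h r p\<bar>)" for p u
  have contr: "continuous_map (prod_topology XG Y.mtopology) euclideanreal (\<lambda>(p, u). \<bar>dY r u - h r p\<bar>)"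
    if r: "r \<in> N" for r
  proof -
    have "r \<in> space Y" using N(2) r by blast
    from continuous_map_compose[OF continuous_map_snd Y.continuous_map_dist[OF this]]
      continuous_map_compose[OF continuous_map_fst h(1)[OF r]]
    show ?thesis
      unfolding case_prod_unfold comp_def by (intro continuous_map_real_abs continuous_map_diff)
  qed
  have cont: "continuous_map (prod_topology XG Y.mtopology) euclideanreal (\<lambda>(p, u). D p u)"
    unfolding D_def case_prod_unfold
    using contr N(1) by (intro continuous_map_sum) (auto simp: case_prod_unfold)
  have small: "(\<integral>\<omega>. D (a \<omega>) (b \<omega> \<one>) \<partial>P) < \<epsilon>"
  proof -
    have "(\<integral>\<omega>. D (a \<omega>) (b \<omega> \<one>) \<partial>P) = (\<Sum>r\<in>N. \<integral>\<omega>. \<bar>dY r (b \<omega> \<one>) - h r (a \<omega>)\<bar> \<partial>P)"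
      unfolding D_def
      using integrable_joint[OF continuous_map_eval[OF contr one_closed]]
      by (intro Bochner_Integration.integral_sum) simp
    also have "\<dots> \<le> (\<Sum>r\<in>N. \<epsilon>')" using h(2) by (intro sum_mono) (simp add: less_imp_le)
    also have "\<dots> = \<epsilon> * (real (card N) / (real (card N) + 1))" by (simp add: \<epsilon>'_def)
    also have "\<dots> < \<epsilon> * 1" using e by (intro mult_strict_left_mono) auto
    finally show ?thesis by simp
  qed
  have nonneg: "0 \<le> D p u" for p u unfolding D_def by (intro sum_nonneg) simp
  have tri: "dY u w \<le> \<epsilon> + D p u + D p w" if u: "u \<in> space Y" and w: "w \<in> space Y" for p u w
  proof -
    obtain r where r: "r \<in> N" "dY r u < \<epsilon> / 2" using N(3)[OF u] by blast
    then have rY: "r \<in> space Y" using N(2) by blast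
    have "dY u w \<le> dY u r + dY r w" using Y.triangle[OF u rY w] .
    moreover have "dY u r = dY r u" by (rule Y.commute)
    moreover have "\<bar>dY r u - h r p\<bar> \<le> D p u" "\<bar>dY r w - h r p\<bar> \<le> D p w"
      unfolding D_def using N(1) r(1) by (auto intro!: member_le_sum)
    ultimately show ?thesis using r(2) by linarith
  qed
  have unif: "locally_uniform (carrier G) (space X) dX (space Y) D"
    unfolding locally_uniform_def
  proof (intro allI impI)
    fix \<delta> :: real assume d: "\<delta> > 0"
    define \<delta>' where "\<delta>' = \<delta> / (real (card N) + 1)"
    have d': "\<delta>' > 0" unfolding \<delta>'_def using d by simp
    have "\<exists>F C. finite F \<and> F \<subseteq> carrier G \<and> 0 \<le> C \<and> (\<forall>p\<in>carrier G \<rightarrow>\<^sub>E space X. \<forall>q\<in>carrier G \<rightarrow>\<^sub>E space X.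
        \<bar>h r p - h r q\<bar> \<le> \<delta>' + C * (\<Sum>i\<in>F. dX (p i) (q i)))" if r: "r \<in> N" for r
      using X.product_modulus[OF X.compact h(1)[OF r] d'] by metis
    then have "\<forall>r\<in>N. \<exists>F C. finite F \<and> F \<subseteq> carrier G \<and> 0 \<le> C \<and> (\<forall>p\<in>carrier G \<rightarrow>\<^sub>E space X.
        \<forall>q\<in>carrier G \<rightarrow>\<^sub>E space X. \<bar>h r p - h r q\<bar> \<le> \<delta>' + C * (\<Sum>i\<in>F. dX (p i) (q i)))"
      by (rule ballI)
    from bchoice[OF this] obtain F where "\<forall>r\<in>N. \<exists>C. finite (F r) \<and> F r \<subseteq> carrier G \<and> 0 \<le> C \<and>
        (\<forall>p\<in>carrier G \<rightarrow>\<^sub>E space X. \<forall>q\<in>carrier G \<rightarrow>\<^sub>E space X.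
          \<bar>h r p - h r q\<bar> \<le> \<delta>' + C * (\<Sum>i\<in>F r. dX (p i) (q i)))"
      by (elim exE)
    from bchoice[OF this] obtain C where FC: "\<forall>r\<in>N. finite (F r) \<and> F r \<subseteq> carrier G \<and> 0 \<le> C r \<and>
        (\<forall>p\<in>carrier G \<rightarrow>\<^sub>E space X. \<forall>q\<in>carrier G \<rightarrow>\<^sub>E space X.
          \<bar>h r p - h r q\<bar> \<le> \<delta>' + C r * (\<Sum>i\<in>F r. dX (p i) (q i)))"
      by (elim exE)
    have C: "0 \<le> C r" if "r \<in> N" for r using FC that by blast
    define F0 where "F0 = (\<Union>r\<in>N. F r)"
    define C0 where "C0 = (\<Sum>r\<in>N. C r)"
    have F0: "finite F0" "F0 \<subseteq> carrier G" unfolding F0_def using N(1) FC by blast+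
    have C0: "0 \<le> C0" unfolding C0_def using C by (intro sum_nonneg)
    have "\<bar>D p u - D q u\<bar> \<le> \<delta> + C0 * (\<Sum>i\<in>F0. dX (p i) (q i))"
      if p: "p \<in> carrier G \<rightarrow>\<^sub>E space X" and q: "q \<in> carrier G \<rightarrow>\<^sub>E space X" for p q u
    proof -
      have "\<bar>D p u - D q u\<bar> \<le> (\<Sum>r\<in>N. \<bar>\<bar>dY r u - h r p\<bar> - \<bar>dY r u - h r q\<bar>\<bar>)"
        unfolding D_def sum_subtractf[symmetric] by (rule sum_abs)
      also have "\<dots> \<le> (\<Sum>r\<in>N. \<delta>' + C r * (\<Sum>i\<in>F0. dX (p i) (q i)))"
      proof (rule sum_mono)
        fix r assume r: "r \<in> N"
        have "\<bar>\<bar>dY r u - h r p\<bar> - \<bar>dY r u - h r q\<bar>\<bar> \<le> \<bar>h r p - h r q\<bar>" by linarith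
        also have "\<dots> \<le> \<delta>' + C r * (\<Sum>i\<in>F r. dX (p i) (q i))" using FC r p q by blast
        also have "\<dots> \<le> \<delta>' + C r * (\<Sum>i\<in>F0. dX (p i) (q i))"
          using C[OF r] F0(1) r unfolding F0_def
          by (intro add_left_mono mult_left_mono sum_mono2) auto
        finally show "\<bar>\<bar>dY r u - h r p\<bar> - \<bar>dY r u - h r q\<bar>\<bar> \<le> \<delta>' + C r * (\<Sum>i\<in>F0. dX (p i) (q i))" .
      qed
      also have "\<dots> = real (card N) * \<delta>' + C0 * (\<Sum>i\<in>F0. dX (p i) (q i))"
        by (simp add: sum.distrib C0_def sum_distrib_right)
      also have "real (card N) * \<delta>' \<le> \<delta>" unfolding \<delta>'_def using d by (simp add: field_simps)
      finally show ?thesis by simp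
    qed
    then show "\<exists>F C. finite F \<and> F \<subseteq> carrier G \<and> 0 \<le> C \<and> (\<forall>p\<in>carrier G \<rightarrow>\<^sub>E space X. \<forall>q\<in>carrier G \<rightarrow>\<^sub>E space X.
        \<forall>u\<in>space Y. \<bar>D p u - D q u\<bar> \<le> \<delta> + C * (\<Sum>i\<in>F. dX (p i) (q i)))"
      using F0 C0 by (intro exI[of _ F0] exI[of _ C0] conjI ballI) simp_all
  qed
  have "approximate_graph \<epsilon> D"
    unfolding approximate_graph_def using nonneg tri small cont unif by simp
  then show ?thesis by (rule that)
qed

section \<open>The limiting graph is a map on models\<close>

text \<open>
  The letter read off from the name of \<open>v\<close> sits at \<open>\<sigma> \<one> v\<close>, which may differ from \<open>v\<close>.
\<close>

lemma graph_values_small: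
  assumes D: "approximate_graph \<epsilon> D" and xy: "XY_models F n x y"
  shows "\<forall>\<^sub>F i in F. vertex_avg (V (n i)) (\<lambda>v. D (pb (n i) v (x i)) (y i (\<sigma> (n i) \<one> v))) < \<epsilon>"
proof -
  have "((\<lambda>i. vertex_avg (V (n i)) (\<lambda>v. D (pb (n i) v (x i)) (pb (n i) v (y i) \<one>)))
      \<longlongrightarrow> (\<integral>\<omega>. D (a \<omega>) (b \<omega> \<one>) \<partial>P)) F"
    using xy[unfolded joint_models_def, rule_format,
        OF continuous_map_eval[OF approximate_graphD(4)[OF D] one_closed]] .
  from order_tendstoD(2)[OF this approximate_graphD(3)[OF D]] show ?thesis
    by (simp add: pullback_name_def)
qed

text \<open>
  For most vertices, the letters of \<open>y\<close> and \<open>y'\<close> nearly satisfy the same prediction, because the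
  prediction depends continuously on the names, and \<open>x\<close>, \<open>x'\<close> have nearly the same names.
\<close>

lemma average_dist_vanishes:
  assumes xy: "XY_models F n x y" and xy': "XY_models F n x' y'"
    and x: "\<And>i. x i \<in> V (n i) \<rightarrow>\<^sub>E space X" "\<And>i. x' i \<in> V (n i) \<rightarrow>\<^sub>E space X"
    and y: "\<And>i. y i \<in> V (n i) \<rightarrow>\<^sub>E space Y" "\<And>i. y' i \<in> V (n i) \<rightarrow>\<^sub>E space Y"
    and lim: "((\<lambda>i. average_dist (V (n i)) dX (x i) (x' i)) \<longlongrightarrow> 0) F"
  shows "((\<lambda>i. average_dist (V (n i)) dY (y i) (y' i)) \<longlongrightarrow> 0) F"
proof (rule tendsto_zero_if_eventually_le)
  show "0 \<le> average_dist (V (n i)) dY (y i) (y' i)" for i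
    unfolding average_dist_eq by (rule vertex_avg_nonneg) simp
  fix \<epsilon> :: real assume e: "\<epsilon> > 0"
  define e where "e = \<epsilon> / 4"
  have e': "e > 0" using e by (simp add: e_def)
  obtain D where D: "approximate_graph e D" using approximate_graph_exists[OF e'] .
  let ?q = "\<lambda>i v. y' i (\<sigma> (n i) \<one> v)"
  have "((\<lambda>i. vertex_avg (V (n i)) (\<lambda>v. \<bar>D (pb (n i) v (x i)) (?q i v) - D (pb (n i) v (x' i)) (?q i v)\<bar>)) \<longlongrightarrow> 0) F"
  proof (rule locally_uniform_avg[OF approximate_graphD(5)[OF D]])
    fix g assume g: "g \<in> carrier G"
    have "vertex_avg (V (n i)) (\<lambda>v. dX (pb (n i) v (x i) g) (pb (n i) v (x' i) g))
        = average_dist (V (n i)) dX (x i) (x' i)" for i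
      using vertex_avg_bij[OF bij_V[OF g], of "n i" "\<lambda>v. dX (x i v) (x' i v)"] g
      by (simp add: pullback_name_def average_dist_eq)
    then show "((\<lambda>i. vertex_avg (V (n i)) (\<lambda>v. dX (pb (n i) v (x i) g) (pb (n i) v (x' i) g))) \<longlongrightarrow> 0) F"
      using lim by simp
  next
    fix i v assume v: "v \<in> V (n i)"
    show "y' i (\<sigma> (n i) \<one> v) \<in> space Y" using y(2)[of i] in_V[OF one_closed v] by auto
  qed (rule pullback_in x | assumption)+
  then have "\<forall>\<^sub>F i in F. vertex_avg (V (n i))
      (\<lambda>v. \<bar>D (pb (n i) v (x i)) (?q i v) - D (pb (n i) v (x' i)) (?q i v)\<bar>) < e"
    using e' by (rule order_tendstoD(2))
  with graph_values_small[OF D xy] graph_values_small[OF D xy']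
  show "\<forall>\<^sub>F i in F. average_dist (V (n i)) dY (y i) (y' i) \<le> \<epsilon>"
  proof eventually_elim
    case (elim i)
    (* The distance at \<sigma> 1 v averages to the same as the distance at v, as \<sigma> 1 permutes the vertices. *)
    have "average_dist (V (n i)) dY (y i) (y' i)
        = vertex_avg (V (n i)) (\<lambda>v. dY (y i (\<sigma> (n i) \<one> v)) (?q i v))"
      using vertex_avg_bij[OF bij_V[OF one_closed], of "n i" "\<lambda>v. dY (y i v) (y' i v)"]
      by (simp add: average_dist_eq)
    also have "\<dots> \<le> vertex_avg (V (n i)) (\<lambda>v. (e + D (pb (n i) v (x i)) (y i (\<sigma> (n i) \<one> v)))
        + (D (pb (n i) v (x' i)) (?q i v)
        + \<bar>D (pb (n i) v (x i)) (?q i v) - D (pb (n i) v (x' i)) (?q i v)\<bar>))"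
    proof (rule vertex_avg_mono)
      fix v assume v: "v \<in> V (n i)"
      have "y i (\<sigma> (n i) \<one> v) \<in> space Y" "?q i v \<in> space Y"
        using y[of i] in_V[OF one_closed v] by auto
      from approximate_graphD(2)[OF D pullback_in[OF x(1) v] this]
      show "dY (y i (\<sigma> (n i) \<one> v)) (?q i v) \<le> (e + D (pb (n i) v (x i)) (y i (\<sigma> (n i) \<one> v)))
        + (D (pb (n i) v (x' i)) (?q i v)
        + \<bar>D (pb (n i) v (x i)) (?q i v) - D (pb (n i) v (x' i)) (?q i v)\<bar>)" by linarith
    qed
    also have "\<dots> \<le> (e + e) + (e + e)"
      unfolding vertex_avg_add
      using elim vertex_avg_const_le[of e "V (n i)"] e' by (intro add_mono) auto
    also have "\<dots> = \<epsilon>" by (simp add: e_def)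
    finally show ?case .
  qed
qed

lemma modulus_in_second_argument:
  assumes f: "continuous_map (prod_topology XG YG) euclideanreal (\<lambda>(p, q). f p q)" and e: "\<epsilon> > 0"
  obtains S C where "finite S" "S \<subseteq> carrier G" "0 \<le> C"
    "\<And>p q q'. p \<in> carrier G \<rightarrow>\<^sub>E space X \<Longrightarrow> q \<in> carrier G \<rightarrow>\<^sub>E space Y \<Longrightarrow> q' \<in> carrier G \<rightarrow>\<^sub>E space Y \<Longrightarrow>
      \<bar>f p q - f p q'\<bar> \<le> \<epsilon> + C * (\<Sum>g\<in>S. dY (q g) (q' g))"
proof -
  interpret Z: compact_alphabet "X \<Otimes>\<^sub>M Y" "prod_dist dX dY" by (rule prod_alphabet)
  have top: "Z.mtopology = prod_topology X.mtopology Y.mtopology"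
    by (rule prod_alphabet_topology[OF X.compact_alphabet_axioms Y.compact_alphabet_axioms])
  define K where "K z = f (fst_part z) (snd_part z)" for z
  have K_cont: "continuous_map (product_topology (\<lambda>_. Z.mtopology) (carrier G)) euclideanreal K"
    unfolding top K_def by (rule continuous_map_on_joint[OF f])
  show thesis
  proof (rule Z.product_modulus[OF Z.compact K_cont e])
    fix S C
    assume S: "finite S" "S \<subseteq> carrier G" "0 \<le> C"
      and mod: "\<And>z z'. z \<in> carrier G \<rightarrow>\<^sub>E space (X \<Otimes>\<^sub>M Y) \<Longrightarrow> z' \<in> carrier G \<rightarrow>\<^sub>E space (X \<Otimes>\<^sub>M Y) \<Longrightarrow>
        \<bar>K z - K z'\<bar> \<le> \<epsilon> + C * (\<Sum>i\<in>S. prod_dist dX dY (z i) (z' i))"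
    show thesis
    proof (rule that[OF S])
      fix p q q'
      assume p: "p \<in> carrier G \<rightarrow>\<^sub>E space X" and q: "q \<in> carrier G \<rightarrow>\<^sub>E space Y"
        and q': "q' \<in> carrier G \<rightarrow>\<^sub>E space Y"
      have pair_mem: "pair_up p r \<in> carrier G \<rightarrow>\<^sub>E space (X \<Otimes>\<^sub>M Y)" if "r \<in> carrier G \<rightarrow>\<^sub>E space Y" for r
        using p that unfolding pair_up_def by (auto simp: space_pair_measure)
      have "\<bar>f p q - f p q'\<bar> \<le> \<epsilon> + C * (\<Sum>i\<in>S. prod_dist dX dY (pair_up p q i) (pair_up p q' i))"
        using mod[OF pair_mem[OF q] pair_mem[OF q']]
        unfolding K_def fst_pair_up[OF p] snd_pair_up[OF q] snd_pair_up[OF q'] .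
      also have "(\<Sum>i\<in>S. prod_dist dX dY (pair_up p q i) (pair_up p q' i)) = (\<Sum>g\<in>S. dY (q g) (q' g))"
      proof (rule sum.cong[OF refl])
        fix g assume "g \<in> S"
        then have g: "g \<in> carrier G" using S(2) by (rule subsetD[rotated])
        then have "p g \<in> space X" using p by (rule PiE_mem[rotated])
        then show "prod_dist dX dY (pair_up p q g) (pair_up p q' g) = dY (q g) (q' g)"
          using g by (simp add: pair_up_def prod_dist_def)
      qed
      finally show "\<bar>f p q - f p q'\<bar> \<le> \<epsilon> + C * (\<Sum>g\<in>S. dY (q g) (q' g))" .
    qed
  qed
qed

text \<open>
  Given a test function \<open>f\<close>, the penalised infimum \<open>H p = (INF q. f p q + E p q)\<close>, where \<open>E\<close> sums the
  values of \<open>D\<close> over the finitely many coordinates that matter for \<open>f\<close>, is a continuous function of \<open>p\<close>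
  alone, and \<open>H p\<close> approximates \<open>f p q\<close> up to \<open>E p q\<close> and a small constant.  The averages of \<open>H\<close> converge because \<open>x\<close> is a
  model, and \<open>E\<close> is small on average both under the joining and along the given pairs.
\<close>

lemma joint_models_if_near_graph:
  assumes x: "\<And>i. x i \<in> V (n i) \<rightarrow>\<^sub>E space X" and y: "\<And>i. y i \<in> V (n i) \<rightarrow>\<^sub>E space Y"
    and n: "filterlim n at_top F" and xm: "X_models F n x"
    and near: "\<And>\<tau>. \<tau> > 0 \<Longrightarrow> \<exists>\<epsilon> D. \<epsilon> \<le> \<tau> \<and> approximate_graph \<epsilon> D \<and>
      (\<forall>\<^sub>F i in F. vertex_avg (V (n i)) (\<lambda>v. D (pb (n i) v (x i)) (y i v)) \<le> \<tau>)"
  shows "XY_models F n x y"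
  unfolding joint_models_def
proof (intro allI impI)
  fix f assume f: "continuous_map (prod_topology XG YG) euclideanreal (\<lambda>(p, q). f p q)"
  let ?avg_f = "\<lambda>i. vertex_avg (V (n i)) (\<lambda>v. f (pb (n i) v (x i)) (pb (n i) v (y i)))"
  let ?int_f = "\<integral>\<omega>. f (a \<omega>) (b \<omega>) \<partial>P"
  show "(?avg_f \<longlongrightarrow> ?int_f) F"
  proof (rule tendstoI)
    fix \<eta> :: real assume eta: "\<eta> > 0"
    define e where "e = \<eta> / 10"
    have e: "e > 0" using eta by (simp add: e_def)
    obtain S C where S: "finite S" "S \<subseteq> carrier G" "0 \<le> C"
      and modf: "\<And>p q q'. p \<in> carrier G \<rightarrow>\<^sub>E space X \<Longrightarrow> q \<in> carrier G \<rightarrow>\<^sub>E space Y \<Longrightarrow>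
        q' \<in> carrier G \<rightarrow>\<^sub>E space Y \<Longrightarrow> \<bar>f p q - f p q'\<bar> \<le> e + C * (\<Sum>g\<in>S. dY (q g) (q' g))"
      using modulus_in_second_argument[OF f e] by blast
    define c where "c = C * real (card S)"
    have c: "0 \<le> c" unfolding c_def using S(3) by simp
    (* Small enough for the |S| terms of E, each multiplied by C. *)
    define \<tau> where "\<tau> = e / (c + 1)"
    have tau: "\<tau> > 0" unfolding \<tau>_def using e c by simp
    have ctau: "c * \<tau> \<le> e"
    proof -
      have "c * \<tau> \<le> (c + 1) * \<tau>" using tau by (intro mult_right_mono) auto
      also have "\<dots> = e" unfolding \<tau>_def using c by simp
      finally show ?thesis .
    qed
    obtain \<epsilon> D where eps: "\<epsilon> \<le> \<tau>" and D: "approximate_graph \<epsilon> D"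
      and small: "\<forall>\<^sub>F i in F. vertex_avg (V (n i)) (\<lambda>v. D (pb (n i) v (x i)) (y i v)) \<le> \<tau>"
      using near[OF tau] by blast
    note D_nonneg = approximate_graphD(1)[OF D] and D_cont = approximate_graphD(4)[OF D]
    have ceps: "c * \<epsilon> \<le> e"
      using mult_left_mono[OF eps c] ctau by linarith
    define E where "E p q = C * (\<Sum>g\<in>S. D (shift G g p) (q g))" for p and q :: "'g \<Rightarrow> 'y"
    have E_nonneg: "0 \<le> E p q" for p q
      unfolding E_def using S(3) D_nonneg by (intro mult_nonneg_nonneg sum_nonneg)
    have E_term: "continuous_map (prod_topology XG YG) euclideanreal (\<lambda>(p, q). D (shift G g p) (q g))"
      if "g \<in> S" for g
      using continuous_map_shift_eval[OF D_cont] S(2) that by blast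
    have E_cont: "continuous_map (prod_topology XG YG) euclideanreal (\<lambda>(p, q). E p q)"
      unfolding E_def case_prod_unfold
      using E_term S(1) by (intro continuous_map_real_mult_left continuous_map_sum)
        (auto simp: case_prod_unfold)
    have fE: "\<bar>f p q - f p q'\<bar> \<le> 2 * e + E p q + E p q'"
      if p: "p \<in> carrier G \<rightarrow>\<^sub>E space X" and q: "q \<in> carrier G \<rightarrow>\<^sub>E space Y" and q': "q' \<in> carrier G \<rightarrow>\<^sub>E space Y"
      for p q q'
    proof -
      have "(\<Sum>g\<in>S. dY (q g) (q' g)) \<le> (\<Sum>g\<in>S. \<epsilon> + D (shift G g p) (q g) + D (shift G g p) (q' g))"
      proof (rule sum_mono)
        fix g assume "g \<in> S"
        then have g: "g \<in> carrier G" using S(2) by blast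
        show "dY (q g) (q' g) \<le> \<epsilon> + D (shift G g p) (q g) + D (shift G g p) (q' g)"
          by (rule approximate_graphD(2)[OF D shift_in[OF p g]]) (use q q' g in auto)
      qed
      then have "C * (\<Sum>g\<in>S. dY (q g) (q' g))
          \<le> C * (\<Sum>g\<in>S. \<epsilon> + D (shift G g p) (q g) + D (shift G g p) (q' g))"
        using S(3) by (rule mult_left_mono)
      also have "\<dots> = c * \<epsilon> + E p q + E p q'"
        by (simp add: E_def c_def sum.distrib distrib_left)
      finally show ?thesis using modf[OF p q q'] ceps by linarith
    qed
    define H where "H p = (INF q\<in>topspace YG. f p q + E p q)" for p
    have YG_nonempty: "topspace YG \<noteq> {}"
      using space_Y_nonempty by (simp add: PiE_eq_empty_iff)
    have H_cont: "continuous_map XG euclideanreal H"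
      unfolding H_def
    proof (rule continuous_map_INF_compact[OF _ Y.compact_process YG_nonempty])
      show "continuous_map (prod_topology XG YG) euclideanreal (\<lambda>(p, q). f p q + E p q)"
        using continuous_map_add[OF f E_cont] by (simp add: case_prod_unfold)
    qed
    have Hf: "\<bar>f p q - H p\<bar> \<le> E p q + 2 * e"
      if p: "p \<in> carrier G \<rightarrow>\<^sub>E space X" and q: "q \<in> carrier G \<rightarrow>\<^sub>E space Y" for p q
    proof -
      have lower: "f p q - E p q - 2 * e \<le> f p q' + E p q'" if "q' \<in> topspace YG" for q'
      proof -
        have "q' \<in> carrier G \<rightarrow>\<^sub>E space Y" using that by simp
        from fE[OF p q this] show ?thesis by linarith
      qed
      have "f p q - E p q - 2 * e \<le> H p"
        unfolding H_def by (rule cINF_greatest[OF YG_nonempty lower])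
      moreover have "H p \<le> f p q + E p q"
        unfolding H_def
        by (rule cINF_lower[OF bdd_belowI2[OF lower]]) (use q in simp_all)
      ultimately show ?thesis using e by linarith
    qed
    have intE: "(\<integral>\<omega>. E (a \<omega>) (b \<omega>) \<partial>P) \<le> e"
    proof -
      have "(\<integral>\<omega>. E (a \<omega>) (b \<omega>) \<partial>P) = C * (\<Sum>g\<in>S. \<integral>\<omega>. D (shift G g (a \<omega>)) (b \<omega> g) \<partial>P)"
        unfolding E_def using integrable_joint[OF E_term]
        by (subst integral_mult_right_zero, subst Bochner_Integration.integral_sum) simp_all
      also have "(\<Sum>g\<in>S. \<integral>\<omega>. D (shift G g (a \<omega>)) (b \<omega> g) \<partial>P) = (\<Sum>g\<in>S. \<integral>\<omega>. D (a \<omega>) (b \<omega> \<one>) \<partial>P)"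
        using S(2) integral_stationary[OF D_cont] by (intro sum.cong) auto
      also have "C * \<dots> = c * (\<integral>\<omega>. D (a \<omega>) (b \<omega> \<one>) \<partial>P)" by (simp add: c_def)
      also have "\<dots> \<le> c * \<epsilon>" using c approximate_graphD(3)[OF D] by (intro mult_left_mono) auto
      finally show ?thesis using ceps by linarith
    qed
    have int_fH: "\<bar>?int_f - (\<integral>\<omega>. H (a \<omega>) \<partial>P)\<bar> \<le> 3 * e"
    proof -
      have If: "integrable P (\<lambda>\<omega>. f (a \<omega>) (b \<omega>))" by (rule integrable_joint[OF f])
      have IE: "integrable P (\<lambda>\<omega>. E (a \<omega>) (b \<omega>))" by (rule integrable_joint[OF E_cont])
      have IH: "integrable P (\<lambda>\<omega>. H (a \<omega>))"
        by (rule X.integrable_continuous_process[OF countable_carrier P.finite_measure_axioms a_meas H_cont])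
      have "\<bar>?int_f - (\<integral>\<omega>. H (a \<omega>) \<partial>P)\<bar> = \<bar>\<integral>\<omega>. f (a \<omega>) (b \<omega>) - H (a \<omega>) \<partial>P\<bar>"
        using If IH by simp
      also have "\<dots> \<le> (\<integral>\<omega>. \<bar>f (a \<omega>) (b \<omega>) - H (a \<omega>)\<bar> \<partial>P)" by (rule integral_abs_bound)
      also have "\<dots> \<le> (\<integral>\<omega>. E (a \<omega>) (b \<omega>) + 2 * e \<partial>P)"
        using If IH IE Hf[OF a_space b_space] by (intro integral_mono) auto
      also have "\<dots> = (\<integral>\<omega>. E (a \<omega>) (b \<omega>) \<partial>P) + 2 * e" using IE by (simp add: P.prob_space)
      finally show ?thesis using intE by linarith
    qed
    have "((\<lambda>i. vertex_avg (V (n i)) (\<lambda>v. H (pb (n i) v (x i)))) \<longlongrightarrow> (\<integral>\<omega>. H (a \<omega>) \<partial>P)) F"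
      using xm[unfolded models_def, rule_format, OF H_cont] .
    then have ev_H: "\<forall>\<^sub>F i in F. dist (vertex_avg (V (n i)) (\<lambda>v. H (pb (n i) v (x i)))) (\<integral>\<omega>. H (a \<omega>) \<partial>P) < e"
      using e by (rule tendstoD)
    let ?A = "\<lambda>i g. vertex_avg (V (n i)) (\<lambda>v. \<bar>D (shift G g (pb (n i) v (x i))) (y i (\<sigma> (n i) g v))
        - D (pb (n i) (\<sigma> (n i) g v) (x i)) (y i (\<sigma> (n i) g v))\<bar>)"
    have "((\<lambda>i. C * (\<Sum>g\<in>S. ?A i g)) \<longlongrightarrow> C * (\<Sum>g\<in>S. 0)) F"
    proof (intro tendsto_mult tendsto_const tendsto_sum)
      fix g assume "g \<in> S"
      then have g: "g \<in> carrier G" using S(2) by blast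
      show "((\<lambda>i. ?A i g) \<longlongrightarrow> 0) F"
      proof (rule pullback_shift[OF X.compact_alphabet_axioms approximate_graphD(5)[OF D] x _ n g])
        show "y i (\<sigma> (n i) g v) \<in> space Y" if "v \<in> V (n i)" for i v
          using y[of i] in_V[OF g that] by auto
      qed
    qed
    then have ev_A: "\<forall>\<^sub>F i in F. C * (\<Sum>g\<in>S. ?A i g) < e"
      using e by (intro order_tendstoD(2)) auto
    show "\<forall>\<^sub>F i in F. dist (?avg_f i) ?int_f < \<eta>"
      using ev_H ev_A small
    proof eventually_elim
      case (elim i)
      have avgE: "vertex_avg (V (n i)) (\<lambda>v. E (pb (n i) v (x i)) (pb (n i) v (y i))) \<le> 2 * e"
      proof -
        have "vertex_avg (V (n i)) (\<lambda>v. E (pb (n i) v (x i)) (pb (n i) v (y i)))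
            = C * (\<Sum>g\<in>S. vertex_avg (V (n i)) (\<lambda>v. D (shift G g (pb (n i) v (x i))) (pb (n i) v (y i) g)))"
          unfolding E_def vertex_avg_cmult vertex_avg_sum ..
        also have "\<dots> \<le> C * (\<Sum>g\<in>S. \<tau> + ?A i g)"
        proof (intro mult_left_mono sum_mono S(3))
          fix g assume "g \<in> S"
          then have g: "g \<in> carrier G" using S(2) by blast
          (* Replace the shifted name of v by the name of \<sigma> g v, then use that \<sigma> g permutes the vertices. *)
          have "vertex_avg (V (n i)) (\<lambda>v. D (shift G g (pb (n i) v (x i))) (pb (n i) v (y i) g))
              \<le> vertex_avg (V (n i)) (\<lambda>v. D (pb (n i) (\<sigma> (n i) g v) (x i)) (y i (\<sigma> (n i) g v))
                + \<bar>D (shift G g (pb (n i) v (x i))) (y i (\<sigma> (n i) g v))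
                  - D (pb (n i) (\<sigma> (n i) g v) (x i)) (y i (\<sigma> (n i) g v))\<bar>)"
            using g by (intro vertex_avg_mono) (simp add: pullback_name_def)
          also have "\<dots> = vertex_avg (V (n i)) (\<lambda>v. D (pb (n i) v (x i)) (y i v)) + ?A i g"
            unfolding vertex_avg_add
            using vertex_avg_bij[OF bij_V[OF g], of "n i" "\<lambda>v. D (pb (n i) v (x i)) (y i v)"] by simp
          finally show "vertex_avg (V (n i)) (\<lambda>v. D (shift G g (pb (n i) v (x i))) (pb (n i) v (y i) g))
              \<le> \<tau> + ?A i g"
            using elim(3) by linarith
        qed
        also have "\<dots> = c * \<tau> + C * (\<Sum>g\<in>S. ?A i g)"
          by (simp add: sum.distrib distrib_left c_def)
        finally show ?thesis using elim(2) ctau by linarith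
      qed
      have "\<bar>?avg_f i - vertex_avg (V (n i)) (\<lambda>v. H (pb (n i) v (x i)))\<bar>
          \<le> vertex_avg (V (n i)) (\<lambda>v. \<bar>f (pb (n i) v (x i)) (pb (n i) v (y i)) - H (pb (n i) v (x i))\<bar>)"
        by (rule vertex_avg_abs_diff)
      also have "\<dots> \<le> vertex_avg (V (n i)) (\<lambda>v. E (pb (n i) v (x i)) (pb (n i) v (y i)) + 2 * e)"
        by (intro vertex_avg_mono Hf pullback_in x y)
      also have "\<dots> \<le> 2 * e + 2 * e"
        unfolding vertex_avg_add using avgE vertex_avg_const_le[of "2 * e" "V (n i)"] e
        by (intro add_mono) auto
      finally have "\<bar>?avg_f i - vertex_avg (V (n i)) (\<lambda>v. H (pb (n i) v (x i)))\<bar> \<le> 4 * e" by simp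
      with int_fH elim(1) have "\<bar>?avg_f i - ?int_f\<bar> < 10 * e"
        unfolding dist_real_def using e by linarith
      then show ?case by (simp add: dist_real_def e_def)
    qed
  qed
qed

text \<open>
  At every vertex, choose a letter that almost minimises a weighted sum of approximate graphs \<open>D j\<close>.  The
  infimum is a continuous function of the name; its averages converge to a value that is at most the
  mean of the sum at the true letter.  The weights \<open>2 ^ j\<close> against means below \<open>(1/4) ^ j\<close> make each
  \<open>D j\<close> small separately.
\<close>

lemma models_lift:
  assumes x: "\<And>i. x i \<in> V (n i) \<rightarrow>\<^sub>E space X" and n: "filterlim n at_top F" and xm: "X_models F n x"
  obtains y where "\<And>i. y i \<in> V (n i) \<rightarrow>\<^sub>E space Y" "XY_models F n x y"
proof -
  have "\<exists>D. approximate_graph ((1/4) ^ j) D" for j :: nat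
  proof -
    have "(1/4 :: real) ^ j > 0" by simp
    then obtain D where "approximate_graph ((1/4) ^ j) D" by (rule approximate_graph_exists)
    then show ?thesis by (intro exI)
  qed
  then have "\<forall>j::nat. \<exists>D. approximate_graph ((1/4) ^ j) D" by (rule allI)
  from choice[OF this] obtain D where "\<forall>j::nat. approximate_graph ((1/4) ^ j) (D j)" by (elim exE)
  then have D: "approximate_graph ((1/4) ^ j) (D j)" for j by (rule spec)
  define Q where "Q k i y \<longleftrightarrow> y \<in> V (n i) \<rightarrow>\<^sub>E space Y \<and>
    (\<forall>j\<le>k. vertex_avg (V (n i)) (\<lambda>v. D j (pb (n i) v (x i)) (y v)) \<le> 4 * (1/2) ^ j)" for k i y
  have ex: "\<forall>\<^sub>F i in F. \<exists>y. Q k i y" for k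
  proof -
    define Dk where "Dk p u = (\<Sum>j\<le>k. 2 ^ j * D j p u)" for p u
    have Dk_nonneg: "0 \<le> Dk p u" for p u
      unfolding Dk_def using approximate_graphD(1)[OF D] by (intro sum_nonneg) simp
    have Dk_cont: "continuous_map (prod_topology XG Y.mtopology) euclideanreal (\<lambda>(p, u). Dk p u)"
      unfolding Dk_def case_prod_unfold
      using approximate_graphD(4)[OF D]
      by (intro continuous_map_sum continuous_map_real_mult_left) (simp_all add: case_prod_unfold)
    define m where "m p = (INF u\<in>space Y. Dk p u)" for p
    have m_cont: "continuous_map XG euclideanreal m"
      using continuous_map_INF_compact[OF Dk_cont Y.compact] space_Y_nonempty by (simp add: m_def[abs_def])
    have m_le: "m p \<le> Dk p u" if "u \<in> space Y" for p u
      unfolding m_def using Dk_nonneg that by (intro cINF_lower bdd_belowI2[of _ 0]) auto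
    have "(\<integral>\<omega>. m (a \<omega>) \<partial>P) \<le> (\<integral>\<omega>. Dk (a \<omega>) (b \<omega> \<one>) \<partial>P)"
      using X.integrable_continuous_process[OF countable_carrier P.finite_measure_axioms a_meas m_cont]
        integrable_joint[OF continuous_map_eval[OF Dk_cont one_closed]] m_le b_one
      by (intro integral_mono) auto
    also have "\<dots> = (\<Sum>j\<le>k. 2 ^ j * (\<integral>\<omega>. D j (a \<omega>) (b \<omega> \<one>) \<partial>P))"
      unfolding Dk_def using integrable_joint[OF continuous_map_eval[OF approximate_graphD(4)[OF D] one_closed]]
      by (subst Bochner_Integration.integral_sum) auto
    also have "\<dots> \<le> (\<Sum>j\<le>k. 2 ^ j * (1/4) ^ j)"
      using approximate_graphD(3)[OF D] by (intro sum_mono mult_left_mono) (auto intro: less_imp_le)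
    also have "\<dots> = (\<Sum>j\<le>k. (1/2) ^ j)"
      by (intro sum.cong) (simp_all add: power_mult_distrib[symmetric])
    also have "\<dots> = 2 - (1/2) ^ k" by (induction k) simp_all
    also have "\<dots> < 3"
      using zero_less_power[of "1/2::real" k] by linarith
    finally have "\<forall>\<^sub>F i in F. vertex_avg (V (n i)) (\<lambda>v. m (pb (n i) v (x i))) < 3"
      by (rule order_tendstoD(2)[OF xm[unfolded models_def, rule_format, OF m_cont]])
    then show ?thesis
    proof eventually_elim
      case (elim i)
      have "\<exists>u\<in>space Y. Dk p u < m p + 1" for p
      proof -
        have "\<exists>t\<in>Dk p ` space Y. t < m p + 1"
          using cInf_lessD[of "Dk p ` space Y" "m p + 1"] space_Y_nonempty by (simp add: m_def)
        then show ?thesis by blast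
      qed
      then obtain u where u: "\<And>p. u p \<in> space Y" "\<And>p. Dk p (u p) < m p + 1" by metis
      define y where "y = (\<lambda>v\<in>V (n i). u (pb (n i) v (x i)))"
      have total: "vertex_avg (V (n i)) (\<lambda>v. Dk (pb (n i) v (x i)) (y v)) \<le> 4"
      proof -
        have "vertex_avg (V (n i)) (\<lambda>v. Dk (pb (n i) v (x i)) (y v))
            \<le> vertex_avg (V (n i)) (\<lambda>v. m (pb (n i) v (x i)) + 1)"
          using u(2) by (intro vertex_avg_mono) (simp add: y_def less_imp_le)
        also have "\<dots> \<le> 3 + 1"
          unfolding vertex_avg_add using elim vertex_avg_const_le[of 1 "V (n i)"] by (intro add_mono) auto
        finally show ?thesis by simp
      qed
      have "vertex_avg (V (n i)) (\<lambda>v. D j (pb (n i) v (x i)) (y v)) \<le> 4 * (1/2) ^ j" if j: "j \<le> k" for j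
      proof -
        have "2 ^ j * vertex_avg (V (n i)) (\<lambda>v. D j (pb (n i) v (x i)) (y v))
            \<le> vertex_avg (V (n i)) (\<lambda>v. Dk (pb (n i) v (x i)) (y v))"
          unfolding vertex_avg_cmult[symmetric] Dk_def
          using j approximate_graphD(1)[OF D] by (intro vertex_avg_mono member_le_sum) auto
        then show ?thesis using total by (simp add: power_divide field_simps)
      qed
      then have "Q k i y" unfolding Q_def using u(1) by (simp add: y_def)
      then show ?case by blast
    qed
  qed
  have anti: "Q k i y" if "k \<le> k'" "Q k' i y" for k k' i y using that unfolding Q_def by simp
  have QR: "y \<in> V (n i) \<rightarrow>\<^sub>E space Y" if "Q k i y" for k i y using that unfolding Q_def by simp
  obtain u where "u \<in> space Y" using space_Y_nonempty by blast
  then have default: "\<exists>y. y \<in> V (n i) \<rightarrow>\<^sub>E space Y" for i by (intro exI[of _ "\<lambda>v\<in>V (n i). u"]) simp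
  show thesis
  proof (rule eventually_diagonal_choice[where Q=Q and R="\<lambda>i y. y \<in> V (n i) \<rightarrow>\<^sub>E space Y",
        OF n ex anti default QR])
    fix y assume y: "\<And>i. y i \<in> V (n i) \<rightarrow>\<^sub>E space Y" "\<And>k. \<forall>\<^sub>F i in F. Q k i (y i)"
    have "XY_models F n x y"
    proof (rule joint_models_if_near_graph[OF x y(1) n xm])
      fix \<tau> :: real assume tau: "\<tau> > 0"
      then obtain j where j: "(1/2) ^ j < \<tau> / 4" using real_arch_pow_inv[of "\<tau> / 4" "1/2"] by auto
      have "(1/4 :: real) ^ j \<le> (1/2) ^ j" by (intro power_mono) auto
      then have "(1/4) ^ j \<le> \<tau>" using j tau by linarith
      moreover have "\<forall>\<^sub>F i in F. vertex_avg (V (n i)) (\<lambda>v. D j (pb (n i) v (x i)) (y i v)) \<le> \<tau>"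
        using y(2)[of j]
      proof eventually_elim
        case (elim i)
        then have "vertex_avg (V (n i)) (\<lambda>v. D j (pb (n i) v (x i)) (y i v)) \<le> 4 * (1/2) ^ j"
          unfolding Q_def by blast
        then show ?case using j by linarith
      qed
      ultimately show "\<exists>\<epsilon> D. \<epsilon> \<le> \<tau> \<and> approximate_graph \<epsilon> D \<and>
          (\<forall>\<^sub>F i in F. vertex_avg (V (n i)) (\<lambda>v. D (pb (n i) v (x i)) (y i v)) \<le> \<tau>)"
        using D by blast
    qed
    with y(1) show thesis by (rule that)
  qed
qed

section \<open>Transfer of connected model spaces\<close>

text \<open>
  Complete every point of a path between lifts of the end points, and add the given end points.
\<close>

lemma connected_transfer:
  assumes conn: "connected_model_spaces G V \<sigma> X (distr P (PiM (carrier G) (\<lambda>_. X)) a) dX"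
    and lift: "\<And>n y. strict_mono n \<Longrightarrow> (\<And>i. y i \<in> V (n i) \<rightarrow>\<^sub>E space Y) \<Longrightarrow>
      models Y.mtopology P b sequentially n y \<Longrightarrow>
      \<exists>x. (\<forall>i. x i \<in> V (n i) \<rightarrow>\<^sub>E space X) \<and> XY_models sequentially n x y"
  shows "connected_model_spaces G V \<sigma> Y (distr P (PiM (carrier G) (\<lambda>_. Y)) b) dY"
  unfolding connected_model_spaces_iff[OF Y.compact_alphabet_axioms P.prob_space_axioms b_meas]
proof (intro allI impI, elim conjE)
  fix n :: "nat \<Rightarrow> nat" and y y'
  assume n: "strict_mono n"
    and y: "\<forall>i. y i \<in> V (n i) \<rightarrow>\<^sub>E space Y" and y': "\<forall>i. y' i \<in> V (n i) \<rightarrow>\<^sub>E space Y"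
    and ym: "models Y.mtopology P b sequentially n y" and y'm: "models Y.mtopology P b sequentially n y'"
  obtain x where x: "\<And>i. x i \<in> V (n i) \<rightarrow>\<^sub>E space X" and xy: "XY_models sequentially n x y"
    using lift[OF n _ ym] y by blast
  obtain x' where x': "\<And>i. x' i \<in> V (n i) \<rightarrow>\<^sub>E space X" and xy': "XY_models sequentially n x' y'"
    using lift[OF n _ y'm] y' by blast
  have "\<exists>l p. vanishing_paths X dX P a n x x' l p"
    using conn[unfolded connected_model_spaces_iff[OF X.compact_alphabet_axioms P.prob_space_axioms a_meas],
        THEN spec, THEN spec, THEN spec, THEN mp]
      n x x' joint_models_fst[OF xy] joint_models_fst[OF xy'] by simp
  then obtain l p where "vanishing_paths X dX P a n x x' l p" by blast
  then have p_ends: "p (i, 0) = x i" "p (i, l i) = x' i"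
    and p_mem: "j \<le> l i \<Longrightarrow> p (i, j) \<in> V (n i) \<rightarrow>\<^sub>E space X"
    and p_models: "X_models (path_filter (\<lambda>i. {..l i})) (\<lambda>k. n (fst k)) p"
    and p_steps: "((\<lambda>k. average_dist (V (n (fst k))) dX (p k) (p (fst k, Suc (snd k)))) \<longlongrightarrow> 0)
       (path_filter (\<lambda>i. {..<l i}))" for i j
    unfolding vanishing_paths_def by simp_all
  let ?F = "path_filter (\<lambda>i. {..l i})" and ?F' = "path_filter (\<lambda>i. {..<l i})"
  let ?n = "\<lambda>k. n (fst k)"
  have nF: "filterlim ?n at_top ?F"
    by (rule filterlim_path_filter_fst[OF filterlim_subseq[OF n]])
  (* Extended constantly beyond the end of the path, so that r k is a configuration for every k. *)
  define r where "r k = p (fst k, min (snd k) (l (fst k)))" for k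
  have r_mem: "r k \<in> V (?n k) \<rightarrow>\<^sub>E space X" for k
    unfolding r_def by (rule p_mem) simp
  have r_models: "X_models ?F ?n r"
    by (rule models_cong[OF _ p_models]) (simp add: eventually_path_filter r_def)
  obtain q where q_mem: "\<And>k. q k \<in> V (?n k) \<rightarrow>\<^sub>E space Y" and rq: "XY_models ?F ?n r q"
    using models_lift[OF r_mem nF r_models] by blast
  have x_self: "average_dist (V i) dX u u = 0" if u: "u \<in> V i \<rightarrow>\<^sub>E space X" for i u
  proof -
    have "dX (u v) (u v) = 0" if "v \<in> V i" for v
      using PiE_mem[OF u that] by (rule X.mdist_zero)
    then show ?thesis by (simp add: average_dist_def)
  qed
  have first: "(\<lambda>i. average_dist (V (n i)) dY (y i) (q (i, 0))) \<longlonglongrightarrow> 0"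
  proof (rule average_dist_vanishes[OF xy _ x x])
    have "filterlim (\<lambda>i. (i, 0)) ?F sequentially" by (rule filterlim_into_path_filter) simp
    from joint_models_compose[OF rq this] show "XY_models sequentially n x (\<lambda>i. q (i, 0))"
      by (simp add: r_def p_ends)
    show "(\<lambda>i. average_dist (V (n i)) dX (x i) (x i)) \<longlonglongrightarrow> 0" by (simp add: x_self[OF x])
    show "y i \<in> V (n i) \<rightarrow>\<^sub>E space Y" "q (i, 0) \<in> V (n i) \<rightarrow>\<^sub>E space Y" for i
      using y q_mem[of "(i, 0)"] by simp_all
  qed
  have last: "(\<lambda>i. average_dist (V (n i)) dY (q (i, l i)) (y' i)) \<longlonglongrightarrow> 0"
  proof (rule average_dist_vanishes[OF _ xy' x' x'])
    have "filterlim (\<lambda>i. (i, l i)) ?F sequentially" by (rule filterlim_into_path_filter) simp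
    from joint_models_compose[OF rq this] show "XY_models sequentially n x' (\<lambda>i. q (i, l i))"
      by (simp add: r_def p_ends)
    show "(\<lambda>i. average_dist (V (n i)) dX (x' i) (x' i)) \<longlonglongrightarrow> 0" by (simp add: x_self[OF x'])
    show "q (i, l i) \<in> V (n i) \<rightarrow>\<^sub>E space Y" "y' i \<in> V (n i) \<rightarrow>\<^sub>E space Y" for i
      using y' q_mem[of "(i, l i)"] by simp_all
  qed
  have steps: "((\<lambda>k. average_dist (V (?n k)) dY (q k) (q (fst k, Suc (snd k)))) \<longlongrightarrow> 0) ?F'"
  proof (rule average_dist_vanishes)
    have "filterlim (\<lambda>k. (fst k, snd k)) ?F ?F'"
      by (rule filterlim_path_filter[where g="\<lambda>i j. j"]) simp
    from joint_models_compose[OF rq this] show "XY_models ?F' ?n r q" by simp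
    have "filterlim (\<lambda>k. (fst k, Suc (snd k))) ?F ?F'"
      by (rule filterlim_path_filter[where g="\<lambda>i j. Suc j"]) simp
    from joint_models_compose[OF rq this]
    show "XY_models ?F' ?n (\<lambda>k. r (fst k, Suc (snd k))) (\<lambda>k. q (fst k, Suc (snd k)))" by simp
    have "\<forall>\<^sub>F k in ?F'. average_dist (V (?n k)) dX (p k) (p (fst k, Suc (snd k)))
        = average_dist (V (?n k)) dX (r k) (r (fst k, Suc (snd k)))"
      by (simp add: eventually_path_filter r_def)
    with p_steps show "((\<lambda>k. average_dist (V (?n k)) dX (r k) (r (fst k, Suc (snd k)))) \<longlongrightarrow> 0) ?F'"
      by (rule Lim_transform_eventually)
    show "r k \<in> V (?n k) \<rightarrow>\<^sub>E space X" "r (fst k, Suc (snd k)) \<in> V (?n k) \<rightarrow>\<^sub>E space X"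
      "q k \<in> V (?n k) \<rightarrow>\<^sub>E space Y" "q (fst k, Suc (snd k)) \<in> V (?n k) \<rightarrow>\<^sub>E space Y" for k
      using r_mem[of k] r_mem[of "(fst k, Suc (snd k))"] q_mem[of k] q_mem[of "(fst k, Suc (snd k))"]
      by simp_all
  qed
  define w where "w k = (if snd k = 0 then y (fst k)
    else if snd k \<le> Suc (l (fst k)) then q (fst k, snd k - 1) else y' (fst k))" for k
  have "vanishing_paths Y dY P b n y y' (\<lambda>i. l i + 2) w"
    unfolding vanishing_paths_def
  proof (intro conjI allI impI)
    fix i j
    show "w (i, 0) = y i" "w (i, l i + 2) = y' i" by (simp_all add: w_def)
    show "w (i, j) \<in> V (n i) \<rightarrow>\<^sub>E space Y"
      using y y' q_mem[of "(i, j - 1)"] by (simp add: w_def)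
  next
    show "models Y.mtopology P b (path_filter (\<lambda>i. {..l i + 2})) ?n w"
      unfolding models_def
    proof (intro allI impI)
      fix K assume K: "continuous_map YG euclideanreal K"
      let ?a = "\<lambda>i z. vertex_avg (V i) (\<lambda>v. K (pb i v z))"
      show "((\<lambda>k. ?a (?n k) (w k)) \<longlongrightarrow> (\<integral>\<omega>. K (b \<omega>) \<partial>P)) (path_filter (\<lambda>i. {..l i + 2}))"
      proof (rule tendsto_path_filter_assemble)
        show "((\<lambda>k. ?a (?n k) (q k)) \<longlongrightarrow> (\<integral>\<omega>. K (b \<omega>) \<partial>P)) ?F"
          using joint_models_fst[OF joint_models_swap[OF rq]] K unfolding models_def by blast
        show "(\<lambda>i. ?a (n i) (y i)) \<longlonglongrightarrow> (\<integral>\<omega>. K (b \<omega>) \<partial>P)"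
          using ym K unfolding models_def by blast
        show "(\<lambda>i. ?a (n i) (y' i)) \<longlonglongrightarrow> (\<integral>\<omega>. K (b \<omega>) \<partial>P)"
          using y'm K unfolding models_def by blast
        fix i j
        show "?a (?n (i, j)) (w (i, j)) = ?a (n i) (y i) \<or> ?a (?n (i, j)) (w (i, j)) = ?a (n i) (y' i) \<or>
            (\<exists>j'\<in>{..l i}. ?a (?n (i, j)) (w (i, j)) = ?a (?n (i, j')) (q (i, j')))"
        proof (cases "j = 0 \<or> j > Suc (l i)")
          case False
          then have "j - 1 \<in> {..l i}" "w (i, j) = q (i, j - 1)" by (auto simp: w_def)
          then show ?thesis by auto
        qed (auto simp: w_def)
      qed
    qed
    show "((\<lambda>k. average_dist (V (?n k)) dY (w k) (w (fst k, Suc (snd k)))) \<longlongrightarrow> 0)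
        (path_filter (\<lambda>i. {..<l i + 2}))"
    proof (rule tendsto_path_filter_assemble[OF first last steps])
      fix i j assume j: "j \<in> {..<l i + 2}"
      show "average_dist (V (?n (i, j))) dY (w (i, j)) (w (fst (i, j), Suc (snd (i, j))))
            = average_dist (V (n i)) dY (y i) (q (i, 0)) \<or>
          average_dist (V (?n (i, j))) dY (w (i, j)) (w (fst (i, j), Suc (snd (i, j))))
            = average_dist (V (n i)) dY (q (i, l i)) (y' i) \<or>
          (\<exists>j'\<in>{..<l i}. average_dist (V (?n (i, j))) dY (w (i, j)) (w (fst (i, j), Suc (snd (i, j))))
            = average_dist (V (?n (i, j'))) dY (q (i, j')) (q (fst (i, j'), Suc (snd (i, j')))))"
      proof (cases "j = 0 \<or> j = Suc (l i)")
        case False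
        then have "j - 1 \<in> {..<l i}" "w (i, j) = q (i, j - 1)" "w (i, Suc j) = q (i, Suc (j - 1))"
          using j by (auto simp: w_def)
        then show ?thesis by fastforce
      qed (auto simp: w_def)
    qed
  qed
  then show "\<exists>l p. vanishing_paths Y dY P b n y y' l p" by blast
qed

end

context sofic_group
begin

text \<open>
  Lifts of models of the second process are completions for the joining with exchanged roles.
\<close>

lemma connected_if_mutually_determined:
  assumes A: "joining G V \<sigma> X dX Y dY P a b" and B: "joining G V \<sigma> Y dY X dX P b a"
    and conn: "connected_model_spaces G V \<sigma> X (distr P (PiM (carrier G) (\<lambda>_. X)) a) dX"
  shows "connected_model_spaces G V \<sigma> Y (distr P (PiM (carrier G) (\<lambda>_. Y)) b) dY"
proof (rule joining.connected_transfer[OF A conn])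
  fix n :: "nat \<Rightarrow> nat" and y
  assume n: "strict_mono n" and y: "\<And>i. y i \<in> V (n i) \<rightarrow>\<^sub>E space Y"
    and ym: "models (metric_topology Y dY) P b sequentially n y"
  obtain x where "\<And>i. x i \<in> V (n i) \<rightarrow>\<^sub>E space X"
      "joint_models (metric_topology Y dY) (metric_topology X dX) P b a sequentially n y x"
    using joining.models_lift[OF B y filterlim_subseq[OF n] ym] by blast
  then show "\<exists>x. (\<forall>i. x i \<in> V (n i) \<rightarrow>\<^sub>E space X) \<and>
      joint_models (metric_topology X dX) (metric_topology Y dY) P a b sequentially n x y"
    using joint_models_swap by blast
qed

lemma shift_measurable:
  assumes "g \<in> carrier G"
  shows "shift G g \<in> PiM (carrier G) (\<lambda>_. X) \<rightarrow>\<^sub>M PiM (carrier G) (\<lambda>_. X)"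
  unfolding shift_def using assms by (intro measurable_restrict measurable_component_singleton) simp

text \<open>
  Both joinings live on \<open>(X\<^sup>G, \<mu>)\<close>, where \<open>R\<close> is the shift; in the second one, \<open>\<Psi>\<close> recovers \<open>x\<close> from
  \<open>\<Phi> x\<close>.
\<close>

lemma factor_joinings:
  assumes X: "metric_process G X \<mu> dX" and Y: "metric_process G Y \<nu> dY"
    and \<Phi>: "factor_map G \<mu> (shift G) \<nu> (shift G) \<Phi>"
  shows "joining G V \<sigma> X dX Y dY \<mu> (\<lambda>x. x) \<Phi>"
    and "\<Psi> \<in> \<nu> \<rightarrow>\<^sub>M \<mu> \<Longrightarrow> AE x in \<mu>. \<Psi> (\<Phi> x) = x \<Longrightarrow> joining G V \<sigma> Y dY X dX \<mu> \<Phi> (\<lambda>x. x)"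
proof -
  have sets: "sets \<mu> = sets (PiM (carrier G) (\<lambda>_. X))" "sets \<nu> = sets (PiM (carrier G) (\<lambda>_. Y))"
    and P: "prob_space \<mu>" and inv: "\<And>g. g \<in> carrier G \<Longrightarrow> distr \<mu> \<mu> (shift G g) = \<mu>"
    using X Y by (simp_all add: metric_process_def)
  have id: "(\<lambda>x. x) \<in> \<mu> \<rightarrow>\<^sub>M PiM (carrier G) (\<lambda>_. X)"
    by (rule measurable_ident_sets[OF sets(1)])
  have \<Phi>_meas: "\<Phi> \<in> \<mu> \<rightarrow>\<^sub>M PiM (carrier G) (\<lambda>_. Y)" "\<Phi> \<in> PiM (carrier G) (\<lambda>_. X) \<rightarrow>\<^sub>M PiM (carrier G) (\<lambda>_. Y)"
    using \<Phi> measurable_cong_sets[OF refl sets(2), of \<mu>] measurable_cong_sets[OF sets]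
    by (simp_all add: factor_map_def)
  have stat: "\<exists>R\<in>\<mu> \<rightarrow>\<^sub>M \<mu>. distr \<mu> \<mu> R = \<mu> \<and> (AE x in \<mu>. R x = shift G g x) \<and>
      (AE x in \<mu>. \<Phi> (R x) = shift G g (\<Phi> x))" if g: "g \<in> carrier G" for g
  proof (intro bexI[of _ "shift G g"] conjI)
    show "shift G g \<in> \<mu> \<rightarrow>\<^sub>M \<mu>"
      using shift_measurable[OF g] measurable_cong_sets[OF sets(1) sets(1)] by blast
    show "AE x in \<mu>. \<Phi> (shift G g x) = shift G g (\<Phi> x)" using \<Phi> g by (simp add: factor_map_def)
  qed (simp_all add: inv g)
  note base = sofic_group_axioms compact_alphabet_metric_process[OF X] compact_alphabet_metric_process[OF Y] P
  show "joining G V \<sigma> X dX Y dY \<mu> (\<lambda>x. x) \<Phi>"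
  proof (intro joining.intro joining_axioms.intro base)
    show "\<exists>\<psi>\<in>PiM (carrier G) (\<lambda>_. X) \<rightarrow>\<^sub>M PiM (carrier G) (\<lambda>_. Y). AE x in \<mu>. \<Phi> x = \<psi> x"
      using \<Phi>_meas(2) by (intro bexI[of _ \<Phi>]) simp_all
  qed (use id \<Phi>_meas stat in auto)
  assume \<Psi>: "\<Psi> \<in> \<nu> \<rightarrow>\<^sub>M \<mu>" "AE x in \<mu>. \<Psi> (\<Phi> x) = x"
  show "joining G V \<sigma> Y dY X dX \<mu> \<Phi> (\<lambda>x. x)"
  proof (intro joining.intro joining_axioms.intro base)
    have "\<Psi> \<in> PiM (carrier G) (\<lambda>_. Y) \<rightarrow>\<^sub>M PiM (carrier G) (\<lambda>_. X)"
      using \<Psi>(1) measurable_cong_sets[OF sets(2,1)] by blast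
    then show "\<exists>\<psi>\<in>PiM (carrier G) (\<lambda>_. Y) \<rightarrow>\<^sub>M PiM (carrier G) (\<lambda>_. X). AE x in \<mu>. x = \<psi> (\<Phi> x)"
      using \<Psi>(2) by (intro bexI[of _ \<Psi>]) (auto elim: eventually_mono)
    show "\<exists>R\<in>\<mu> \<rightarrow>\<^sub>M \<mu>. distr \<mu> \<mu> R = \<mu> \<and> (AE x in \<mu>. \<Phi> (R x) = shift G g (\<Phi> x)) \<and>
        (AE x in \<mu>. R x = shift G g x)" if "g \<in> carrier G" for g
      using stat[OF that] by blast
  qed (use id \<Phi>_meas in auto)
qed

lemma factor_laws:
  assumes X: "metric_process G X \<mu> dX" and Y: "metric_process G Y \<nu> dY"
    and \<Phi>: "factor_map G \<mu> (shift G) \<nu> (shift G) \<Phi>"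
  shows "distr \<mu> (PiM (carrier G) (\<lambda>_. X)) (\<lambda>x. x) = \<mu>" "distr \<mu> (PiM (carrier G) (\<lambda>_. Y)) \<Phi> = \<nu>"
proof -
  have sets: "sets \<mu> = sets (PiM (carrier G) (\<lambda>_. X))" "sets \<nu> = sets (PiM (carrier G) (\<lambda>_. Y))"
    using X Y by (simp_all add: metric_process_def)
  show "distr \<mu> (PiM (carrier G) (\<lambda>_. X)) (\<lambda>x. x) = \<mu>" by (rule distr_id2[OF sets(1)[symmetric]])
  have "distr \<mu> (PiM (carrier G) (\<lambda>_. Y)) \<Phi> = distr \<mu> \<nu> \<Phi>"
    by (rule distr_cong) (simp_all add: sets)
  then show "distr \<mu> (PiM (carrier G) (\<lambda>_. Y)) \<Phi> = \<nu>" using \<Phi> by (simp add: factor_map_def)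
qed

theorem connected_model_spaces_factor:
  assumes X: "metric_process G X \<mu> dX" and Y: "metric_process G Y \<nu> dY"
    and \<Phi>: "factor_map G \<mu> (shift G) \<nu> (shift G) \<Phi>"
    and conn: "connected_model_spaces G V \<sigma> X \<mu> dX"
    and surj: "model_surjective G V \<sigma> X \<mu> dX Y \<nu> dY \<Phi>"
  shows "connected_model_spaces G V \<sigma> Y \<nu> dY"
proof -
  interpret joining G V \<sigma> X dX Y dY \<mu> "\<lambda>x. x" \<Phi> by (rule factor_joinings(1)[OF X Y \<Phi>])
  note laws = factor_laws[OF X Y \<Phi>]
  have "connected_model_spaces G V \<sigma> Y (distr \<mu> (PiM (carrier G) (\<lambda>_. Y)) \<Phi>) dY"
  proof (rule connected_transfer)
    show "connected_model_spaces G V \<sigma> X (distr \<mu> (PiM (carrier G) (\<lambda>_. X)) (\<lambda>x. x)) dX"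
      using conn by (simp add: laws)
    fix n :: "nat \<Rightarrow> nat" and y
    assume n: "strict_mono n" and y: "\<And>i. y i \<in> V (n i) \<rightarrow>\<^sub>E space Y"
      and ym: "models Y.mtopology \<mu> \<Phi> sequentially n y"
    have top: "Metric_space.mtopology (space (X \<Otimes>\<^sub>M Y)) (prod_dist dX dY) = prod_topology X.mtopology Y.mtopology"
      by (rule prod_alphabet_topology[OF X.compact_alphabet_axioms Y.compact_alphabet_axioms])
    have joint: "graphical_joining G X \<mu> Y \<Phi>
        = distr \<mu> (PiM (carrier G) (\<lambda>_. X \<Otimes>\<^sub>M Y)) (\<lambda>x. pair_up x (\<Phi> x))"
      by (simp add: graphical_joining_def pair_up_def)
    have "limitin (weak_star_topology (process_topology G Y dY))
        (\<lambda>i. empirical G Y (V (n i)) (\<sigma> (n i)) (y i)) \<nu> sequentially"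
      using limitin_empirical[OF Y.compact_alphabet_axioms P.prob_space_axioms b_meas _ filterlim_subseq[OF n], of y]
        y ym by (simp add: laws)
    then have "\<exists>x. (\<forall>i. x i \<in> V (n i) \<rightarrow>\<^sub>E space X) \<and>
        limitin (weak_star_topology (joint_topology G X dX Y dY))
             (\<lambda>i. empirical G (X \<Otimes>\<^sub>M Y) (V (n i)) (\<sigma> (n i)) (\<lambda>v\<in>V (n i). (x i v, y i v)))
             (graphical_joining G X \<mu> Y \<Phi>) sequentially"
      using surj[unfolded model_surjective_def, THEN spec, THEN spec, THEN mp] n y by simp
    then obtain x where x: "\<And>i. x i \<in> V (n i) \<rightarrow>\<^sub>E space X"
      and lim: "limitin (weak_star_topology (joint_topology G X dX Y dY))
             (\<lambda>i. empirical G (X \<Otimes>\<^sub>M Y) (V (n i)) (\<sigma> (n i)) (\<lambda>v\<in>V (n i). (x i v, y i v)))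
             (graphical_joining G X \<mu> Y \<Phi>) sequentially"
      by blast
    have mem: "(\<lambda>v\<in>V (n i). (x i v, y i v)) \<in> V (n i) \<rightarrow>\<^sub>E space (X \<Otimes>\<^sub>M Y)" for i
      using x[of i] y[of i] by (auto simp: space_pair_measure)
    have "models (prod_topology X.mtopology Y.mtopology) \<mu> (\<lambda>x. pair_up x (\<Phi> x)) sequentially n
        (\<lambda>i. \<lambda>v\<in>V (n i). (x i v, y i v))"
      using limitin_empirical[OF prod_alphabet P.prob_space_axioms pair_up_meas
          always_eventually[OF allI[OF mem]] filterlim_subseq[OF n]] lim
      by (simp add: top joint)
    then have "XY_models sequentially n x y" using joint_models_iff[of x n y, OF x y] by simp
    then show "\<exists>x. (\<forall>i. x i \<in> V (n i) \<rightarrow>\<^sub>E space X) \<and> XY_models sequentially n x y" using x by blast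
  qed
  then show ?thesis by (simp add: laws)
qed

theorem connected_model_spaces_isomorphic:
  assumes X: "metric_process G X \<mu> dX" and Y: "metric_process G Y \<nu> dY"
    and iso: "isomorphic_systems G \<mu> (shift G) \<nu> (shift G)"
  shows "connected_model_spaces G V \<sigma> X \<mu> dX \<longleftrightarrow> connected_model_spaces G V \<sigma> Y \<nu> dY"
proof -
  obtain \<Phi> \<Psi> where \<Phi>: "factor_map G \<mu> (shift G) \<nu> (shift G) \<Phi>" and \<Psi>: "\<Psi> \<in> \<nu> \<rightarrow>\<^sub>M \<mu>" "AE x in \<mu>. \<Psi> (\<Phi> x) = x"
    using iso unfolding isomorphic_systems_def by blast
  note joinings = factor_joinings(1)[OF X Y \<Phi>] factor_joinings(2)[OF X Y \<Phi> \<Psi>]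
  show ?thesis
    using connected_if_mutually_determined[OF joinings] connected_if_mutually_determined[OF joinings(2,1)]
    unfolding factor_laws[OF X Y \<Phi>] by blast
qed

end

lemma isomorphic_systems_refl: "isomorphic_systems G \<mu> T \<mu> T"
  unfolding isomorphic_systems_def factor_map_def
  by (intro exI[of _ "\<lambda>x. x"]) (simp add: distr_id)

theorem theoremA:
  fixes G :: "('g, 'm) monoid_scheme"
    and V :: "nat \<Rightarrow> 'v set"
    and \<sigma> :: "nat \<Rightarrow> 'g \<Rightarrow> 'v \<Rightarrow> 'v"
  assumes "group G" and "countable (carrier G)" and "sofic_approximation G V \<sigma>"
  shows
    "(\<forall>(X :: 'x measure) \<mu> dX (Y :: 'y measure) \<nu> dY \<Phi>.
        metric_process G X \<mu> dX \<and> metric_process G Y \<nu> dY \<and>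
        factor_map G \<mu> (shift G) \<nu> (shift G) \<Phi> \<and>
        connected_model_spaces G V \<sigma> X \<mu> dX \<and>
        model_surjective G V \<sigma> X \<mu> dX Y \<nu> dY \<Phi>
        \<longrightarrow> connected_model_spaces G V \<sigma> Y \<nu> dY) \<and>
     (\<forall>(X :: 'x measure) \<mu> d d'.
        metric_process G X \<mu> d \<and> metric_process G X \<mu> d'
        \<longrightarrow> (connected_model_spaces G V \<sigma> X \<mu> d \<longleftrightarrow> connected_model_spaces G V \<sigma> X \<mu> d')) \<and>
     (\<forall>(X :: 'x measure) \<mu> dX (Y :: 'y measure) \<nu> dY.
        metric_process G X \<mu> dX \<and> metric_process G Y \<nu> dY \<and>
        isomorphic_systems G \<mu> (shift G) \<nu> (shift G)
        \<longrightarrow> (connected_model_spaces G V \<sigma> X \<mu> dX \<longleftrightarrow> connected_model_spaces G V \<sigma> Y \<nu> dY))"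
proof -
  interpret group G by (fact assms(1))
  interpret sofic_group G V \<sigma> by unfold_locales (fact assms(2,3))+
  show ?thesis
  proof (intro conjI allI impI; elim conjE)
    fix X :: "'x measure" and \<mu> d d'
    assume X: "metric_process G X \<mu> d" "metric_process G X \<mu> d'"
    show "connected_model_spaces G V \<sigma> X \<mu> d \<longleftrightarrow> connected_model_spaces G V \<sigma> X \<mu> d'"
      by (intro connected_model_spaces_isomorphic[OF X] isomorphic_systems_refl)
  qed (fact connected_model_spaces_factor connected_model_spaces_isomorphic)+
qed

end
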